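(* Let $Q$ be an $(\mathcal{F}_t)_{t\ge0}$-Poisson point process on $(0,+\infty)\times(0,+\infty)$ with unit intensity. Let $h:(0,+\infty)\to\mathbb{R}$ be a signed measurable function, $\lambda>0$, and $N^0$ an ($\mathcal{F}_0$-measurable) initial condition in $\mathcal{N}((-\infty,0])$ with law $\mathfrak{m}$. Consider the equation $$(\mathrm{E}_h)\quad\begin{cases}N^h=N^0+\displaystyle\int_{(0,+\infty)\times(0,+\infty)}\delta_u\mathbf 1_{\{\theta\le\Lambda^h(u)\}}\,Q(du,d\theta),\\[2mm]\Lambda^h(u)=\Big(\lambda+\displaystyle\int_{(-\infty,u)}h(u-s)\,N^h(ds)\Big)^+,\quad u>0,\end{cases}$$ and the similar equation $(\mathrm{E}_{h^+})$ for $N^{h^+}$ (with the same $Q$, $\lambda$, $N^0$) in which $h$ is replaced by $h^+$. Assume that $\|h^+\|_1=\int_{(0,+\infty)}h^+(t)\,dt<1$ and that $$\forall t>0,\quad\int_0^t\mathbb{E}_{\mathfrak{m}}\Big(\int_{(-\infty,0]}h^+(u-s)\,N^0(ds)\Big)\,du<+\infty.$$ (a) There exists a pathwise unique strong solution $N^h$ of $(\mathrm{E}_h)$, and this solution is a Hawkes process on $(0,+\infty)$ with immigration rate $\lambda$, reproduction function $h$ and initial condition $N^0$. (b) The same holds for $N^{h^+}$ and $(\mathrm{E}_{h^+})$, and moreover $N^h\le N^{h^+}$ a.s. in the sense of measures.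
   Context: A filtered probability space $(\Omega,\mathcal{F},(\mathcal{F}_t)_{t\ge0},\mathbb{P})$ satisfying the usual conditions is given. For an interval $I\subset\mathbb{R}$, $\mathcal{N}(I)$ is the space of boundedly finite counting measures on $I$ (Borel measures with values in $\{0,1,\dots\}\cup\{+\infty\}$, finite on bounded sets), with the weak topology generated by continuous functions with bounded support and its Borel $\sigma$-field. $x^+=\max(x,0)$. $\mathbb{P}_{\mathfrak{m}},\mathbb{E}_{\mathfrak{m}}$ indicate that $N^0$ has law $\mathfrak{m}$. An $(\mathcal{F}_t)$-Poisson point process $Q$ on $(0,\infty)^2$ with unit intensity is such that for all $t,r,a>0$, $Q((t,t+r]\times(0,a])$ is $\mathcal{F}_{t+r}$-measurable, independent of $\mathcal{F}_t$, and Poisson of parameter $ra$. A Hawkes process on $(0,+\infty)$ with immigration rate $\lambda$, reproduction function $h$ (reproduction measure $h(t)\,dt$) and initial condition $N^0$ is a point process $N^h$ on $\mathbb{R}$ with $N^h|_{(-\infty,0]}=N^0$ and such that $N^h|_{(0,+\infty)}$ is adapted to $(\mathcal{F}_t)$, with conditional intensity measure w.r.t. $(\mathcal{F}_t)_{t\ge0}$ absolutely continuous with density $\Lambda^h(t)=\big(\lambda+\int_{(-\infty,t)}h(t-u)\,N^h(du)\big)^+$, $t>0$. *)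

theory Defs
  imports "HOL-Probability.Probability"
begin

section \<open>Filtered probability spaces\<close>

text \<open>Only the values \<open>F t\<close> with \<open>0 \<le> t\<close> are constrained, so time ranges over \<open>[0,\<infinity>)\<close>;
  this is why the library locale \<^locale>\<open>filtration\<close>, whose time set is a whole type, is not used.\<close>

locale usual_filtered_prob_space = prob_space M + complete_measure M for M :: "'w measure" +
  fixes F :: "real \<Rightarrow> 'w measure"
  assumes subalgebra_F: "0 \<le> t \<Longrightarrow> subalgebra M (F t)"
    and F_mono: "0 \<le> s \<Longrightarrow> s \<le> t \<Longrightarrow> sets (F s) \<subseteq> sets (F t)"
    and null_sets_F: "null_sets M \<subseteq> sets (F 0)"
    and F_right_continuous: "0 \<le> t \<Longrightarrow> sets (F t) = (\<Inter>s\<in>{t<..}. sets (F s))"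

definition predictable :: "'w measure \<Rightarrow> (real \<Rightarrow> 'w measure) \<Rightarrow> (real \<times> 'w) measure" where
  "predictable M F =
    sigma ({0<..} \<times> space M) {{s<..t} \<times> A | s t A. 0 \<le> s \<and> s \<le> t \<and> A \<in> sets (F s)}"


section \<open>Boundedly finite counting measures and point processes\<close>

definition counting_measures :: "'a::metric_space set \<Rightarrow> 'a measure set" where
  "counting_measures S = {\<mu>. sets \<mu> = sets (restrict_space borel S) \<and>
     (\<forall>A\<in>sets \<mu>. emeasure \<mu> A \<in> insert \<infinity> (range of_nat)) \<and>
     (\<forall>A\<in>sets \<mu>. bounded A \<longrightarrow> emeasure \<mu> A < \<infinity>)}"

definition weak_topology :: "real set \<Rightarrow> real measure topology" where
  "weak_topology I = topology_generated_by
     {{\<mu>\<in>counting_measures I. (\<integral>x. f x \<partial>\<mu>) \<in> U} | (f :: real \<Rightarrow> real) U.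
        continuous_on I f \<and> bounded {x\<in>I. f x \<noteq> 0} \<and> open U}"

definition counting_borel :: "real set \<Rightarrow> real measure measure" where
  "counting_borel I = sigma (counting_measures I) {U. openin (weak_topology I) U}"

definition adapted_on_pos :: "(real \<Rightarrow> 'w measure) \<Rightarrow> ('w \<Rightarrow> real measure) \<Rightarrow> bool" where
  "adapted_on_pos F N \<longleftrightarrow>
    (\<forall>t\<ge>0. \<forall>A\<in>sets borel. A \<subseteq> {0<..t} \<longrightarrow> (\<lambda>\<omega>. emeasure (N \<omega>) A) \<in> borel_measurable (F t))"

text \<open>\<open>\<nu>\<close> is the predictable compensator (dual predictable projection) of the random measure \<open>N\<close>
  on \<open>(0,\<infinity>)\<close>.\<close>

definition conditional_intensity_measure ::
  "'w measure \<Rightarrow> (real \<Rightarrow> 'w measure) \<Rightarrow> ('w \<Rightarrow> real measure) \<Rightarrow> ('w \<Rightarrow> real measure) \<Rightarrow> bool" where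
  "conditional_intensity_measure M F N \<nu> \<longleftrightarrow>
    (\<forall>\<omega>\<in>space M. sets (\<nu> \<omega>) = sets (restrict_space borel {0<..})) \<and>
    (AE \<omega> in M. \<forall>t>0. emeasure (\<nu> \<omega>) {0<..t} < \<infinity>) \<and>
    (\<lambda>(t, \<omega>). emeasure (\<nu> \<omega>) {0<..t}) \<in> borel_measurable (predictable M F) \<and>
    (\<forall>C::real \<times> 'w \<Rightarrow> ennreal. C \<in> borel_measurable (predictable M F) \<longrightarrow>
       (\<integral>\<^sup>+\<omega>. (\<integral>\<^sup>+t. C (t, \<omega>) \<partial>N \<omega>) \<partial>M) = (\<integral>\<^sup>+\<omega>. (\<integral>\<^sup>+t. C (t, \<omega>) \<partial>\<nu> \<omega>) \<partial>M))"

definition poisson_point_process ::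
  "'w measure \<Rightarrow> (real \<Rightarrow> 'w measure) \<Rightarrow> ('w \<Rightarrow> (real \<times> real) measure) \<Rightarrow> bool" where
  "poisson_point_process M F Q \<longleftrightarrow>
    (\<forall>\<omega>\<in>space M. Q \<omega> \<in> counting_measures ({0<..} \<times> {0<..})) \<and>
    (\<forall>t>0. \<forall>r>0. \<forall>a>0. let X = (\<lambda>\<omega>. emeasure (Q \<omega>) ({t<..t + r} \<times> {0<..a})) in
       X \<in> borel_measurable (F (t + r)) \<and>
       prob_space.indep_set M (sets (vimage_algebra (space M) X borel)) (sets (F t)) \<and>
       distr M borel X = distr (measure_pmf (poisson_pmf (r * a))) borel of_nat)"


section \<open>Hawkes processes\<close>

text \<open>The integral of \<open>f\<close> over \<open>A\<close> as an extended real. It is \<open>-\<infinity>\<close> when only the negative part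
  diverges; the Bochner integral would return \<open>0\<close> in that case. If both parts diverge, the
  integral is undefined in the mathematics and equals \<open>\<infinity>\<close> here.\<close>

definition signed_integral :: "'a measure \<Rightarrow> 'a set \<Rightarrow> ('a \<Rightarrow> real) \<Rightarrow> ereal" where
  "signed_integral \<mu> A f =
    enn2ereal (\<integral>\<^sup>+x\<in>A. ennreal (f x) \<partial>\<mu>) - enn2ereal (\<integral>\<^sup>+x\<in>A. ennreal (- f x) \<partial>\<mu>)"

text \<open>Since \<open>u - s > 0\<close> for \<open>s < u\<close>, only the values of \<open>h\<close> on \<open>(0,\<infinity>)\<close> matter.\<close>

definition hawkes_intensity :: "real \<Rightarrow> (real \<Rightarrow> real) \<Rightarrow> real measure \<Rightarrow> real \<Rightarrow> ennreal" where
  "hawkes_intensity lam h \<mu> u =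
    e2ennreal (max (ereal lam + signed_integral \<mu> {..<u} (\<lambda>s. h (u - s))) 0)"

definition hawkes_process ::
  "'w measure \<Rightarrow> (real \<Rightarrow> 'w measure) \<Rightarrow> real \<Rightarrow> (real \<Rightarrow> real) \<Rightarrow> ('w \<Rightarrow> real measure) \<Rightarrow>
    ('w \<Rightarrow> real measure) \<Rightarrow> bool" where
  "hawkes_process M F lam h N0 N \<longleftrightarrow>
    N \<in> measurable M (counting_borel UNIV) \<and>
    (AE \<omega> in M. restrict_space (N \<omega>) {..0} = N0 \<omega>) \<and>
    adapted_on_pos F N \<and>
    conditional_intensity_measure M F (\<lambda>\<omega>. restrict_space (N \<omega>) {0<..})
      (\<lambda>\<omega>. density (restrict_space lborel {0<..}) (hawkes_intensity lam h (N \<omega>)))"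


section \<open>The equation driven by the Poisson point process\<close>

text \<open>The equation between measures is evaluated at each Borel set \<open>A\<close>: the Dirac mass \<open>\<delta>\<^sub>u\<close>
  contributes \<open>indicator A u\<close>.\<close>

definition solution ::
  "'w measure \<Rightarrow> (real \<Rightarrow> 'w measure) \<Rightarrow> ('w \<Rightarrow> (real \<times> real) measure) \<Rightarrow> real \<Rightarrow> (real \<Rightarrow> real) \<Rightarrow>
    ('w \<Rightarrow> real measure) \<Rightarrow> ('w \<Rightarrow> real measure) \<Rightarrow> bool" where
  "solution M F Q lam h N0 N \<longleftrightarrow>
    N \<in> measurable M (counting_borel UNIV) \<and>
    adapted_on_pos F N \<and>
    (AE \<omega> in M. \<forall>A\<in>sets borel. emeasure (N \<omega>) A = emeasure (N0 \<omega>) (A \<inter> {..0}) +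
       (\<integral>\<^sup>+(u, \<theta>). indicator A u * of_bool (ennreal \<theta> \<le> hawkes_intensity lam h (N \<omega>) u) \<partial>Q \<omega>))"

text \<open>The filtration generated by the data \<open>N0\<close>, \<open>Q\<close> and augmented by the null sets. As for
  strong solutions of stochastic differential equations, a solution is strong if it is adapted to
  this filtration, whereas pathwise uniqueness is required among all \<open>F\<close>-adapted solutions.\<close>

definition data_filtration ::
  "'w measure \<Rightarrow> ('w \<Rightarrow> (real \<times> real) measure) \<Rightarrow> ('w \<Rightarrow> real measure) \<Rightarrow> real \<Rightarrow> 'w measure" where
  "data_filtration M Q N0 t = sigma (space M)
    ({N0 -` B \<inter> space M | B. B \<in> sets (counting_borel {..0})} \<union>
     {(\<lambda>\<omega>. emeasure (Q \<omega>) A) -` B \<inter> space M | A B.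
        A \<in> sets borel \<and> A \<subseteq> {0<..t} \<times> {0<..} \<and> B \<in> sets borel} \<union>
     null_sets M)"

definition strong_solution ::
  "'w measure \<Rightarrow> (real \<Rightarrow> 'w measure) \<Rightarrow> ('w \<Rightarrow> (real \<times> real) measure) \<Rightarrow> real \<Rightarrow> (real \<Rightarrow> real) \<Rightarrow>
    ('w \<Rightarrow> real measure) \<Rightarrow> ('w \<Rightarrow> real measure) \<Rightarrow> bool" where
  "strong_solution M F Q lam h N0 N \<longleftrightarrow>
    solution M F Q lam h N0 N \<and> adapted_on_pos (data_filtration M Q N0) N"

definition pathwise_unique ::
  "'w measure \<Rightarrow> (real \<Rightarrow> 'w measure) \<Rightarrow> ('w \<Rightarrow> (real \<times> real) measure) \<Rightarrow> real \<Rightarrow> (real \<Rightarrow> real) \<Rightarrow>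
    ('w \<Rightarrow> real measure) \<Rightarrow> bool" where
  "pathwise_unique M F Q lam h N0 \<longleftrightarrow>
    (\<forall>N N'. solution M F Q lam h N0 N \<longrightarrow> solution M F Q lam h N0 N' \<longrightarrow>
       (AE \<omega> in M. N \<omega> = N' \<omega>))"

end

theory Submission
  imports Defs
begin

text \<open>A point process that solves the equation is determined by its intensity, and the intensity at time
\<open>u\<close> depends only on the points before \<open>u\<close>. So the equation is a fixed point equation for intensities
\<open>l\<close>: accept the points \<open>(s, \<theta>)\<close> of \<open>Q\<close> with \<open>\<theta> \<le> l s\<close>, compute from these points and from \<open>N0\<close> the
intensity prescribed by the model (\<open>next_intensity\<close>), and ask that the result is \<open>l\<close> again. Everything
below follows from combining this with two facts.

Pathwise fact. On a bounded interval a boundedly finite counting measure has finitely many points,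
and causality determines the process from one point to the next. The induction rule
\<open>counting_increments_induct\<close> expresses this without listing the points: a statement about \<open>(0, t]\<close> is
proved from the statement for all times before \<open>\<tau>\<close>, where no point lies in \<open>(\<tau>, t]\<close>. It yields that two
solutions agree (\<open>path_unique\<close>), that the solution for \<open>h\<close> is below the one for the positive part of
\<open>h\<close> (\<open>path_domination\<close>), and that the Picard iterates of the fixed point equation become constant after
finitely many steps on each bounded interval, as soon as all points that some iterate accepts lie in
a locally finite set (\<open>picard_stabilises\<close>).

Probabilistic fact. If \<open>l\<close> is predictable, the accepted points have compensator \<open>l u du\<close>
(\<open>compensation_formula\<close>, \<open>thinning_compensator\<close>). It is enough to compare the two sides on rectangles
\<open>(s, t] \<times> A \<times> (0, b]\<close> with \<open>A\<close> in the past of \<open>s\<close>, where it is the mean of a Poisson variable that is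
independent of the past.

The Picard iterates \<open>l n\<close> for the positive part of \<open>h\<close> increase with \<open>n\<close> and dominate the iterates for
\<open>h\<close>. By the compensation formula, the mean number \<open>x n\<close> of points accepted up to time \<open>t\<close> satisfies
\<open>x (n + 1) \<le> a + r * x n\<close>, where \<open>a\<close> is finite by the assumption on \<open>N0\<close> and \<open>r < 1\<close> is the total mass of
the positive part of \<open>h\<close> (\<open>picard_mean_bound\<close>). So \<open>x n\<close> is bounded, almost surely only finitely many
points are ever accepted on a bounded interval, and the iterates for \<open>h\<close> stabilise. Their limit is
predictable for the filtration of the data, which makes the solution strong, and the compensation
formula identifies its conditional intensity. By uniqueness this holds for every solution.

The rest is measurability. Integrals with respect to the random measures are measurable functions of
the parameters (\<open>borel_measurable_kernel_nn_integral\<close>), and the weak topology on counting measures is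
generated by counts on countably many intervals (\<open>measurable_counting_borelI\<close>).\<close>

section \<open>Kernels\<close>

text \<open>Restricted to \<open>E i\<close> and divided by \<open>1 + emeasure (K z) (E i)\<close>, the kernel becomes a measurable map into
the subprobability measures, for which the claim is known. The factor is measurable and
finite, so it can be put back, and the sets \<open>E i\<close> exhaust the space.\<close>

lemma borel_measurable_kernel_nn_integral:
  fixes K :: "'z \<Rightarrow> 'x measure"
  assumes sets: "\<And>z. z \<in> space P \<Longrightarrow> sets (K z) = sets N"
    and E: "\<And>i::nat. E i \<in> sets N" "incseq E" "(\<Union>i. E i) = space N"
    and fin: "\<And>z i. z \<in> space P \<Longrightarrow> emeasure (K z) (E i) < \<infinity>"
    and meas: "\<And>i A. A \<in> sets N \<Longrightarrow> A \<subseteq> E i \<Longrightarrow> (\<lambda>z. emeasure (K z) A) \<in> borel_measurable P"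
    and f: "case_prod f \<in> borel_measurable (P \<Otimes>\<^sub>M N)"
  shows "(\<lambda>z. \<integral>\<^sup>+x. f z x \<partial>K z) \<in> borel_measurable P"
proof (cases "space N = {}")
  case True
  have "(\<integral>\<^sup>+x. f z x \<partial>K z) = 0" if "z \<in> space P" for z
    using sets_eq_imp_space_eq[OF sets[OF that]] True by (simp add: nn_integral_empty)
  then show ?thesis by (simp cong: measurable_cong)
next
  case False
  have sp: "space (K z) = space N" if "z \<in> space P" for z
    using sets[OF that] by (rule sets_eq_imp_space_eq)
  have EK[measurable]: "E i \<in> sets (K z)" if "z \<in> space P" for i z using E(1) sets[OF that] by simp
  define c where "c = (\<lambda>i z. 1 + emeasure (K z) (E i))"
  have c[measurable]: "c i \<in> borel_measurable P" for i
    unfolding c_def using meas[OF E(1) order.refl] by measurable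
  have c0: "c i z \<noteq> 0" "c i z \<noteq> \<infinity>" if "z \<in> space P" for i z
    using fin[OF that, of i] by (auto simp: c_def)
  define L where "L = (\<lambda>i z. density (K z) (\<lambda>x. indicator (E i) x / c i z))"
  have intL: "(\<integral>\<^sup>+x. g x \<partial>L i z) = (\<integral>\<^sup>+x. g x * indicator (E i) x \<partial>K z) / c i z"
    if z: "z \<in> space P" and g: "g \<in> borel_measurable N" for g i z
  proof -
    note [measurable] = EK[OF z]
    have [measurable]: "g \<in> borel_measurable (K z)" using g by (simp add: measurable_cong_sets[OF sets[OF z] refl])
    have "(\<integral>\<^sup>+x. g x \<partial>L i z) = (\<integral>\<^sup>+x. indicator (E i) x / c i z * g x \<partial>K z)"
      unfolding L_def by (rule nn_integral_density) measurable
    also have "\<dots> = (\<integral>\<^sup>+x. g x * indicator (E i) x / c i z \<partial>K z)"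
      by (intro nn_integral_cong) (simp add: divide_ennreal_def mult_ac)
    also have "\<dots> = (\<integral>\<^sup>+x. g x * indicator (E i) x \<partial>K z) / c i z" by (rule nn_integral_divide) measurable
    finally show ?thesis .
  qed
  have emL: "emeasure (L i z) A = emeasure (K z) (A \<inter> E i) / c i z" if z: "z \<in> space P" and A: "A \<in> sets N" for A i z
  proof -
    have "emeasure (L i z) A = (\<integral>\<^sup>+x. indicator A x \<partial>L i z)" using A sets[OF z] by (simp add: L_def)
    also have "\<dots> = (\<integral>\<^sup>+x. indicator (A \<inter> E i) x \<partial>K z) / c i z"
      using intL[OF z, of "indicator A" i] A by (simp add: indicator_inter_arith)
    finally show ?thesis using A sets[OF z] E(1) by simp
  qed
  have L: "L i \<in> measurable P (subprob_algebra N)" for i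
  proof (rule measurable_subprob_algebra)
    fix z assume z: "z \<in> space P"
    show "sets (L i z) = sets N" using sets[OF z] by (simp add: L_def)
    show "subprob_space (L i z)"
    proof
      have "emeasure (L i z) (space N) \<le> c i z / c i z"
        unfolding emL[OF z sets.top] using sets.sets_into_space[OF E(1)]
        by (intro divide_right_mono_ennreal) (simp add: c_def Int_absorb1)
      then show "emeasure (L i z) (space (L i z)) \<le> 1" using ennreal_divide_self[of "c i z"] c0[OF z, of i] sp[OF z] by (simp add: L_def less_top)
      show "space (L i z) \<noteq> {}" using False sp[OF z] by (simp add: L_def)
    qed
  next
    fix A assume A: "A \<in> sets N"
    have "(\<lambda>z. emeasure (K z) (A \<inter> E i) / c i z) \<in> borel_measurable P"
      using meas[of "A \<inter> E i" i] A E(1) by (intro borel_measurable_divide_ennreal c) auto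
    then show "(\<lambda>z. emeasure (L i z) A) \<in> borel_measurable P"
      by (subst measurable_cong[OF emL[OF _ A]])
  qed
  have "(\<integral>\<^sup>+x. f z x \<partial>K z) = (SUP i. c i z * (\<integral>\<^sup>+x. f z x \<partial>L i z))" if z: "z \<in> space P" for z
  proof -
    have fz: "f z \<in> borel_measurable N" using measurable_Pair2[OF f z] by simp
    have [measurable]: "f z \<in> borel_measurable (K z)" using fz by (simp add: measurable_cong_sets[OF sets[OF z] refl])
    note [measurable] = EK[OF z]
    have "c i z * (\<integral>\<^sup>+x. f z x \<partial>L i z) = (\<integral>\<^sup>+x. f z x * indicator (E i) x \<partial>K z)" for i
      unfolding intL[OF z fz] ennreal_times_divide using c0[OF z, of i]
      by (subst mult.commute) (simp add: ennreal_mult_divide_eq)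
    moreover have "(SUP i. \<integral>\<^sup>+x. f z x * indicator (E i) x \<partial>K z) = (\<integral>\<^sup>+x. (SUP i. f z x * indicator (E i) x) \<partial>K z)"
      using E(2) by (intro nn_integral_monotone_convergence_SUP[symmetric]) (auto simp: incseq_def le_fun_def indicator_def)
    moreover have "(SUP i. f z x * indicator (E i) x) = f z x" if x: "x \<in> space (K z)" for x
    proof -
      obtain i where i: "x \<in> E i" using E(3) sp[OF z] x by auto
      have "f z x \<le> (SUP i. f z x * indicator (E i) x)" using i by (intro SUP_upper2[of i]) auto
      moreover have "(SUP i. f z x * indicator (E i) x) \<le> f z x" by (rule SUP_least) (simp add: indicator_def)
      ultimately show ?thesis by (rule antisym[rotated])
    qed
    ultimately show ?thesis by (simp cong: nn_integral_cong_simp)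
  qed
  moreover have "(\<lambda>z. SUP i. c i z * (\<integral>\<^sup>+x. f z x \<partial>L i z)) \<in> borel_measurable P"
    using nn_integral_measurable_subprob_algebra2[OF f L] by measurable
  ultimately show ?thesis by (subst measurable_cong)
qed

text \<open>A Dynkin system argument. Inside a set \<open>E\<close> of finite mass the complement corresponds to a
subtraction, which preserves measurability.\<close>

lemma borel_measurable_kernel_emeasure:
  fixes K :: "'z \<Rightarrow> 'x measure"
  assumes G: "Int_stable G" "G \<subseteq> Pow Z" and setsN: "sets N = sigma_sets Z G"
    and sets: "\<And>z. z \<in> space P \<Longrightarrow> sets (K z) = sets N"
    and E: "E \<in> sets N" and fin: "\<And>z. z \<in> space P \<Longrightarrow> emeasure (K z) E < \<infinity>"
    and meas: "\<And>A. A \<in> G \<Longrightarrow> (\<lambda>z. emeasure (K z) (A \<inter> E)) \<in> borel_measurable P"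
    and measE: "(\<lambda>z. emeasure (K z) E) \<in> borel_measurable P"
    and A: "A \<in> sets N"
  shows "(\<lambda>z. emeasure (K z) (A \<inter> E)) \<in> borel_measurable P"
proof -
  have "A \<in> sigma_sets Z G" using A setsN by simp
  with G show ?thesis
  proof (induct rule: sigma_sets_induct_disjoint)
    case (basic A) then show ?case by (rule meas)
  next
    case empty then show ?case by simp
  next
    case (compl A)
    have EZ: "E \<subseteq> Z" using E setsN sigma_sets_into_sp[OF G(2)] by auto
    have "emeasure (K z) ((Z - A) \<inter> E) = emeasure (K z) E - emeasure (K z) (A \<inter> E)" if z: "z \<in> space P" for z
    proof -
      have [measurable]: "E \<in> sets (K z)" "A \<in> sets (K z)" using E compl(1) setsN sets[OF z] by auto
      have "(Z - A) \<inter> E = E - A \<inter> E" using EZ by auto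
      moreover have "emeasure (K z) (A \<inter> E) \<le> emeasure (K z) E" by (rule emeasure_mono) auto
      then have "emeasure (K z) (A \<inter> E) \<noteq> \<infinity>" using fin[OF z] by auto
      ultimately show ?thesis by (simp add: emeasure_Diff)
    qed
    moreover have "(\<lambda>z. emeasure (K z) E - emeasure (K z) (A \<inter> E)) \<in> borel_measurable P"
      using measE compl(2) by simp
    ultimately show ?case by (simp cong: measurable_cong)
  next
    case (union A)
    have "emeasure (K z) ((\<Union>i. A i) \<inter> E) = (\<Sum>i. emeasure (K z) (A i \<inter> E))" if z: "z \<in> space P" for z
    proof -
      have [measurable]: "E \<in> sets (K z)" "A i \<in> sets (K z)" for i using E union(2) setsN sets[OF z] by auto
      have "(\<Sum>i. emeasure (K z) (A i \<inter> E)) = emeasure (K z) (\<Union>i. A i \<inter> E)"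
        using union(1) by (intro suminf_emeasure) (auto simp: disjoint_family_on_def)
      moreover have "(\<Union>i. A i \<inter> E) = (\<Union>i. A i) \<inter> E" by auto
      ultimately show ?thesis by (simp only:)
    qed
    moreover have "(\<lambda>z. \<Sum>i. emeasure (K z) (A i \<inter> E)) \<in> borel_measurable P"
      using union(3)[measurable] by measurable
    ultimately show ?case by (simp cong: measurable_cong)
  qed
qed

section \<open>Counting measures and the weak topology\<close>

lemma counting_measuresD:
  assumes "\<mu> \<in> counting_measures S"
  shows "sets \<mu> = sets (restrict_space borel S)" "space \<mu> = S"
    "A \<in> sets \<mu> \<Longrightarrow> emeasure \<mu> A \<in> insert \<infinity> (range of_nat)"
    "A \<in> sets \<mu> \<Longrightarrow> bounded A \<Longrightarrow> emeasure \<mu> A < \<infinity>"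
proof -
  show s: "sets \<mu> = sets (restrict_space borel S)" using assms unfolding counting_measures_def by blast
  show "space \<mu> = S" using sets_eq_imp_space_eq[OF s] by (simp add: space_restrict_space)
  show "A \<in> sets \<mu> \<Longrightarrow> emeasure \<mu> A \<in> insert \<infinity> (range of_nat)"
    "A \<in> sets \<mu> \<Longrightarrow> bounded A \<Longrightarrow> emeasure \<mu> A < \<infinity>"
    using assms unfolding counting_measures_def by blast+
qed

lemma space_counting_borel: "space (counting_borel I) = counting_measures I"
  unfolding counting_borel_def by (rule space_measure_of_conv)

lemma openin_weak_topology_subset: "openin (weak_topology I) U \<Longrightarrow> U \<subseteq> counting_measures I"
  using openin_subset[of "weak_topology I" U] unfolding weak_topology_def by auto

lemma sets_counting_borel: "sets (counting_borel I) = sigma_sets (counting_measures I) {U. openin (weak_topology I) U}"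
  unfolding counting_borel_def using openin_weak_topology_subset by (intro sets_measure_of) auto

lemma borel_measurable_counting_integral:
  fixes f :: "real \<Rightarrow> real"
  assumes "continuous_on I f" "bounded {x\<in>I. f x \<noteq> 0}"
  shows "(\<lambda>\<mu>. \<integral>x. f x \<partial>\<mu>) \<in> borel_measurable (counting_borel I)"
proof (rule borel_measurableI)
  fix U :: "real set" assume U: "open U"
  have "openin (weak_topology I) {\<mu> \<in> counting_measures I. (\<integral>x. f x \<partial>\<mu>) \<in> U}"
    unfolding weak_topology_def by (rule topology_generated_by_Basis) (use assms U in blast)
  moreover have "(\<lambda>\<mu>. \<integral>x. f x \<partial>\<mu>) -` U \<inter> space (counting_borel I) = {\<mu> \<in> counting_measures I. (\<integral>x. f x \<partial>\<mu>) \<in> U}"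
    by (auto simp: space_counting_borel)
  ultimately show "(\<lambda>\<mu>. \<integral>x. f x \<partial>\<mu>) -` U \<inter> space (counting_borel I) \<in> sets (counting_borel I)"
    by (auto simp: sets_counting_borel)
qed

lemma sets_restrict_borel: "S \<in> sets borel \<Longrightarrow> A \<in> sets (restrict_space borel S) \<longleftrightarrow> A \<in> sets borel \<and> A \<subseteq> S"
  by (subst sets_restrict_space_iff) auto

text \<open>The indicator of \<open>[a, 0]\<close> is the decreasing limit of continuous piecewise linear functions. On the
half-line up to \<open>0\<close> these have bounded support, so their integrals are measurable by definition.\<close>

lemma counting_borel_emeasure_halfline:
  "(\<lambda>\<mu>. emeasure \<mu> {a..0::real}) \<in> borel_measurable (counting_borel {..0})"
proof -
  define f where "f = (\<lambda>n x. max 0 (min 1 (1 + real (Suc n) * (x - a))))"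
  have meas: "(\<lambda>\<mu>. \<integral>x. f n x \<partial>\<mu>) \<in> borel_measurable (counting_borel {..0})" for n
  proof (rule borel_measurable_counting_integral)
    show "continuous_on {..0} (f n)" unfolding f_def by (intro continuous_intros)
    have "x \<in> {a - 1..0}" if "x \<le> 0" "f n x \<noteq> 0" for x
    proof -
      have "real (Suc n) * (x - a) > -1"
        using that(2) by (auto simp: f_def max_def min_def simp del: of_nat_Suc split: if_splits)
      moreover have "real (Suc n) * (x - a) \<le> x - a" if "x < a"
        using that mult_right_mono_neg[of 1 "real (Suc n)" "x - a"] by simp
      ultimately have "x \<ge> a - 1" by (cases "x < a"; linarith)
      then show ?thesis using that by simp
    qed
    then have "{x \<in> {..0}. f n x \<noteq> 0} \<subseteq> {a - 1..0}" by auto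
    then show "bounded {x \<in> {..0}. f n x \<noteq> 0}" using bounded_subset bounded_closed_interval by blast
  qed
  have lim: "(\<lambda>n. \<integral>x. f n x \<partial>\<mu>) \<longlonglongrightarrow> measure \<mu> {a..0}" if "\<mu> \<in> counting_measures {..0}" for \<mu>
  proof -
    note D = counting_measuresD[OF that]
    have mI: "B \<in> sets \<mu>" if "B \<in> sets borel" "B \<subseteq> {..0}" for B using that D(1) by (simp add: sets_restrict_borel)
    have fm: "f n \<in> borel_measurable \<mu>" for n
      unfolding f_def measurable_cong_sets[OF D(1) refl] by (rule measurable_restrict_space1) measurable
    have e: "measure \<mu> {a..0} = (\<integral>x. indicator {a..} x \<partial>\<mu>)"
    proof -
      have "(\<integral>x. indicator {a..} x \<partial>\<mu>) = (\<integral>x. indicator {a..0} x \<partial>\<mu>)"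
        by (rule Bochner_Integration.integral_cong) (auto simp: D(2) indicator_def)
      also have "\<dots> = measure \<mu> ({a..0} \<inter> space \<mu>)" by simp
      finally show ?thesis using D(2) by (simp add: Int_absorb2)
    qed
    show ?thesis unfolding e
    proof (rule integral_dominated_convergence[where w="indicator {a-1..0}"])
      show "(indicator {a..} :: real \<Rightarrow> real) \<in> borel_measurable \<mu>"
        unfolding measurable_cong_sets[OF D(1) refl] by (rule measurable_restrict_space1) measurable
      show "integrable \<mu> (indicator {a-1..0} :: real \<Rightarrow> real)"
        using D(4)[of "{a-1..0}"] mI[of "{a-1..0}"] by (intro integrable_real_indicator) auto
      have "(\<lambda>n. f n x) \<longlonglongrightarrow> indicator {a..} x" for x
      proof (cases "a \<le> x")
        case True
        have "1 \<le> 1 + real (Suc n) * (x - a)" for n using True by simp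
        then have "f n x = 1" for n by (simp add: f_def min_def del: of_nat_Suc)
        with True show ?thesis by simp
      next
        case False
        then obtain m :: nat where m: "1 < real m * (a - x)" using reals_Archimedean3[of "a - x"] by auto
        have "f n x = 0" if "n \<ge> m" for n
        proof -
          have "real m * (a - x) \<le> real (Suc n) * (a - x)" using that False by (intro mult_right_mono) auto
          then have "1 + real (Suc n) * (x - a) \<le> 0" using m by (simp add: algebra_simps)
          then show ?thesis by (simp add: f_def max_def min_def del: of_nat_Suc)
        qed
        then have "\<forall>\<^sub>F n in sequentially. f n x = 0" by (auto simp: eventually_sequentially)
        then show ?thesis using False by (simp add: tendsto_eventually)
      qed
      then show "AE x in \<mu>. (\<lambda>n. f n x) \<longlonglongrightarrow> indicator {a..} x" by simp
      fix n
      have "norm (f n x) \<le> indicator {a-1..0} x" if "x \<le> 0" for x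
      proof (cases "x < a - 1")
        case True
        have "real (Suc n) * (x - a) \<le> x - a" using True mult_right_mono_neg[of 1 "real (Suc n)" "x - a"] by simp
        then have "1 + real (Suc n) * (x - a) \<le> 0" using True by linarith
        then show ?thesis by (simp add: f_def max_def min_def del: of_nat_Suc)
      qed (use that in \<open>auto simp: f_def\<close>)
      then show "AE x in \<mu>. norm (f n x) \<le> indicator {a-1..0} x" using D(2) by auto
    qed (rule fm)
  qed
  have "(\<lambda>\<mu>. measure \<mu> {a..0}) \<in> borel_measurable (counting_borel {..0})"
    by (rule borel_measurable_LIMSEQ_metric[OF meas]) (use lim space_counting_borel in auto)
  then have m: "(\<lambda>\<mu>. ennreal (measure \<mu> {a..0})) \<in> borel_measurable (counting_borel {..0})" by measurable
  have e: "emeasure \<mu> {a..0} = ennreal (measure \<mu> {a..0})" if "\<mu> \<in> counting_measures {..0}" for \<mu>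
  proof (rule emeasure_eq_ennreal_measure)
    note D = counting_measuresD[OF that]
    have "{a..0} \<in> sets \<mu>" using D(1) by (auto simp: sets_restrict_borel)
    then show "emeasure \<mu> {a..0} \<noteq> top" using D(4)[of "{a..0}"] by auto
  qed
  show ?thesis
    by (subst measurable_cong[OF e]) (simp_all only: space_counting_borel m)
qed

text \<open>The closed half-lines \<open>[a, \<infinity>)\<close> generate the Borel sets and are stable under intersection. The windows
\<open>[- n, 0]\<close> have finite mass and exhaust the half-line.\<close>

lemma counting_borel_emeasure:
  assumes A: "A \<in> sets (borel :: real measure)"
  shows "(\<lambda>\<mu>. emeasure \<mu> (A \<inter> {..0})) \<in> borel_measurable (counting_borel {..0})"
proof -
  let ?P = "counting_borel {..0::real}"
  let ?K = "\<lambda>\<mu>. distr \<mu> borel (\<lambda>x::real. x)"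
  have em: "emeasure (?K \<mu>) B = emeasure \<mu> (B \<inter> {..0})" if "\<mu> \<in> space ?P" "B \<in> sets borel" for \<mu> B
  proof -
    note D = counting_measuresD[OF that(1)[unfolded space_counting_borel]]
    have "(\<lambda>x. x) \<in> measurable \<mu> borel"
      unfolding measurable_cong_sets[OF D(1) refl] by (rule measurable_restrict_space1) simp
    from emeasure_distr[OF this that(2)] show ?thesis by (simp add: D(2))
  qed
  have 1: "(\<lambda>\<mu>. emeasure (?K \<mu>) (A \<inter> {- real n..0})) \<in> borel_measurable ?P" for n
  proof (rule borel_measurable_kernel_emeasure[where Z=UNIV and G="range (\<lambda>a. {a..})" and N=borel])
    show "Int_stable (range (\<lambda>a::real. {a..}))"
    proof (rule Int_stableI)
      fix A B assume "A \<in> range (\<lambda>a::real. {a..})" "B \<in> range (\<lambda>a::real. {a..})"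
      then obtain a b where "A = {a..}" "B = {b..}" by auto
      then have "A \<inter> B = {max a b..}" by auto
      then show "A \<inter> B \<in> range (\<lambda>a::real. {a..})" by auto
    qed
    show "sets (borel :: real measure) = sigma_sets UNIV (range atLeast)"
      by (subst borel_Ici) simp
    fix \<mu> assume \<mu>: "\<mu> \<in> space ?P"
    then show "sets (?K \<mu>) = sets borel" by simp
    note D = counting_measuresD[OF \<mu>[unfolded space_counting_borel]]
    have "{-real n..0} \<in> sets \<mu>" using D(1) by (auto simp: sets_restrict_borel)
    then show "emeasure (?K \<mu>) {- real n..0} < \<infinity>" using D(4)[of "{- real n..0}"] em[OF \<mu>, of "{-real n..0}"]
      by (simp add: Int_absorb2)
  next
    fix B assume "B \<in> range (\<lambda>a::real. {a..})"
    then obtain a where a: "B = {a..}" by auto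
    have "emeasure (?K \<mu>) (B \<inter> {- real n..0}) = emeasure \<mu> {max a (- real n)..0}" if "\<mu> \<in> space ?P" for \<mu>
    proof -
      have "B \<inter> {- real n..0} = {max a (- real n)..0}" "B \<inter> {- real n..0} \<inter> {..0} = B \<inter> {- real n..0}" using a by auto
      then show ?thesis using em[OF that, of "B \<inter> {- real n..0}"] by (metis borel_closed closed_real_atLeastAtMost)
    qed
    then show "(\<lambda>\<mu>. emeasure (?K \<mu>) (B \<inter> {- real n..0})) \<in> borel_measurable ?P"
      using counting_borel_emeasure_halfline by (simp cong: measurable_cong)
  next
    have "emeasure (?K \<mu>) {- real n..0} = emeasure \<mu> {- real n..0}" if "\<mu> \<in> space ?P" for \<mu>
      using em[OF that, of "{- real n..0}"] by (simp add: Int_absorb2)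
    then show "(\<lambda>\<mu>. emeasure (?K \<mu>) {- real n..0}) \<in> borel_measurable ?P"
      using counting_borel_emeasure_halfline by (simp cong: measurable_cong)
  qed (use A in auto)
  have "emeasure \<mu> (A \<inter> {..0}) = (SUP n. emeasure (?K \<mu>) (A \<inter> {- real n..0}))" if \<mu>: "\<mu> \<in> space ?P" for \<mu>
  proof -
    have "(SUP n. emeasure (?K \<mu>) (A \<inter> {- real n..0})) = emeasure (?K \<mu>) (\<Union>n. A \<inter> {- real n..0})"
      using A by (intro SUP_emeasure_incseq) (auto simp: incseq_def)
    also have "(\<Union>n. A \<inter> {- real n..0}) = A \<inter> {..0}"
    proof -
      have "\<exists>n. - real n \<le> x" for x using real_arch_simple[of "-x"] by (metis minus_le_iff)
      then show ?thesis by auto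
    qed
    also have "emeasure (?K \<mu>) (A \<inter> {..0}) = emeasure \<mu> (A \<inter> {..0})"
      using em[OF \<mu>, of "A \<inter> {..0}"] A by (simp add: Int_assoc)
    finally show ?thesis by simp
  qed
  then show ?thesis using 1 by (simp cong: measurable_cong)
qed

text \<open>On a window that contains the support of \<open>f\<close>, uniform continuity makes the integral of \<open>f\<close> close to a
Riemann sum, and the Riemann sum only involves the masses of finitely many intervals with rational
endpoints. The window itself is added to these intervals because its mass controls the error.\<close>

lemma counting_integral_close:
  fixes f :: "real \<Rightarrow> real"
  assumes cont: "continuous_on UNIV f" and bdd: "bounded {x. f x \<noteq> 0}"
    and \<mu>: "\<mu> \<in> counting_measures UNIV" and e: "e > 0"
  obtains I :: "(rat \<times> rat) set" where "finite I"
    "\<And>\<mu>'. \<mu>' \<in> counting_measures UNIV \<Longrightarrow>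
      (\<forall>(a, b)\<in>I. emeasure \<mu>' {real_of_rat a<..real_of_rat b} = emeasure \<mu> {real_of_rat a<..real_of_rat b}) \<Longrightarrow>
      \<bar>(\<integral>x. f x \<partial>\<mu>') - (\<integral>x. f x \<partial>\<mu>)\<bar> < e"
proof -
  obtain B where B: "\<And>x. f x \<noteq> 0 \<Longrightarrow> \<bar>x\<bar> \<le> B" using bdd unfolding bounded_iff by auto
  obtain n :: nat where n: "B < real n" using reals_Archimedean2 by auto
  let ?W = "{- real n<..real n}"
  have f0: "f x = 0" if "x \<notin> ?W" for x using B[of x] n that by (cases "f x = 0") auto
  define c where "c = measure \<mu> ?W"
  define \<eta> where "\<eta> = e / (4 * (c + 1))"
  have c: "c \<ge> 0" by (simp add: c_def)
  have \<eta>: "\<eta> > 0" "2 * \<eta> * c < e" using e c by (auto simp: \<eta>_def field_simps intro!: add_pos_nonneg)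
  have "uniformly_continuous_on {- real n..real n} f"
    by (rule compact_uniformly_continuous) (auto intro: continuous_on_subset[OF cont])
  then obtain d where d: "d > 0" "\<And>x y. x \<in> {- real n..real n} \<Longrightarrow> y \<in> {- real n..real n} \<Longrightarrow> \<bar>y - x\<bar> < d \<Longrightarrow> \<bar>f y - f x\<bar> < \<eta>"
    using \<eta>(1) unfolding uniformly_continuous_on_def dist_real_def by metis
  obtain p :: nat where p: "p > 0" "1 / real p < d"
    using reals_Archimedean[OF d(1)] by (metis inverse_eq_divide zero_less_Suc)
  define S where "S = {- int (n * p)..<int (n * p)}"
  define J where "J = (\<lambda>i::int. {of_int i / real p<..(of_int i + 1) / real p})"
  \<comment> \<open>The step function that takes on each cell the value of \<open>f\<close> at the right end of the cell.\<close>
  define g where "g = (\<lambda>x. \<Sum>i\<in>S. f ((of_int i + 1) / real p) * indicator (J i) x)"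
  have J: "x \<in> J i \<longleftrightarrow> i = \<lceil>x * real p\<rceil> - 1" for x i
    using p(1) by (auto simp: J_def field_simps ceiling_eq_iff) linarith+
  have JS: "\<lceil>x * real p\<rceil> - 1 \<in> S \<longleftrightarrow> x \<in> ?W" for x
  proof -
    have "- int (n * p) < \<lceil>x * real p\<rceil> \<longleftrightarrow> - real n * real p < x * real p"
      by (simp add: less_ceiling_iff)
    moreover have "\<lceil>x * real p\<rceil> \<le> int (n * p) \<longleftrightarrow> x * real p \<le> real n * real p"
      by (simp add: ceiling_le_iff)
    moreover have "- real n * real p < x * real p \<longleftrightarrow> - real n < x" "x * real p \<le> real n * real p \<longleftrightarrow> x \<le> real n"
      using p(1) mult_less_cancel_right_pos[of "real p" "- real n" x] by simp_all
    ultimately show ?thesis unfolding S_def by (simp only: greaterThanAtMost_iff atLeastLessThan_iff) linarith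
  qed
  have g: "g x = (if x \<in> ?W then f (of_int \<lceil>x * real p\<rceil> / real p) else 0)" for x
  proof -
    have "g x = (\<Sum>i\<in>S. if i = \<lceil>x * real p\<rceil> - 1 then f ((of_int i + 1) / real p) else 0)"
      unfolding g_def by (intro sum.cong) (auto simp: indicator_def J)
    also have "\<dots> = (if \<lceil>x * real p\<rceil> - 1 \<in> S then f (of_int \<lceil>x * real p\<rceil> / real p) else 0)"
      by (subst sum.delta) (auto simp: S_def)
    finally show ?thesis by (simp only: JS)
  qed
  have fg: "\<bar>f x - g x\<bar> \<le> \<eta> * indicator ?W x" for x
  proof (cases "x \<in> ?W")
    case True
    let ?y = "of_int \<lceil>x * real p\<rceil> / real p"
    have 1: "x \<le> ?y" "?y - x < 1 / real p"
    proof -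
      have "x * real p \<le> of_int \<lceil>x * real p\<rceil>" "of_int \<lceil>x * real p\<rceil> < x * real p + 1"
        using ceiling_correct[of "x * real p"] by linarith+
      then have "x \<le> ?y" "?y < (x * real p + 1) / real p"
        using p(1) by (simp_all only: divide_strict_right_mono of_nat_0_less_iff pos_le_divide_eq)
      moreover have "(x * real p + 1) / real p = x + 1 / real p" using p(1) by (simp add: add_divide_distrib)
      ultimately show "x \<le> ?y" "?y - x < 1 / real p" by linarith+
    qed
    have "\<lceil>x * real p\<rceil> \<le> int (n * p)" using True p(1) by (simp add: ceiling_le_iff)
    then have "of_int \<lceil>x * real p\<rceil> \<le> real n * real p" by (metis of_int_le_iff of_int_of_nat_eq of_nat_mult)
    then have "?y \<le> real n" using p(1) by (simp add: field_simps)
    then have "\<bar>f ?y - f x\<bar> < \<eta>" using True 1 p(2) by (intro d(2)) auto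
    then show ?thesis using True by (simp add: g abs_minus_commute)
  next
    case False
    then show ?thesis using g[of x] f0[OF False] by (simp only: if_False indicator_simps) simp
  qed
  define I :: "(rat \<times> rat) set" where "I = insert (of_int (- int n), of_int (int n)) ((\<lambda>i. (of_int i / of_nat p, (of_int i + 1) / of_nat p)) ` S)"
  have close: "\<bar>(\<integral>x. f x \<partial>\<nu>) - (\<Sum>i\<in>S. f ((of_int i + 1) / real p) * measure \<nu> (J i))\<bar> \<le> \<eta> * measure \<nu> ?W"
    if \<nu>: "\<nu> \<in> counting_measures UNIV" for \<nu>
  proof -
    note D = counting_measuresD[OF \<nu>]
    have sets[measurable_cong]: "sets \<nu> = sets borel" using D(1) by simp
    have intI: "integrable \<nu> (indicator A :: real \<Rightarrow> real)" if "A \<in> sets borel" "bounded A" for A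
      using D(4)[of A] that sets by (intro integrable_real_indicator) auto
    have intJ: "integrable \<nu> (indicator (J i) :: real \<Rightarrow> real)" for i by (rule intI) (auto simp: J_def)
    have intW: "integrable \<nu> (indicator ?W :: real \<Rightarrow> real)" by (rule intI) auto
    have intg: "integrable \<nu> g" unfolding g_def by (intro Bochner_Integration.integrable_sum integrable_mult_right intJ)
    have [measurable]: "f \<in> borel_measurable borel" by (rule borel_measurable_continuous_onI[OF cont])
    have intd: "integrable \<nu> (\<lambda>x. f x - g x)"
    proof (rule Bochner_Integration.integrable_bound)
      show "integrable \<nu> (\<lambda>x. \<eta> * indicator ?W x)" using intW by (rule integrable_mult_right)
      have "f \<in> borel_measurable \<nu>" by measurable
      then show "(\<lambda>x. f x - g x) \<in> borel_measurable \<nu>"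
        using borel_measurable_integrable[OF intg] by (rule borel_measurable_diff)
      have "norm (f x - g x) \<le> norm (\<eta> * indicator ?W x)" for x
        using fg[of x] abs_ge_self[of "\<eta> * indicator ?W x"] unfolding real_norm_def by linarith
      then show "AE x in \<nu>. norm (f x - g x) \<le> norm (\<eta> * indicator ?W x)" by (rule AE_I2)
    qed
    then have intf: "integrable \<nu> f" using Bochner_Integration.integrable_add[OF intd intg] by simp
    have "(\<integral>x. g x \<partial>\<nu>) = (\<Sum>i\<in>S. f ((of_int i + 1) / real p) * measure \<nu> (J i))"
      unfolding g_def using intJ D(2) by (subst Bochner_Integration.integral_sum) auto
    moreover have "\<bar>(\<integral>x. f x \<partial>\<nu>) - (\<integral>x. g x \<partial>\<nu>)\<bar> \<le> (\<integral>x. \<bar>f x - g x\<bar> \<partial>\<nu>)"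
      using integral_abs_bound[of \<nu> "\<lambda>x. f x - g x"] intf intg by simp
    moreover have "(\<integral>x. \<bar>f x - g x\<bar> \<partial>\<nu>) \<le> (\<integral>x. \<eta> * indicator ?W x \<partial>\<nu>)"
      by (intro integral_mono integrable_abs intd integrable_mult_right intW fg)
    moreover have "(\<integral>x. \<eta> * indicator ?W x \<partial>\<nu>) = \<eta> * measure \<nu> ?W" using D(2) by simp
    ultimately show ?thesis by simp
  qed
  show ?thesis
  proof (rule that[of I])
    show "finite I" by (simp add: I_def S_def)
    fix \<mu>' assume \<mu>': "\<mu>' \<in> counting_measures UNIV"
      and eq: "\<forall>(a, b)\<in>I. emeasure \<mu>' {real_of_rat a<..real_of_rat b} = emeasure \<mu> {real_of_rat a<..real_of_rat b}"
    have W: "measure \<mu>' ?W = measure \<mu> ?W" using eq by (simp add: I_def measure_def of_rat_minus)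
    have "measure \<mu>' (J i) = measure \<mu> (J i)" if "i \<in> S" for i
      using eq that by (simp add: I_def measure_def J_def of_rat_divide of_rat_add)
    then have "(\<Sum>i\<in>S. f ((of_int i + 1) / real p) * measure \<mu>' (J i)) = (\<Sum>i\<in>S. f ((of_int i + 1) / real p) * measure \<mu> (J i))"
      by simp
    with close[OF \<mu>', unfolded W] close[OF \<mu>] have "\<bar>(\<integral>x. f x \<partial>\<mu>') - (\<integral>x. f x \<partial>\<mu>)\<bar> \<le> 2 * (\<eta> * c)"
      unfolding c_def by linarith
    then show "\<bar>(\<integral>x. f x \<partial>\<mu>') - (\<integral>x. f x \<partial>\<mu>)\<bar> < e" using \<eta>(2) by simp
  qed
qed

definition rational_interval :: "nat \<Rightarrow> real set" where
  "rational_interval k = (case from_nat k of (a, b) \<Rightarrow> {real_of_rat a<..real_of_rat b})"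

text \<open>Open sets of the weak topology are arbitrary unions of finite intersections of generators, so
measurability of a map on the generators does not immediately give measurability on all open sets.
This lemma supplies the countability: whether a measure belongs to an open set can be confirmed from its masses
on finitely many members of one fixed sequence of intervals. The property passes to intersections
by taking the larger number of intervals, and to unions without change.\<close>

lemma openin_weak_topology_rational_intervals:
  assumes "openin (weak_topology UNIV) U" "\<mu> \<in> U"
  shows "\<exists>m. \<forall>\<mu>'\<in>counting_measures UNIV.
    (\<forall>k<m. emeasure \<mu>' (rational_interval k) = emeasure \<mu> (rational_interval k)) \<longrightarrow> \<mu>' \<in> U"
  using openin_topology_generated_by[OF assms(1)[unfolded weak_topology_def]] assms(2)
proof (induct arbitrary: \<mu>)
  case Empty then show ?case by simp
next
  case (Int a b)
  have m12: "\<mu> \<in> a" "\<mu> \<in> b" using Int by auto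
  obtain m1 m2 where
    "\<forall>\<mu>'\<in>counting_measures UNIV. (\<forall>k<m1. emeasure \<mu>' (rational_interval k) = emeasure \<mu> (rational_interval k)) \<longrightarrow> \<mu>' \<in> a"
    "\<forall>\<mu>'\<in>counting_measures UNIV. (\<forall>k<m2. emeasure \<mu>' (rational_interval k) = emeasure \<mu> (rational_interval k)) \<longrightarrow> \<mu>' \<in> b"
    using Int(2)[OF m12(1)] Int(4)[OF m12(2)] by blast
  then show ?case by (intro exI[of _ "max m1 m2"]) simp
next
  case (UN K)
  then obtain k where k: "k \<in> K" "\<mu> \<in> k" by auto
  with UN(2)[OF k] show ?case by blast
next
  case (Basis s)
  then obtain f :: "real \<Rightarrow> real" and V where s: "s = {\<mu>\<in>counting_measures UNIV. (\<integral>x. f x \<partial>\<mu>) \<in> V}"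
    and f: "continuous_on UNIV f" "bounded {x\<in>UNIV. f x \<noteq> 0}" and V: "open V" by auto
  obtain e where e: "e > 0" "\<And>y. \<bar>y - (\<integral>x. f x \<partial>\<mu>)\<bar> < e \<Longrightarrow> y \<in> V"
    using V Basis(2) s unfolding open_dist dist_real_def by blast
  have \<mu>: "\<mu> \<in> counting_measures UNIV" using Basis(2) s by simp
  obtain I where I: "finite I" "\<And>\<mu>'. \<mu>' \<in> counting_measures UNIV \<Longrightarrow>
      (\<forall>(a, b)\<in>I. emeasure \<mu>' {real_of_rat a<..real_of_rat b} = emeasure \<mu> {real_of_rat a<..real_of_rat b}) \<Longrightarrow>
      \<bar>(\<integral>x. f x \<partial>\<mu>') - (\<integral>x. f x \<partial>\<mu>)\<bar> < e"
    using counting_integral_close[OF f(1) _ \<mu> e(1)] f(2) by auto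
  obtain m where m: "\<And>k. k \<in> to_nat ` I \<Longrightarrow> k < m"
    using I(1) finite_nat_set_iff_bounded[of "to_nat ` I"] by auto
  have "\<mu>' \<in> s" if "\<mu>' \<in> counting_measures UNIV"
    "\<forall>k<m. emeasure \<mu>' (rational_interval k) = emeasure \<mu> (rational_interval k)" for \<mu>'
  proof -
    have "emeasure \<mu>' {real_of_rat a<..real_of_rat b} = emeasure \<mu> {real_of_rat a<..real_of_rat b}" if "(a, b) \<in> I" for a b
    proof -
      have "to_nat (a, b) < m" using m that by blast
      with \<open>\<forall>k<m. _\<close> have "emeasure \<mu>' (rational_interval (to_nat (a, b))) = emeasure \<mu> (rational_interval (to_nat (a, b)))" by blast
      then show ?thesis by (simp add: rational_interval_def)
    qed
    then have "\<bar>(\<integral>x. f x \<partial>\<mu>') - (\<integral>x. f x \<partial>\<mu>)\<bar> < e" by (intro I(2)) (use that in auto)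
    then show ?thesis using that(1) e(2) s by simp
  qed
  then show ?case by blast
qed

text \<open>The masses of bounded intervals are natural numbers, so there are only countably many possible lists
\<open>l\<close> of masses on the first \<open>m\<close> intervals. The preimage of an open set is the union, over the lists
that confirm membership, of the events that these masses are observed.\<close>

lemma measurable_counting_borelI:
  assumes N: "\<And>\<omega>. \<omega> \<in> space M \<Longrightarrow> N \<omega> \<in> counting_measures UNIV"
    and meas: "\<And>A. A \<in> sets (borel :: real measure) \<Longrightarrow> (\<lambda>\<omega>. emeasure (N \<omega>) A) \<in> borel_measurable M"
  shows "N \<in> measurable M (counting_borel UNIV)"
proof -
  have J: "rational_interval k \<in> sets borel" "bounded (rational_interval k)" for k
    by (auto simp: rational_interval_def split: prod.splits intro: bounded_subset[OF bounded_closed_interval])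
  have "N -` U \<inter> space M \<in> sets M" if U: "openin (weak_topology UNIV) U" for U
  proof -
    let ?L = "\<lambda>m. {l :: nat list. length l = m \<and> (\<forall>\<mu>'\<in>counting_measures UNIV. (\<forall>k<m. emeasure \<mu>' (rational_interval k) = of_nat (l ! k)) \<longrightarrow> \<mu>' \<in> U)}"
    let ?C = "\<lambda>m l. {\<omega>\<in>space M. \<forall>k<m. emeasure (N \<omega>) (rational_interval k) = of_nat (l ! k)}"
    have "N -` U \<inter> space M = (\<Union>m. \<Union>l\<in>?L m. ?C m l)"
    proof (intro equalityI subsetI)
      fix \<omega> assume w: "\<omega> \<in> N -` U \<inter> space M"
      then obtain m where m: "\<forall>\<mu>'\<in>counting_measures UNIV.
        (\<forall>k<m. emeasure \<mu>' (rational_interval k) = emeasure (N \<omega>) (rational_interval k)) \<longrightarrow> \<mu>' \<in> U"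
        using openin_weak_topology_rational_intervals[OF U] by blast
      note D = counting_measuresD[OF N[of \<omega>]]
      have "\<exists>n. emeasure (N \<omega>) (rational_interval k) = of_nat n" for k
      proof -
        have "rational_interval k \<in> sets (N \<omega>)" using D(1) J(1)[of k] w by simp
        then show ?thesis using D(3)[of "rational_interval k"] D(4)[of "rational_interval k"] J(2)[of k] w by auto
      qed
      then obtain n where n: "\<And>k. emeasure (N \<omega>) (rational_interval k) = of_nat (n k)" by metis
      have "map n [0..<m] \<in> ?L m" using m n by simp
      moreover have "\<omega> \<in> ?C m (map n [0..<m])" using w n by simp
      ultimately show "\<omega> \<in> (\<Union>m. \<Union>l\<in>?L m. ?C m l)" by blast
    next
      fix \<omega> assume "\<omega> \<in> (\<Union>m. \<Union>l\<in>?L m. ?C m l)"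
      then show "\<omega> \<in> N -` U \<inter> space M" using N by blast
    qed
    also have "\<dots> \<in> sets M"
    proof (rule sets.countable_UN''[OF countableI_type], rule sets.countable_UN''[OF countableI_type])
      fix m :: nat and l :: "nat list"
      have "?C m l = space M \<inter> (\<Inter>k\<in>{..<m}. (\<lambda>\<omega>. emeasure (N \<omega>) (rational_interval k)) -` {of_nat (l ! k)} \<inter> space M)"
        by auto
      also have "\<dots> \<in> sets M"
      proof (cases "m = 0")
        case False
        then show ?thesis
          by (intro sets.Int[OF sets.top sets.finite_INT] measurable_sets[OF meas[OF J(1)]]) auto
      qed simp
      finally show "?C m l \<in> sets M" .
    qed
    finally show ?thesis .
  qed
  then show ?thesis unfolding counting_borel_def
    using openin_weak_topology_subset N by (intro measurable_measure_of) auto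
qed

section \<open>Predictable processes\<close>

text \<open>The predictable \<open>\<sigma>\<close>-field is studied for an increasing family of \<open>\<sigma>\<close>-fields without the usual conditions,
because it is used both for the given filtration and for the smaller one generated by the data.\<close>

locale stochastic_base =
  fixes M :: "'w measure" and F :: "real \<Rightarrow> 'w measure"
  assumes space_F: "0 \<le> t \<Longrightarrow> space (F t) = space M"
    and sets_F_mono: "0 \<le> s \<Longrightarrow> s \<le> t \<Longrightarrow> sets (F s) \<subseteq> sets (F t)"
begin

abbreviation "predictable_rectangles \<equiv> {{s<..t} \<times> A | s t A. 0 \<le> s \<and> s \<le> t \<and> A \<in> sets (F s)}"

lemma predictable_rectangles_subset: "predictable_rectangles \<subseteq> Pow ({0<..} \<times> space M)"
  using space_F sets.sets_into_space by fastforce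

lemma space_predictable: "space (predictable M F) = {0<..} \<times> space M"
  unfolding predictable_def using predictable_rectangles_subset by (rule space_measure_of)

lemma sets_predictable: "sets (predictable M F) = sigma_sets ({0<..} \<times> space M) predictable_rectangles"
  unfolding predictable_def using predictable_rectangles_subset by (rule sets_measure_of)

lemma predictable_halfline:
  assumes "0 \<le> s" "A \<in> sets (F s)"
  shows "{s<..} \<times> A \<in> sets (predictable M F)"
proof -
  have "{s<..} \<times> A = (\<Union>n. {s<..s + real n} \<times> A)"
  proof (intro equalityI subsetI)
    fix z assume "z \<in> {s<..} \<times> A"
    then obtain u \<omega> where z: "z = (u, \<omega>)" "u > s" "\<omega> \<in> A" by auto
    obtain n where "u - s \<le> real n" using real_arch_simple by blast
    with z show "z \<in> (\<Union>n. {s<..s + real n} \<times> A)" by (auto intro!: exI[of _ n])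
  qed auto
  moreover have "{s<..s + real n} \<times> A \<in> sets (predictable M F)" for n
    unfolding sets_predictable using assms by (intro sigma_sets.Basic) force
  ultimately show ?thesis by auto
qed

lemma measurable_fst_predictable: "fst \<in> borel_measurable (predictable M F)"
proof (rule borel_measurableI_greater)
  fix y :: real
  have "{x \<in> space (predictable M F). y < fst x} = {max y 0<..} \<times> space M"
    by (auto simp: space_predictable)
  also have "\<dots> \<in> sets (predictable M F)"
    using sets.top[of "F (max y 0)"] space_F[of "max y 0"] by (intro predictable_halfline) auto
  finally show "{x \<in> space (predictable M F). y < fst x} \<in> sets (predictable M F)" .
qed

lemma predictable_step:
  fixes X :: "'w \<Rightarrow> ennreal"
  assumes q: "0 \<le> q" and X: "X \<in> borel_measurable (F q)"
  shows "(\<lambda>z. X (snd z) * indicator {q<..} (fst z)) \<in> borel_measurable (predictable M F)"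
proof (rule borel_measurableI_greater)
  fix y :: ennreal
  have "{z \<in> space (predictable M F). y < X (snd z) * indicator {q<..} (fst z)} = {q<..} \<times> {\<omega> \<in> space (F q). y < X \<omega>}"
    using q by (auto simp: space_predictable space_F indicator_def split: if_splits)
  also have "\<dots> \<in> sets (predictable M F)"
    using q X by (intro predictable_halfline) measurable
  finally show "{z \<in> space (predictable M F). y < X (snd z) * indicator {q<..} (fst z)} \<in> sets (predictable M F)" .
qed

text \<open>A left-continuous increasing process is, at time \<open>t\<close>, the supremum over rational \<open>q < t\<close> of its values
at \<open>q\<close>, that is, a countable supremum of processes \<open>X q\<close> that are switched on after time \<open>q\<close>.\<close>

lemma predictable_monotone_left_continuous:
  fixes X :: "real \<Rightarrow> 'w \<Rightarrow> ennreal"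
  assumes meas: "\<And>q. 0 \<le> q \<Longrightarrow> X q \<in> borel_measurable (F q)"
    and mono: "\<And>s t \<omega>. \<omega> \<in> space M \<Longrightarrow> s \<le> t \<Longrightarrow> X s \<omega> \<le> X t \<omega>"
    and left: "\<And>t \<omega>. \<omega> \<in> space M \<Longrightarrow> t > 0 \<Longrightarrow> X t \<omega> \<le> (SUP n. X (t - 1 / real (Suc n)) \<omega>)"
  shows "(\<lambda>z. X (fst z) (snd z)) \<in> borel_measurable (predictable M F)"
proof -
  let ?Y = "\<lambda>z. SUP q\<in>\<rat> \<inter> {0..}. X q (snd z) * indicator {q<..} (fst z)"
  have "?Y \<in> borel_measurable (predictable M F)"
    by (rule borel_measurable_SUP) (auto intro!: predictable_step meas countable_Int1 countable_rat)
  moreover have "X (fst z) (snd z) = ?Y z" if zs: "z \<in> space (predictable M F)" for z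
  proof -
    obtain t \<omega> where z: "z = (t, \<omega>)" "t > 0" "\<omega> \<in> space M" using zs by (cases z) (auto simp: space_predictable)
    have "X t \<omega> \<le> ?Y z"
    proof (rule order_trans[OF left[OF z(3,2)]], rule SUP_least)
      fix n
      obtain q where q: "q \<in> \<rat>" "max 0 (t - 1 / real (Suc n)) < q" "q < t"
        using Rats_dense_in_real[of "max 0 (t - 1 / real (Suc n))" t] z(2) by auto
      have "X (t - 1 / real (Suc n)) \<omega> \<le> X q \<omega> * indicator {q<..} t"
        using q mono[OF z(3), of "t - 1 / real (Suc n)" q] by simp
      then show "X (t - 1 / real (Suc n)) \<omega> \<le> ?Y z"
        using q by (intro SUP_upper2[of q]) (auto simp: z)
    qed
    moreover have "?Y z \<le> X t \<omega>"
      using mono[OF z(3)] by (intro SUP_least) (auto simp: z indicator_def)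
    ultimately show ?thesis using z by auto
  qed
  ultimately show ?thesis by (subst measurable_cong)
qed

lemma measurable_into_predictable:
  assumes U[measurable]: "U \<in> borel_measurable R" and pos: "\<And>z. z \<in> space R \<Longrightarrow> U z > 0"
    and W: "\<And>z. z \<in> space R \<Longrightarrow> W z \<in> space M"
    and rect: "\<And>a A. 0 \<le> a \<Longrightarrow> A \<in> sets (F a) \<Longrightarrow> {z \<in> space R. a < U z \<and> W z \<in> A} \<in> sets R"
  shows "(\<lambda>z. (U z, W z)) \<in> measurable R (predictable M F)"
  unfolding predictable_def
proof (rule measurable_measure_of)
  show "predictable_rectangles \<subseteq> Pow ({0<..} \<times> space M)" by (rule predictable_rectangles_subset)
  show "(\<lambda>z. (U z, W z)) \<in> space R \<rightarrow> {0<..} \<times> space M" using pos W by auto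
  fix y assume "y \<in> predictable_rectangles"
  then obtain s t A where y: "y = {s<..t} \<times> A" "0 \<le> s" "A \<in> sets (F s)" by auto
  have "(\<lambda>z. (U z, W z)) -` y \<inter> space R = {z \<in> space R. s < U z \<and> W z \<in> A} \<inter> {z \<in> space R. U z \<le> t}"
    using y by auto
  also have "\<dots> \<in> sets R"
  proof (rule sets.Int[OF rect[OF y(2,3)]])
    show "{z \<in> space R. U z \<le> t} \<in> sets R" by measurable
  qed
  finally show "(\<lambda>z. (U z, W z)) -` y \<inter> space R \<in> sets R" .
qed

lemma predictable_section:
  assumes f: "f \<in> borel_measurable (predictable M F)" and \<omega>: "\<omega> \<in> space M"
  shows "(\<lambda>u. f (u, \<omega>) * indicator {0<..} u :: ennreal) \<in> borel_measurable borel"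
proof -
  have "(\<lambda>u. (u, \<omega>)) \<in> measurable (restrict_space borel {0<..}) (predictable M F)"
  proof (rule measurable_into_predictable)
    show "(\<lambda>u. u) \<in> borel_measurable (restrict_space borel {0<..})" by (rule measurable_restrict_space1) simp
    fix a :: real and A assume "0 \<le> a"
    then have "{z \<in> space (restrict_space borel {0<..}). a < z \<and> \<omega> \<in> A} = (if \<omega> \<in> A then {a<..} else {})"
      by (auto simp: space_restrict_space)
    then show "{z \<in> space (restrict_space borel {0<..}). a < z \<and> \<omega> \<in> A} \<in> sets (restrict_space borel {0<..})"
      using \<open>0 \<le> a\<close> by (auto simp: sets_restrict_borel)
  qed (use \<omega> in \<open>auto simp: space_restrict_space\<close>)
  from measurable_compose[OF this f]
  show ?thesis by (subst (asm) borel_measurable_restrict_space_iff_ennreal) auto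
qed

text \<open>For \<open>s < u\<close>, the value at time \<open>s\<close> of a predictable process is known just before \<open>u\<close>. This is what makes
an integral over the strict past of \<open>u\<close> again a predictable function of \<open>u\<close>.\<close>

lemma predictable_past:
  assumes f: "f \<in> borel_measurable (predictable M F)"
  shows "(\<lambda>(z, s). f (s, snd z) * indicator {0<..<fst z} s :: ennreal) \<in> borel_measurable (predictable M F \<Otimes>\<^sub>M borel)"
proof -
  let ?B = "predictable M F \<Otimes>\<^sub>M borel :: ((real \<times> 'w) \<times> real) measure"
  let ?T = "{x \<in> space ?B. 0 < snd x \<and> snd x < fst (fst x)}"
  note measurable_fst_predictable[measurable]
  have T[measurable]: "?T \<in> sets ?B" by measurable
  have spT: "space (restrict_space ?B ?T) = ?T" by (auto simp: space_restrict_space)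
  have "(\<lambda>x. (snd x, snd (fst x))) \<in> measurable (restrict_space ?B ?T) (predictable M F)"
  proof (rule measurable_into_predictable)
    show "snd \<in> borel_measurable (restrict_space ?B ?T)" by (rule measurable_restrict_space1) simp
    fix a :: real and A assume a: "0 \<le> a" "A \<in> sets (F a)"
    have "{x \<in> space (restrict_space ?B ?T). a < snd x \<and> snd (fst x) \<in> A} = ?T \<inter> (({a<..} \<times> A) \<times> {a<..})"
      unfolding spT using a sets.sets_into_space[OF a(2)] space_F[OF a(1)]
      by (auto simp: space_pair_measure space_predictable)
    also have "\<dots> \<in> sets (restrict_space ?B ?T)"
      using predictable_halfline[OF a] T by (subst sets_restrict_space_iff) auto
    finally show "{x \<in> space (restrict_space ?B ?T). a < snd x \<and> snd (fst x) \<in> A} \<in> sets (restrict_space ?B ?T)" .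
  qed (unfold spT, auto simp: space_pair_measure space_predictable)
  from measurable_compose[OF this f]
  have "(\<lambda>x. f (snd x, snd (fst x)) * indicator ?T x) \<in> borel_measurable ?B"
    by (subst (asm) borel_measurable_restrict_space_iff_ennreal) auto
  moreover have "f (snd x, snd (fst x)) * indicator ?T x = (\<lambda>(z, s). f (s, snd z) * indicator {0<..<fst z} s) x"
    if "x \<in> space ?B" for x using that by (auto simp: indicator_def split: prod.splits)
  ultimately show ?thesis by (simp cong: measurable_cong)
qed

text \<open>Up to a fixed time a predictable process is jointly measurable for the \<open>\<sigma>\<close>-field of that time. The
lemma is stated for a set \<open>T\<close> of times and a \<open>\<sigma>\<close>-field \<open>H\<close> that contains the past of every time before some point of
\<open>T\<close>, and it allows an additional mark \<open>snd x\<close>.\<close>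

lemma predictable_marked_adapted:
  fixes f :: "(real \<times> 'w) \<times> real \<Rightarrow> ennreal"
  assumes f: "f \<in> borel_measurable (predictable M F \<Otimes>\<^sub>M borel)"
    and H: "space H = space M" and T: "T \<in> sets borel" "T \<subseteq> {0<..}"
    and HF: "\<And>a A. 0 \<le> a \<Longrightarrow> A \<in> sets (F a) \<Longrightarrow> T \<inter> {a<..} \<noteq> {} \<Longrightarrow> A \<in> sets H"
  shows "(\<lambda>(\<omega>, x). f ((fst x, \<omega>), snd x) * indicator T (fst x)) \<in> borel_measurable (H \<Otimes>\<^sub>M borel)"
proof -
  let ?B = "H \<Otimes>\<^sub>M (borel :: (real \<times> real) measure)"
  have [measurable]: "fst \<in> borel_measurable (borel :: (real \<times> real) measure)"
    "snd \<in> borel_measurable (borel :: (real \<times> real) measure)" by (simp_all add: borel_prod[symmetric])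
  let ?R = "restrict_space ?B (space M \<times> (T \<times> UNIV))"
  have TU: "T \<times> UNIV \<in> sets (borel :: (real \<times> real) measure)" using T by (intro borel_Times) auto
  have sub: "space M \<times> (T \<times> UNIV) \<in> sets ?B" using TU sets.top[of H] H by (intro pair_measureI) auto
  have sp: "space ?R = space M \<times> (T \<times> UNIV)" using H by (auto simp: space_restrict_space space_pair_measure)
  have m1: "(\<lambda>x. fst (snd x)) \<in> borel_measurable ?R" "(\<lambda>x. snd (snd x)) \<in> borel_measurable ?R"
    by (rule measurable_restrict_space1, measurable)+
  have "(\<lambda>x. (fst (snd x), fst x)) \<in> measurable ?R (predictable M F)"
  proof (rule measurable_into_predictable)
    show "(\<lambda>x. fst (snd x)) \<in> borel_measurable ?R" by (rule m1)
    fix a :: real and A assume a: "0 \<le> a" "A \<in> sets (F a)"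
    have "{x \<in> space ?R. a < fst (snd x) \<and> fst x \<in> A} = A \<times> ((T \<inter> {a<..}) \<times> UNIV)"
      unfolding sp using sets.sets_into_space[OF a(2)] space_F[OF a(1)] by auto
    moreover have "A \<times> ((T \<inter> {a<..}) \<times> UNIV) \<in> sets ?R"
    proof (cases "T \<inter> {a<..} = {}")
      case False
      have "(T \<inter> {a<..}) \<times> UNIV \<in> sets (borel :: (real \<times> real) measure)" using T by (intro borel_Times) auto
      then have "A \<times> ((T \<inter> {a<..}) \<times> UNIV) \<in> sets ?B" using HF[OF a False] by auto
      then show ?thesis using sub sets.sets_into_space[OF a(2)] space_F[OF a(1)]
        by (subst sets_restrict_space_iff) auto
    qed simp
    ultimately show "{x \<in> space ?R. a < fst (snd x) \<and> fst x \<in> A} \<in> sets ?R" by (simp only:)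
  qed (use T sp in auto)
  from measurable_compose[OF measurable_Pair[OF this m1(2)] f]
  have "(\<lambda>x. f ((fst (snd x), fst x), snd (snd x)) * indicator (space M \<times> (T \<times> UNIV)) x) \<in> borel_measurable ?B"
    using sub by (subst (asm) borel_measurable_restrict_space_iff_ennreal) auto
  moreover have "f ((fst (snd x), fst x), snd (snd x)) * indicator (space M \<times> (T \<times> UNIV)) x = (\<lambda>(\<omega>, x). f ((fst x, \<omega>), snd x) * indicator T (fst x)) x"
    if "x \<in> space ?B" for x using that H by (auto simp: indicator_def space_pair_measure split: prod.splits)
  ultimately show ?thesis by (simp cong: measurable_cong)
qed

lemma predictable_adapted:
  fixes f :: "real \<times> 'w \<Rightarrow> ennreal"
  assumes f: "f \<in> borel_measurable (predictable M F)"
    and H: "space H = space M" and T: "T \<in> sets borel" "T \<subseteq> {0<..}"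
    and HF: "\<And>a A. 0 \<le> a \<Longrightarrow> A \<in> sets (F a) \<Longrightarrow> T \<inter> {a<..} \<noteq> {} \<Longrightarrow> A \<in> sets H"
  shows "(\<lambda>(\<omega>, u). f (u, \<omega>) * indicator T u) \<in> borel_measurable (H \<Otimes>\<^sub>M borel)"
proof -
  have "(\<lambda>x. f (fst x)) \<in> borel_measurable (predictable M F \<Otimes>\<^sub>M borel)"
    by (rule measurable_compose[OF measurable_fst f])
  note 1 = predictable_marked_adapted[OF this H T HF]
  have "(\<lambda>x. (fst x, (snd x, 0))) \<in> measurable (H \<Otimes>\<^sub>M borel) (H \<Otimes>\<^sub>M (borel :: (real \<times> real) measure))"
    by (simp add: borel_prod[symmetric])
  from measurable_compose[OF this 1] show ?thesis by (simp add: split_beta')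
qed

end

section \<open>The driving Poisson process\<close>

abbreviation quadrant :: "(real \<times> real) set" where "quadrant \<equiv> {0<..} \<times> {0<..}"

lemma quadrant_borel: "quadrant \<in> sets borel" by (intro borel_Times) auto

lemma poisson_mean:
  assumes "l > 0"
  shows "(\<integral>\<^sup>+x. x \<partial>distr (measure_pmf (poisson_pmf l)) borel of_nat) = ennreal l"
proof -
  \<comment> \<open>The factor \<open>n\<close> in the mean cancels against \<open>n!\<close>, which shifts the exponential series by one.\<close>
  have "(\<lambda>n. l ^ n /\<^sub>R fact n) sums exp l" by (rule exp_converges)
  then have "(\<lambda>n. (l * exp (- l)) * (l ^ n /\<^sub>R fact n)) sums ((l * exp (- l)) * exp l)" by (rule sums_mult)
  moreover have "(l * exp (- l)) * exp l = l" by (simp add: exp_minus)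
  moreover have "(l * exp (- l)) * (l ^ n /\<^sub>R fact n) = l ^ Suc n / fact (Suc n) * exp (- l) * real (Suc n)" for n
    by (simp add: field_simps del: of_nat_Suc)
  ultimately have "(\<lambda>n. l ^ Suc n / fact (Suc n) * exp (- l) * real (Suc n)) sums l" by simp
  then have s: "(\<lambda>n. l ^ n / fact n * exp (- l) * real n) sums l"
    by (subst (asm) sums_Suc_iff) simp
  have "(\<integral>\<^sup>+x. x \<partial>distr (measure_pmf (poisson_pmf l)) borel of_nat) = (\<integral>\<^sup>+n. of_nat n \<partial>measure_pmf (poisson_pmf l))"
    by (subst nn_integral_distr) auto
  also have "\<dots> = (\<Sum>n. ennreal (l ^ n / fact n * exp (- l)) * of_nat n)"
    using assms by (simp add: nn_integral_measure_pmf nn_integral_count_space_nat)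
  also have "\<dots> = (\<Sum>n. ennreal (l ^ n / fact n * exp (- l) * real n))"
    using assms by (intro arg_cong[where f=suminf] ext)
      (simp add: ennreal_mult[symmetric] ennreal_of_nat_eq_real_of_nat less_imp_le)
  also have "\<dots> = ennreal l"
    using assms s by (intro suminf_ennreal_eq) auto
  finally show ?thesis .
qed

text \<open>The form in which independence of the past enters: it gives the factorisation for indicators of
events determined by \<open>X\<close>, hence for simple functions of \<open>X\<close>, hence for \<open>X\<close> itself.\<close>

lemma (in prob_space) indep_set_nn_integral_indicator:
  fixes X :: "'a \<Rightarrow> ennreal"
  assumes indep: "indep_set (sets (vimage_algebra (space M) X borel)) \<A>" and A: "A \<in> \<A>"
  shows "(\<integral>\<^sup>+\<omega>. X \<omega> * indicator A \<omega> \<partial>M) = (\<integral>\<^sup>+\<omega>. X \<omega> \<partial>M) * emeasure M A"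
proof -
  let ?V = "vimage_algebra (space M) X borel"
  have sub: "sets ?V \<subseteq> sets M" by (rule indep_setD_ev1[OF indep])
  have A': "A \<in> sets M" using indep_setD_ev2[OF indep] A by auto
  have spV: "space ?V = space M" by simp
  have mV: "f \<in> borel_measurable M" if "f \<in> borel_measurable ?V" for f :: "'a \<Rightarrow> ennreal"
    by (rule measurable_from_subalg[OF _ that]) (simp add: subalgebra_def sub)
  have "X \<in> borel_measurable ?V" by (rule measurable_vimage_algebra1) auto
  then show ?thesis
  proof (induct rule: borel_measurable_induct)
    case (cong f g)
    have "(\<integral>\<^sup>+\<omega>. f \<omega> * indicator A \<omega> \<partial>M) = (\<integral>\<^sup>+\<omega>. g \<omega> * indicator A \<omega> \<partial>M)"
      "(\<integral>\<^sup>+\<omega>. f \<omega> \<partial>M) = (\<integral>\<^sup>+\<omega>. g \<omega> \<partial>M)"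
      by (rule nn_integral_cong, use cong(3) in simp)+
    then show ?case using cong(4) by simp
  next
    case (set B)
    then have "B \<in> sets M" using sub by auto
    have "emeasure M (B \<inter> A) = emeasure M B * emeasure M A"
      using indep_setD[OF indep set A] by (simp add: emeasure_eq_measure ennreal_mult)
    then show ?case using A' \<open>B \<in> sets M\<close> by (simp add: indicator_inter_arith[symmetric])
  next
    case (mult u c)
    have "(\<integral>\<^sup>+\<omega>. c * u \<omega> * indicator A \<omega> \<partial>M) = c * (\<integral>\<^sup>+\<omega>. u \<omega> * indicator A \<omega> \<partial>M)"
      using mV[OF mult(2)] A' by (simp add: mult.assoc nn_integral_cmult)
    then show ?case using mult mV[OF mult(2)] by (simp add: nn_integral_cmult mult.assoc)
  next
    case (add u v)
    then show ?case using mV[OF add(1)] mV[OF add(4)] A' by (simp add: distrib_right nn_integral_add)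
  next
    case (seq U)
    have m: "U i \<in> borel_measurable M" for i using seq(1) mV by blast
    have inc: "incseq (\<lambda>i \<omega>. U i \<omega> * indicator A \<omega>)"
      using seq(4) by (auto simp: incseq_def le_fun_def intro!: mult_right_mono)
    have "(\<integral>\<^sup>+\<omega>. (SUP i. U i \<omega>) * indicator A \<omega> \<partial>M) = (SUP i. \<integral>\<^sup>+\<omega>. U i \<omega> * indicator A \<omega> \<partial>M)"
      using nn_integral_monotone_convergence_SUP[OF inc] m A' by (simp add: SUP_mult_right_ennreal)
    moreover have "(\<integral>\<^sup>+\<omega>. (SUP i. U i \<omega>) \<partial>M) = (SUP i. \<integral>\<^sup>+\<omega>. U i \<omega> \<partial>M)"
      using seq(4) m by (rule nn_integral_monotone_convergence_SUP)
    ultimately show ?case using seq(3) by (simp add: SUP_mult_right_ennreal image_comp)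
  qed
qed

locale driven_space = usual_filtered_prob_space M F for M :: "'w measure" and F :: "real \<Rightarrow> 'w measure" +
  fixes Q :: "'w \<Rightarrow> (real \<times> real) measure" and N0 :: "'w \<Rightarrow> real measure"
  assumes Q_poisson: "poisson_point_process M F Q"
    and N0_measurable: "N0 \<in> measurable (F 0) (counting_borel {..0})"
begin

abbreviation "D \<equiv> data_filtration M Q N0"
abbreviation "quadrant_space \<equiv> restrict_space (borel :: (real \<times> real) measure) quadrant"

lemma space_F: "0 \<le> t \<Longrightarrow> space (F t) = space M"
  using subalgebra_F[of t] by (simp add: subalgebra_def)

lemma sets_F_M: "0 \<le> t \<Longrightarrow> sets (F t) \<subseteq> sets M"
  using subalgebra_F[of t] by (simp add: subalgebra_def)

lemma data_generators_subset: "{N0 -` B \<inter> space M | B. B \<in> sets (counting_borel {..0})} \<union>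
     {(\<lambda>\<omega>. emeasure (Q \<omega>) A) -` B \<inter> space M | A B.
        A \<in> sets borel \<and> A \<subseteq> {0<..t} \<times> {0<..} \<and> B \<in> sets borel} \<union>
     null_sets M \<subseteq> Pow (space M)"
  by (auto dest: sets.sets_into_space null_setsD2)

lemma space_D: "space (D t) = space M"
  unfolding data_filtration_def by (rule space_measure_of[OF data_generators_subset])

lemma sets_D: "sets (D t) = sigma_sets (space M) ({N0 -` B \<inter> space M | B. B \<in> sets (counting_borel {..0})} \<union>
     {(\<lambda>\<omega>. emeasure (Q \<omega>) A) -` B \<inter> space M | A B.
        A \<in> sets borel \<and> A \<subseteq> {0<..t} \<times> {0<..} \<and> B \<in> sets borel} \<union> null_sets M)"
  unfolding data_filtration_def by (rule sets_measure_of[OF data_generators_subset])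

lemma D_mono: "s \<le> t \<Longrightarrow> sets (D s) \<subseteq> sets (D t)"
  unfolding sets_D
proof (intro sigma_sets_mono' Un_mono order.refl)
  assume "s \<le> t"
  then have "{0<..s} \<times> {0::real<..} \<subseteq> {0<..t} \<times> {0<..}" by auto
  then show "{(\<lambda>\<omega>. emeasure (Q \<omega>) A) -` B \<inter> space M | A B. A \<in> sets borel \<and> A \<subseteq> {0<..s} \<times> {0<..} \<and> B \<in> sets borel}
    \<subseteq> {(\<lambda>\<omega>. emeasure (Q \<omega>) A) -` B \<inter> space M | A B. A \<in> sets borel \<and> A \<subseteq> {0<..t} \<times> {0<..} \<and> B \<in> sets borel}"
    by (blast intro: subset_trans)
qed

lemma null_sets_D: "null_sets M \<subseteq> sets (D t)"
  unfolding sets_D by (auto intro!: sigma_sets.Basic)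

text \<open>The filtration \<open>F\<close> carries the independence of the increments of \<open>Q\<close>, and predictability for \<open>F\<close>
is what the conditional intensity requires. Solutions are constructed for the data filtration \<open>D\<close>.\<close>

sublocale past: stochastic_base M F
  by unfold_locales (use space_F F_mono in auto)

sublocale data: stochastic_base M D
  by unfold_locales (use space_D D_mono in auto)

lemma Q_counting: "\<omega> \<in> space M \<Longrightarrow> Q \<omega> \<in> counting_measures quadrant"
  using Q_poisson unfolding poisson_point_process_def by blast

lemmas sets_Q = counting_measuresD(1)[OF Q_counting]
lemmas space_Q = counting_measuresD(2)[OF Q_counting]

lemma sets_QI: "\<omega> \<in> space M \<Longrightarrow> A \<in> sets borel \<Longrightarrow> A \<subseteq> quadrant \<Longrightarrow> A \<in> sets (Q \<omega>)"
  using sets_Q quadrant_borel by (simp add: sets_restrict_borel[OF quadrant_borel])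

lemma Q_finite: "\<omega> \<in> space M \<Longrightarrow> A \<in> sets borel \<Longrightarrow> A \<subseteq> {0<..a} \<times> {0<..b} \<Longrightarrow> emeasure (Q \<omega>) A < \<infinity>"
proof (rule counting_measuresD(4)[OF Q_counting])
  assume "A \<subseteq> {0<..a} \<times> {0<..b}"
  moreover have "bounded ({0<..a} \<times> {0<..b})"
    by (intro bounded_Times bounded_subset[OF bounded_closed_interval[of 0 a]] bounded_subset[OF bounded_closed_interval[of 0 b]]) auto
  ultimately show "bounded A" by (rule bounded_subset[rotated])
qed (auto intro!: sets_QI)

text \<open>The increments of \<open>Q\<close> are prescribed on intervals \<open>(s, t]\<close> with \<open>s > 0\<close>. Time \<open>0\<close> is reached as the limit
of \<open>s = t / (n + 2)\<close>, which stays strictly between \<open>0\<close> and \<open>t\<close>.\<close>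

lemma Q_halfopen_SUP:
  assumes "\<omega> \<in> space M" "t > 0"
  shows "emeasure (Q \<omega>) ({0<..t} \<times> {0<..b}) = (SUP n. emeasure (Q \<omega>) ({t / real (n + 2)<..t} \<times> {0<..b}))"
proof -
  have "(SUP n. emeasure (Q \<omega>) ({t / real (n + 2)<..t} \<times> {0<..b})) = emeasure (Q \<omega>) (\<Union>n. {t / real (n + 2)<..t} \<times> {0<..b})"
  proof (rule SUP_emeasure_incseq)
    have "{x<..t} \<times> {0<..b} \<subseteq> quadrant" if "0 \<le> x" for x using that by auto
    then have "{t / real (n + 2)<..t} \<times> {0<..b} \<subseteq> quadrant" for n using assms by simp
    then show "range (\<lambda>n. {t / real (n + 2)<..t} \<times> {0<..b}) \<subseteq> sets (Q \<omega>)"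
      using assms by (auto intro!: sets_QI borel_Times)
    have "t / real (n + 2) \<le> t / real (m + 2)" if "m \<le> n" for m n
      using that assms by (intro divide_left_mono) auto
    moreover have "{x<..t} \<times> {0<..b} \<subseteq> {y<..t} \<times> {0<..b}" if "y \<le> x" for x y using that by auto
    ultimately show "incseq (\<lambda>n. {t / real (n + 2)<..t} \<times> {0<..b})"
      unfolding incseq_def by blast
  qed
  also have "(\<Union>n. {t / real (n + 2)<..t} \<times> {0<..b}) = {0<..t} \<times> {0<..b}"
  proof (intro equalityI subsetI)
    fix x assume x: "x \<in> {0<..t} \<times> {0<..b}"
    then have "\<exists>n. t < real n * fst x" using reals_Archimedean3[of "fst x"] by auto
    then obtain n where "t < real n * fst x" by blast
    also have "\<dots> \<le> real (n + 2) * fst x" using x by (intro mult_right_mono) auto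
    finally have "t / real (n + 2) < fst x" by (simp add: field_simps)
    then show "x \<in> (\<Union>n. {t / real (n + 2)<..t} \<times> {0<..b})" using x by auto
  next
    fix x assume "x \<in> (\<Union>n. {t / real (n + 2)<..t} \<times> {0<..b})"
    then obtain n where n: "x \<in> {t / real (n + 2)<..t} \<times> {0<..b}" by blast
    have "0 \<le> t / real (n + 2)" using assms by simp
    with n show "x \<in> {0<..t} \<times> {0<..b}" by (auto intro: le_less_trans)
  qed
  finally show ?thesis by simp
qed

lemma Q_increment:
  assumes "0 < s" "s < t" "0 < b"
  defines "X \<equiv> \<lambda>\<omega>. emeasure (Q \<omega>) ({s<..t} \<times> {0<..b})"
  shows "X \<in> borel_measurable (F t)" "indep_set (sets (vimage_algebra (space M) X borel)) (sets (F s))"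
    "distr M borel X = distr (measure_pmf (poisson_pmf ((t - s) * b))) borel of_nat"
proof -
  have "0 < t - s" using assms by simp
  note P = Q_poisson[unfolded poisson_point_process_def Let_def, THEN conjunct2, rule_format, OF assms(1) this assms(3)]
  show "X \<in> borel_measurable (F t)" "indep_set (sets (vimage_algebra (space M) X borel)) (sets (F s))"
    "distr M borel X = distr (measure_pmf (poisson_pmf ((t - s) * b))) borel of_nat"
    using P by (simp_all add: X_def)
qed

lemma Q_rectangle_measurable:
  assumes "0 \<le> s" "s < t" "0 < b"
  shows "(\<lambda>\<omega>. emeasure (Q \<omega>) ({s<..t} \<times> {0<..b})) \<in> borel_measurable (F t)"
proof -
  note pos = Q_increment(1)
  show ?thesis
  proof (cases "s = 0")
    case True
    have t: "t > 0" using assms by simp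
    have "emeasure (Q \<omega>) ({s<..t} \<times> {0<..b}) = (SUP n. emeasure (Q \<omega>) ({t / real (n + 2)<..t} \<times> {0<..b}))" if "\<omega> \<in> space (F t)" for \<omega>
      using Q_halfopen_SUP[of \<omega> t b] that space_F[of t] t True by simp
    moreover have "(\<lambda>\<omega>. SUP n. emeasure (Q \<omega>) ({t / real (n + 2)<..t} \<times> {0<..b})) \<in> borel_measurable (F t)"
      using t assms(3) by (intro borel_measurable_SUP pos) (auto simp: field_simps intro!: add_pos_nonneg)
    ultimately show ?thesis by (subst measurable_cong)
  qed (use pos assms in auto)
qed

text \<open>Rectangles \<open>(0, s] \<times> (0, b]\<close> are traces of lower-left quadrants, which generate the Borel sets of the
plane.\<close>

lemma Q_measurable:
  assumes t: "0 \<le> t" and A: "A \<in> sets borel" "A \<subseteq> {0<..t} \<times> {0<..}"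
  shows "(\<lambda>\<omega>. emeasure (Q \<omega>) A) \<in> borel_measurable (F t)"
proof -
  let ?K = "\<lambda>\<omega>. distr (Q \<omega>) borel (\<lambda>x. x)"
  let ?E = "\<lambda>n. {0<..t} \<times> {0<..real n}"
  have em: "emeasure (?K \<omega>) B = emeasure (Q \<omega>) (B \<inter> quadrant)" if "\<omega> \<in> space M" "B \<in> sets borel" for \<omega> B
  proof -
    have "(\<lambda>x. x) \<in> measurable (Q \<omega>) borel"
      unfolding measurable_cong_sets[OF sets_Q[OF that(1)] refl] by (rule measurable_restrict_space1) simp
    from emeasure_distr[OF this that(2)] show ?thesis by (simp add: space_Q[OF that(1)])
  qed
  have em2: "emeasure (?K \<omega>) B = emeasure (Q \<omega>) B" if "\<omega> \<in> space M" "B \<in> sets borel" "B \<subseteq> quadrant" for \<omega> B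
    using em[OF that(1,2)] that(3) by (simp add: Int_absorb2)
  have Eb: "?E n \<in> sets borel" for n by (intro borel_Times) auto
  have rect: "(\<lambda>\<omega>. emeasure (?K \<omega>) ({0<..s} \<times> {0<..b})) \<in> borel_measurable (F t)" if "s \<le> t" for s b
  proof (cases "0 < s \<and> 0 < b")
    case True
    have "(\<lambda>\<omega>. emeasure (Q \<omega>) ({0<..s} \<times> {0<..b})) \<in> borel_measurable (F s)"
      by (rule Q_rectangle_measurable) (use True in auto)
    then have "(\<lambda>\<omega>. emeasure (Q \<omega>) ({0<..s} \<times> {0<..b})) \<in> borel_measurable (F t)"
      by (rule measurable_from_subalg[rotated]) (use True that F_mono[of s t] in \<open>simp add: subalgebra_def space_F\<close>)
    moreover have "emeasure (?K \<omega>) ({0<..s} \<times> {0<..b}) = emeasure (Q \<omega>) ({0<..s} \<times> {0<..b})" if "\<omega> \<in> space (F t)" for \<omega>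
      using that space_F[OF t] by (intro em2 borel_Times) auto
    ultimately show ?thesis by (subst measurable_cong)
  next
    case False
    then have e: "{0<..s} \<times> {0<..b} = {}" by auto
    show ?thesis unfolding e by simp
  qed
  have 1: "(\<lambda>\<omega>. emeasure (?K \<omega>) (A \<inter> ?E n)) \<in> borel_measurable (F t)" for n
  proof (rule borel_measurable_kernel_emeasure[where Z=UNIV and G="range (\<lambda>a. {..a})" and N=borel])
    show "Int_stable (range (\<lambda>a::real \<times> real. {..a}))"
    proof (rule Int_stableI)
      fix A B assume "A \<in> range (\<lambda>a::real \<times> real. {..a})" "B \<in> range (\<lambda>a::real \<times> real. {..a})"
      then obtain a b where "A = {..a}" "B = {..b}" by auto
      then have "A \<inter> B = {..inf a b}" by auto
      then show "A \<inter> B \<in> range (\<lambda>a::real \<times> real. {..a})" by auto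
    qed
    show "sets (borel :: (real \<times> real) measure) = sigma_sets UNIV (range atMost)"
      by (subst borel_eq_atMost) simp
    show "?E n \<in> sets borel" by (rule Eb)
    fix \<omega> assume "\<omega> \<in> space (F t)"
    then show "emeasure (?K \<omega>) (?E n) < \<infinity>"
    proof -
      have "?E n \<subseteq> quadrant" by auto
      with \<open>\<omega> \<in> space (F t)\<close> show ?thesis
        using Q_finite[OF _ Eb[of n] order.refl, of \<omega>] em2[OF _ Eb[of n], of \<omega>] space_F[OF t] by auto
    qed
  next
    fix B assume "B \<in> range (\<lambda>a::real \<times> real. {..a})"
    then obtain a b where B: "B = {..(a, b)}" by auto
    have "B \<inter> ?E n = {0<..min t a} \<times> {0<..min (real n) b}" by (auto simp: B)
    then show "(\<lambda>\<omega>. emeasure (?K \<omega>) (B \<inter> ?E n)) \<in> borel_measurable (F t)"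
      using rect[of "min t a" "min (real n) b"] by simp
  next
    show "(\<lambda>\<omega>. emeasure (?K \<omega>) (?E n)) \<in> borel_measurable (F t)" by (rule rect) simp
  qed (use A in auto)
  have "emeasure (Q \<omega>) A = (SUP n. emeasure (?K \<omega>) (A \<inter> ?E n))" if "\<omega> \<in> space (F t)" for \<omega>
  proof -
    have \<omega>: "\<omega> \<in> space M" using that space_F[OF t] by simp
    have "(SUP n. emeasure (?K \<omega>) (A \<inter> ?E n)) = emeasure (?K \<omega>) (\<Union>n. A \<inter> ?E n)"
      using A Eb by (intro SUP_emeasure_incseq) (auto simp: incseq_def)
    also have "(\<Union>n. A \<inter> ?E n) = A"
    proof (intro equalityI subsetI)
      fix x assume x: "x \<in> A"
      obtain n :: nat where "snd x \<le> real n" using real_arch_simple by blast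
      with x A(2) show "x \<in> (\<Union>n. A \<inter> ?E n)" by (auto intro!: exI[of _ n])
    qed auto
    also have "emeasure (?K \<omega>) A = emeasure (Q \<omega>) A"
      using A by (intro em2 \<omega>) auto
    finally show ?thesis by simp
  qed
  with 1 show ?thesis by (subst measurable_cong) auto
qed

lemma Q_measurable_data:
  assumes "A \<in> sets borel" "A \<subseteq> {0<..t} \<times> {0<..}"
  shows "(\<lambda>\<omega>. emeasure (Q \<omega>) A) \<in> borel_measurable (D t)"
  by (rule measurableI) (auto simp: space_D sets_D intro!: sigma_sets.Basic assms)

lemma Q_measurable_M:
  assumes A: "A \<in> sets borel" "A \<subseteq> quadrant"
  shows "(\<lambda>\<omega>. emeasure (Q \<omega>) A) \<in> borel_measurable M"
proof -
  let ?B = "\<lambda>n. A \<inter> {0<..real n} \<times> {0<..}"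
  have B: "?B n \<in> sets borel" for n using A by (intro sets.Int borel_Times) auto
  have "emeasure (Q \<omega>) A = (SUP n. emeasure (Q \<omega>) (?B n))" if "\<omega> \<in> space M" for \<omega>
  proof -
    have "(SUP n. emeasure (Q \<omega>) (?B n)) = emeasure (Q \<omega>) (\<Union>n. ?B n)"
    proof (rule SUP_emeasure_incseq)
      show "range ?B \<subseteq> sets (Q \<omega>)" using B that A by (auto intro!: sets_QI)
      have "{0<..x} \<times> {0::real<..} \<subseteq> {0<..y} \<times> {0<..}" if "x \<le> y" for x y :: real using that by auto
      then show "incseq ?B" unfolding incseq_def by (meson Int_mono of_nat_mono order_refl)
    qed
    also have "(\<Union>n. ?B n) = A"
    proof (intro equalityI subsetI)
      fix x assume x: "x \<in> A"
      obtain n :: nat where "fst x \<le> real n" using real_arch_simple by blast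
      with x A(2) show "x \<in> (\<Union>n. ?B n)" by (intro UN_I[of n]) auto
    qed auto
    finally show ?thesis by simp
  qed
  moreover have "(\<lambda>\<omega>. emeasure (Q \<omega>) (?B n)) \<in> borel_measurable M" for n
    by (rule measurable_from_subalg[OF subalgebra_F Q_measurable[OF _ B, of "real n" n]]) auto
  then have "(\<lambda>\<omega>. SUP n. emeasure (Q \<omega>) (?B n)) \<in> borel_measurable M" by measurable
  ultimately show ?thesis by (subst measurable_cong)
qed

lemma N0_measurable_data: "N0 \<in> measurable (D t) (counting_borel {..0})"
proof (rule measurableI)
  show "\<omega> \<in> space (D t) \<Longrightarrow> N0 \<omega> \<in> space (counting_borel {..0})" for \<omega>
    using measurable_space[OF N0_measurable] space_F[of 0] by (simp add: space_D)
qed (auto simp: space_D sets_D intro!: sigma_sets.Basic)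

lemma N0_emeasure_measurable_data:
  "A \<in> sets borel \<Longrightarrow> (\<lambda>\<omega>. emeasure (N0 \<omega>) (A \<inter> {..0})) \<in> borel_measurable (D t)"
  by (rule measurable_compose[OF N0_measurable_data counting_borel_emeasure])

lemma N0_counting: "\<omega> \<in> space M \<Longrightarrow> N0 \<omega> \<in> counting_measures {..0}"
  using measurable_space[OF N0_measurable] space_F[of 0] by (simp add: space_counting_borel)

lemma D_sub_F:
  assumes t: "0 \<le> t" shows "sets (D t) \<subseteq> sets (F t)"
proof -
  have "sigma_sets (space M) ({N0 -` B \<inter> space M | B. B \<in> sets (counting_borel {..0})} \<union>
     {(\<lambda>\<omega>. emeasure (Q \<omega>) A) -` B \<inter> space M | A B.
        A \<in> sets borel \<and> A \<subseteq> {0<..t} \<times> {0<..} \<and> B \<in> sets borel} \<union> null_sets M) \<subseteq> sets (F t)"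
    unfolding space_F[OF t, symmetric]
  proof (rule sets.sigma_sets_subset, intro Un_least subsetI)
    fix x assume "x \<in> {N0 -` B \<inter> space (F t) | B. B \<in> sets (counting_borel {..0})}"
    then show "x \<in> sets (F t)"
      using measurable_sets[OF N0_measurable] F_mono[of 0 t] t space_F[of 0] space_F[OF t] by auto
  next
    fix x assume "x \<in> {(\<lambda>\<omega>. emeasure (Q \<omega>) A) -` B \<inter> space (F t) | A B.
        A \<in> sets borel \<and> A \<subseteq> {0<..t} \<times> {0<..} \<and> B \<in> sets borel}"
    then show "x \<in> sets (F t)" using measurable_sets[OF Q_measurable[OF t]] by auto
  next
    fix x assume "x \<in> null_sets M"
    then show "x \<in> sets (F t)" using null_sets_F F_mono[of 0 t] t by auto
  qed
  then show ?thesis by (simp only: sets_D)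
qed

lemma D_sub_M: "0 \<le> t \<Longrightarrow> sets (D t) \<subseteq> sets M"
  using D_sub_F sets_F_M by blast

lemma predictable_D_sub_F: "sets (predictable M D) \<subseteq> sets (predictable M F)"
  unfolding data.sets_predictable past.sets_predictable
  by (intro sigma_sets_mono') (use D_sub_F in blast)

text \<open>For \<open>s > 0\<close> this is independence of the past together with the Poisson mean; \<open>s = 0\<close> follows by
monotone convergence.\<close>

lemma Q_rectangle_mean:
  assumes s: "0 \<le> s" "s \<le> t" and A: "A \<in> sets (F s)"
  shows "(\<integral>\<^sup>+\<omega>. emeasure (Q \<omega>) ({s<..t} \<times> {0<..b}) * indicator A \<omega> \<partial>M) = ennreal ((t - s) * max b 0) * emeasure M A"
proof -
  have pos: "(\<integral>\<^sup>+\<omega>. emeasure (Q \<omega>) ({s<..t} \<times> {0<..b}) * indicator A \<omega> \<partial>M) = ennreal ((t - s) * b) * emeasure M A"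
    if "0 < s" "s < t" "0 < b" "A \<in> sets (F s)" for s
  proof -
    note I = Q_increment[OF that(1-3)]
    have m: "(\<lambda>\<omega>. emeasure (Q \<omega>) ({s<..t} \<times> {0<..b})) \<in> borel_measurable M"
      using that by (intro measurable_from_subalg[OF subalgebra_F I(1)]) auto
    have "(\<integral>\<^sup>+\<omega>. emeasure (Q \<omega>) ({s<..t} \<times> {0<..b}) \<partial>M) = (\<integral>\<^sup>+x. x \<partial>distr M borel (\<lambda>\<omega>. emeasure (Q \<omega>) ({s<..t} \<times> {0<..b})))"
      using m by (subst nn_integral_distr) auto
    also have "\<dots> = ennreal ((t - s) * b)" unfolding I(3) using that by (intro poisson_mean) simp
    finally show ?thesis using indep_set_nn_integral_indicator[OF I(2) that(4)] by simp
  qed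
  consider "b \<le> 0 \<or> s = t" | "0 < b" "0 < s" "s < t" | "0 < b" "s = 0" "s < t" using s by fastforce
  then show ?thesis
  proof cases
    case 1
    then have "{s<..t} \<times> {0<..b} = {}" by auto
    then show ?thesis using 1 by (auto simp: max_def)
  next
    case 2 then show ?thesis using pos A by (simp add: max_def)
  next
    case 3
    let ?s = "\<lambda>n. t / real (n + 2)"
    have sn: "0 < ?s n" "?s n < t" for n using 3 by (auto simp: field_simps intro!: add_pos_nonneg)
    have An: "A \<in> sets (F (?s n))" for n
    proof -
      have "sets (F s) \<subseteq> sets (F (?s n))" using sn[of n] 3(2) by (intro F_mono) auto
      then show ?thesis using A by auto
    qed
    have m: "(\<lambda>\<omega>. emeasure (Q \<omega>) ({?s n<..t} \<times> {0<..b}) * indicator A \<omega>) \<in> borel_measurable M" for n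
      using measurable_from_subalg[OF subalgebra_F Q_increment(1)[OF sn[of n] 3(1)]] 3 s A sets_F_M[OF s(1)] by auto
    have inc: "incseq (\<lambda>n \<omega>. emeasure (Q \<omega>) ({?s n<..t} \<times> {0<..b}) * indicator A \<omega>)"
    proof (intro monoI le_funI)
      fix m n :: nat and \<omega> assume "m \<le> n"
      then have "?s n \<le> ?s m" using 3 by (intro divide_left_mono) auto
      then have sub: "{?s m<..t} \<times> {0<..b} \<subseteq> {?s n<..t} \<times> {0<..b}" by auto
      show "emeasure (Q \<omega>) ({?s m<..t} \<times> {0<..b}) * indicator A \<omega> \<le> emeasure (Q \<omega>) ({?s n<..t} \<times> {0<..b}) * indicator A \<omega>"
      proof (cases "\<omega> \<in> A")
        case True
        then have \<omega>: "\<omega> \<in> space M" using A sets.sets_into_space[of A "F s"] space_F[OF s(1)] by auto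
        have "{x<..t} \<times> {0<..b} \<subseteq> quadrant" if "0 < x" for x using that by auto
        from this[OF sn(1)] have "{?s n<..t} \<times> {0<..b} \<in> sets (Q \<omega>)"
          by (intro sets_QI \<omega> borel_Times) auto
        then show ?thesis using emeasure_mono[OF sub] by (intro mult_right_mono) auto
      qed simp
    qed
    have "(\<integral>\<^sup>+\<omega>. emeasure (Q \<omega>) ({s<..t} \<times> {0<..b}) * indicator A \<omega> \<partial>M)
      = (\<integral>\<^sup>+\<omega>. (SUP n. emeasure (Q \<omega>) ({?s n<..t} \<times> {0<..b}) * indicator A \<omega>) \<partial>M)"
      using 3 by (intro nn_integral_cong) (simp add: Q_halfopen_SUP SUP_mult_right_ennreal)
    also have "\<dots> = (SUP n. \<integral>\<^sup>+\<omega>. emeasure (Q \<omega>) ({?s n<..t} \<times> {0<..b}) * indicator A \<omega> \<partial>M)"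
      using inc m by (intro nn_integral_monotone_convergence_SUP) auto
    also have "\<dots> = (SUP n. ennreal ((t - ?s n) * b) * emeasure M A)"
      using pos[OF sn 3(1) An] by simp
    also have "\<dots> = (SUP n. ennreal ((t - ?s n) * b)) * emeasure M A"
      by (simp add: SUP_mult_right_ennreal)
    also have "(SUP n. ennreal ((t - ?s n) * b)) = ennreal (t * b)"
    proof (rule LIMSEQ_unique[OF LIMSEQ_SUP])
      show "incseq (\<lambda>n. ennreal ((t - ?s n) * b))"
        using 3 by (auto simp: incseq_def intro!: ennreal_leI mult_right_mono diff_left_mono divide_left_mono)
      have "(\<lambda>n. t / real n) \<longlonglongrightarrow> 0" by (rule lim_const_over_n)
      then have "(\<lambda>n. ?s n) \<longlonglongrightarrow> 0" by (rule LIMSEQ_ignore_initial_segment)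
      then have "(\<lambda>n. (t - ?s n) * b) \<longlonglongrightarrow> (t - 0) * b" by (intro tendsto_intros)
      then show "(\<lambda>n. ennreal ((t - ?s n) * b)) \<longlonglongrightarrow> ennreal (t * b)" by (intro tendsto_ennrealI) simp
    qed
    finally show ?thesis using 3 by simp
  qed
qed

end

section \<open>The compensation formula\<close>

lemma emeasure_lborel_below:
  fixes L :: ennreal
  shows "(\<integral>\<^sup>+\<theta>\<in>{0<..}. of_bool (ennreal \<theta> \<le> L) \<partial>lborel) = L"
proof (cases L)
  case (real l)
  have "(\<integral>\<^sup>+\<theta>\<in>{0<..}. of_bool (ennreal \<theta> \<le> L) \<partial>lborel) = (\<integral>\<^sup>+\<theta>. indicator {0<..l} \<theta> \<partial>lborel)"
    by (rule nn_integral_cong) (use real in \<open>auto simp: indicator_def ennreal_le_iff\<close>)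
  then show ?thesis using real by simp
next
  case top
  have "(\<integral>\<^sup>+\<theta>\<in>{0<..}. of_bool (ennreal \<theta> \<le> L) \<partial>lborel) = (\<integral>\<^sup>+\<theta>. indicator {0::real<..} \<theta> \<partial>lborel)"
    by (rule nn_integral_cong) (simp add: top)
  also have "\<dots> = \<infinity>"
  proof -
    have "ennreal (real n) \<le> emeasure lborel {0::real<..}" for n
    proof -
      have "{0<..real n} \<subseteq> {0<..}" by auto
      then show ?thesis using emeasure_mono[of "{0<..real n}" "{0::real<..}" lborel] by simp
    qed
    then have "(SUP n. ennreal (real n)) \<le> emeasure lborel {0::real<..}" by (rule SUP_least)
    moreover have "(SUP n. ennreal (real n)) = top"
      using ennreal_SUP_of_nat_eq_top by (simp only: ennreal_of_nat_eq_real_of_nat)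
    ultimately show ?thesis by (simp add: top_unique)
  qed
  finally show ?thesis using top by simp
qed

context driven_space begin

lemma quadrant_squares:
  "{0<..real n} \<times> {0<..real n} \<in> sets quadrant_space"
  "incseq (\<lambda>n. {0<..real n} \<times> {0<..real n})"
  "(\<Union>n. {0<..real n} \<times> {0<..real n}) = space quadrant_space"
proof -
  show "{0<..real n} \<times> {0<..real n} \<in> sets quadrant_space"
    unfolding sets_restrict_borel[OF quadrant_borel] by (auto intro!: borel_Times)
  have "{0<..x} \<times> {0<..x} \<subseteq> {0<..y} \<times> {0<..y}" if "x \<le> y" for x y :: real using that by auto
  then show "incseq (\<lambda>n. {0<..real n} \<times> {0<..real n})" unfolding incseq_def by (meson of_nat_mono)
  have "x \<in> (\<Union>n. {0<..real n} \<times> {0<..real n})" if x: "x \<in> quadrant" for x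
  proof -
    obtain n :: nat where "max (fst x) (snd x) \<le> real n" using real_arch_simple by blast
    with x show ?thesis by (intro UN_I[of n]) auto
  qed
  then show "(\<Union>n. {0<..real n} \<times> {0<..real n}) = space quadrant_space" by (auto simp: space_restrict_space)
qed

lemma measurable_quadrant_marginals:
  "f \<in> measurable (H \<Otimes>\<^sub>M borel) R \<Longrightarrow> f \<in> measurable (H \<Otimes>\<^sub>M quadrant_space) R"
proof -
  assume f: "f \<in> measurable (H \<Otimes>\<^sub>M borel) R"
  have "(\<lambda>x. x) \<in> measurable quadrant_space borel" by (rule measurable_restrict_space1) simp
  then have "(\<lambda>x. snd x) \<in> measurable (H \<Otimes>\<^sub>M quadrant_space) borel"
    by (rule measurable_compose[OF measurable_snd])
  from measurable_compose[OF measurable_Pair[OF measurable_fst this] f] show ?thesis by simp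
qed

lemma borel_measurable_fst_snd [measurable]:
  "fst \<in> borel_measurable (borel :: (real \<times> real) measure)" "snd \<in> borel_measurable (borel :: (real \<times> real) measure)"
  by (simp_all add: borel_prod[symmetric])

lemma measurable_Q: "\<omega> \<in> space M \<Longrightarrow> f \<in> measurable borel R \<Longrightarrow> f \<in> measurable (Q \<omega>) R"
  unfolding measurable_cong_sets[OF sets_Q refl] by (rule measurable_restrict_space1)

lemma emeasure_density_Q:
  assumes \<omega>: "\<omega> \<in> space M" and T: "T \<in> sets borel" and A: "A \<in> sets quadrant_space"
  shows "emeasure (density (Q \<omega>) (\<lambda>x. indicator T (fst x))) A = emeasure (Q \<omega>) (A \<inter> T \<times> UNIV)"
proof -
  have TU: "T \<times> UNIV \<in> sets (borel :: (real \<times> real) measure)" using T by (intro borel_Times) auto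
  have AQ: "A \<in> sets (Q \<omega>)" using A sets_Q[OF \<omega>] by simp
  have "A \<inter> T \<times> UNIV \<in> sets borel" "A \<inter> T \<times> UNIV \<subseteq> quadrant"
    using A TU unfolding sets_restrict_borel[OF quadrant_borel] by auto
  then have AT: "A \<inter> T \<times> UNIV \<in> sets (Q \<omega>)" by (rule sets_QI[OF \<omega>])
  have m: "(\<lambda>x. indicator T (fst x) :: ennreal) \<in> borel_measurable (Q \<omega>)"
    using T by (intro measurable_Q \<omega> measurable_compose[OF borel_measurable_fst_snd(1)] borel_measurable_indicator)
  have "emeasure (density (Q \<omega>) (\<lambda>x. indicator T (fst x))) A = (\<integral>\<^sup>+x. indicator T (fst x) * indicator A x \<partial>Q \<omega>)"
    by (rule emeasure_density[OF m AQ])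
  also have "\<dots> = (\<integral>\<^sup>+x. indicator (A \<inter> T \<times> UNIV) x \<partial>Q \<omega>)"
    by (rule nn_integral_cong) (auto simp: indicator_def)
  finally show ?thesis using AT by simp
qed

text \<open>Weighting \<open>Q\<close> by the indicator of \<open>T\<close> turns it into a kernel from \<open>H\<close>, with finite mass on the squares \<open>(0, n] \<times> (0, n]\<close>.\<close>

lemma nn_integral_Q_adapted:
  fixes f :: "'w \<times> (real \<times> real) \<Rightarrow> ennreal"
  assumes H: "space H = space M" and T: "T \<in> sets borel" "T \<subseteq> {0<..}"
    and HQ: "\<And>A. A \<in> sets borel \<Longrightarrow> A \<subseteq> T \<times> {0<..} \<Longrightarrow> (\<lambda>\<omega>. emeasure (Q \<omega>) A) \<in> borel_measurable H"
    and f: "f \<in> borel_measurable (H \<Otimes>\<^sub>M borel)"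
  shows "(\<lambda>\<omega>. \<integral>\<^sup>+x. f (\<omega>, x) * indicator T (fst x) \<partial>Q \<omega>) \<in> borel_measurable H"
proof -
  let ?K = "\<lambda>\<omega>. density (Q \<omega>) (\<lambda>x. indicator T (fst x))"
  have TU: "T \<times> UNIV \<in> sets (borel :: (real \<times> real) measure)" using T by (intro borel_Times) auto
  have "(\<lambda>\<omega>. \<integral>\<^sup>+x. (\<lambda>\<omega> x. f (\<omega>, x)) \<omega> x \<partial>?K \<omega>) \<in> borel_measurable H"
  proof (rule borel_measurable_kernel_nn_integral[where N=quadrant_space and E="\<lambda>n. {0<..real n} \<times> {0<..real n}"])
    show "(\<lambda>(\<omega>, x). f (\<omega>, x)) \<in> borel_measurable (H \<Otimes>\<^sub>M quadrant_space)"
      using measurable_quadrant_marginals[OF f] by simp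
    fix \<omega> assume "\<omega> \<in> space H"
    then have \<omega>: "\<omega> \<in> space M" using H by simp
    show "sets (?K \<omega>) = sets quadrant_space" using sets_Q[OF \<omega>] by simp
    fix n
    have E: "({0<..real n} \<times> {0<..real n}) \<inter> T \<times> UNIV \<in> sets borel" by (intro sets.Int[OF _ TU] borel_Times) auto
    show "emeasure (?K \<omega>) ({0<..real n} \<times> {0<..real n}) < \<infinity>"
      unfolding emeasure_density_Q[OF \<omega> T(1) quadrant_squares(1)]
      by (rule Q_finite[OF \<omega> E]) auto
  next
    fix A assume A: "A \<in> sets quadrant_space"
    then have A': "A \<inter> T \<times> UNIV \<in> sets borel" "A \<inter> T \<times> UNIV \<subseteq> T \<times> {0<..}"
      using TU unfolding sets_restrict_borel[OF quadrant_borel] by auto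
    have "emeasure (?K \<omega>) A = emeasure (Q \<omega>) (A \<inter> T \<times> UNIV)" if "\<omega> \<in> space H" for \<omega>
      using emeasure_density_Q[OF _ T(1) A] that H by simp
    then show "(\<lambda>\<omega>. emeasure (?K \<omega>) A) \<in> borel_measurable H"
      using HQ[OF A'] by (subst measurable_cong)
  qed (rule quadrant_squares)+
  moreover have "(\<integral>\<^sup>+x. f (\<omega>, x) * indicator T (fst x) \<partial>Q \<omega>) = (\<integral>\<^sup>+x. f (\<omega>, x) \<partial>?K \<omega>)" if "\<omega> \<in> space H" for \<omega>
  proof -
    have \<omega>: "\<omega> \<in> space M" using that H by simp
    have m: "(\<lambda>x. indicator T (fst x) :: ennreal) \<in> borel_measurable (Q \<omega>)"
      using T by (intro measurable_Q \<omega> measurable_compose[OF borel_measurable_fst_snd(1)] borel_measurable_indicator)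
    have "(\<lambda>x. f (\<omega>, x)) \<in> borel_measurable borel" using measurable_Pair2[OF f that] .
    from nn_integral_density[OF m measurable_Q[OF \<omega> this]] show ?thesis by (simp add: mult.commute)
  qed
  ultimately show ?thesis by (subst measurable_cong)
qed

text \<open>The number of points of \<open>Q\<close> in \<open>A\<close> strictly before time \<open>t\<close> is an increasing left-continuous adapted
process, so \<open>Q\<close> cut off before the current time is a kernel from the predictable \<open>\<sigma>\<close>-field.\<close>

lemma nn_integral_Q_predictable:
  fixes f :: "(real \<times> 'w) \<times> (real \<times> real) \<Rightarrow> ennreal"
  assumes f: "f \<in> borel_measurable (predictable M D \<Otimes>\<^sub>M borel)"
  shows "(\<lambda>z. \<integral>\<^sup>+x. f (z, x) * indicator {..<fst z} (fst x) \<partial>Q (snd z)) \<in> borel_measurable (predictable M D)"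
proof -
  let ?P = "predictable M D"
  let ?K = "\<lambda>z. density (Q (snd z)) (\<lambda>x. indicator {..<fst z} (fst x))"
  have sp: "snd z \<in> space M" if "z \<in> space ?P" for z using that by (auto simp: data.space_predictable)
  have TU: "{..<t} \<times> UNIV \<in> sets (borel :: (real \<times> real) measure)" for t :: real by (intro borel_Times) auto
  have "(\<lambda>z. \<integral>\<^sup>+x. (\<lambda>z x. f (z, x)) z x \<partial>?K z) \<in> borel_measurable ?P"
  proof (rule borel_measurable_kernel_nn_integral[where N=quadrant_space and E="\<lambda>n. {0<..real n} \<times> {0<..real n}"])
    show "(\<lambda>(\<omega>, x). f (\<omega>, x)) \<in> borel_measurable (?P \<Otimes>\<^sub>M quadrant_space)"
      using measurable_quadrant_marginals[OF f] by simp
    fix z assume "z \<in> space ?P"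
    note \<omega> = sp[OF this]
    show "sets (?K z) = sets quadrant_space" using sets_Q[OF \<omega>] by simp
    fix n
    have E: "({0<..real n} \<times> {0<..real n}) \<inter> {..<fst z} \<times> UNIV \<in> sets borel" by (intro sets.Int[OF _ TU] borel_Times) auto
    show "emeasure (?K z) ({0<..real n} \<times> {0<..real n}) < \<infinity>"
      unfolding emeasure_density_Q[OF \<omega> lessThan_borel quadrant_squares(1)]
      by (rule Q_finite[OF \<omega> E]) auto
  next
    fix A assume A: "A \<in> sets quadrant_space"
    then have A': "A \<inter> {..<t} \<times> UNIV \<in> sets borel" "A \<inter> {..<t} \<times> UNIV \<subseteq> {0<..t} \<times> {0<..}" for t
      using TU[of t] unfolding sets_restrict_borel[OF quadrant_borel] by auto
    have A'': "A \<inter> {..<t} \<times> UNIV \<in> sets (Q \<omega>)" if "\<omega> \<in> space M" for t \<omega>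
      using A'[of t] by (intro sets_QI that) auto
    have "emeasure (?K z) A = emeasure (Q (snd z)) (A \<inter> {..<fst z} \<times> UNIV)" if "z \<in> space ?P" for z
      using emeasure_density_Q[OF sp[OF that] lessThan_borel A] .
    moreover have "(\<lambda>z. (\<lambda>t \<omega>. emeasure (Q \<omega>) (A \<inter> {..<t} \<times> UNIV)) (fst z) (snd z)) \<in> borel_measurable ?P"
    proof (rule data.predictable_monotone_left_continuous)
      show "(\<lambda>\<omega>. emeasure (Q \<omega>) (A \<inter> {..<q} \<times> UNIV)) \<in> borel_measurable (D q)" for q
        by (rule Q_measurable_data[OF A'])
      fix s t :: real and \<omega> assume \<omega>: "\<omega> \<in> space M"
      show "emeasure (Q \<omega>) (A \<inter> {..<s} \<times> UNIV) \<le> emeasure (Q \<omega>) (A \<inter> {..<t} \<times> UNIV)" if "s \<le> t"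
        using that by (intro emeasure_mono A''[OF \<omega>]) auto
      have "(SUP n. emeasure (Q \<omega>) (A \<inter> {..<t - 1 / real (Suc n)} \<times> UNIV)) = emeasure (Q \<omega>) (\<Union>n. A \<inter> {..<t - 1 / real (Suc n)} \<times> UNIV)"
      proof (rule SUP_emeasure_incseq)
        show "range (\<lambda>n. A \<inter> {..<t - 1 / real (Suc n)} \<times> UNIV) \<subseteq> sets (Q \<omega>)" using A''[OF \<omega>] by auto
        have "t - 1 / real (Suc m) \<le> t - 1 / real (Suc n)" if "m \<le> n" for m n
          using that by (simp add: frac_le)
        moreover have "A \<inter> {..<x} \<times> UNIV \<subseteq> A \<inter> {..<y} \<times> UNIV" if "x \<le> y" for x y using that by auto
        ultimately show "incseq (\<lambda>n. A \<inter> {..<t - 1 / real (Suc n)} \<times> UNIV)" unfolding incseq_def by blast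
      qed
      also have "(\<Union>n. A \<inter> {..<t - 1 / real (Suc n)} \<times> UNIV) = A \<inter> {..<t} \<times> UNIV"
      proof (intro equalityI subsetI)
        fix x assume x: "x \<in> A \<inter> {..<t} \<times> UNIV"
        then have "\<exists>n. 1 / real (Suc n) < t - fst x" using reals_Archimedean[of "t - fst x"] by (auto simp: inverse_eq_divide)
        then obtain n where "fst x < t - 1 / real (Suc n)" by (auto simp: algebra_simps)
        with x show "x \<in> (\<Union>n. A \<inter> {..<t - 1 / real (Suc n)} \<times> UNIV)" by (intro UN_I[of n]) auto
      next
        fix x assume "x \<in> (\<Union>n. A \<inter> {..<t - 1 / real (Suc n)} \<times> UNIV)"
        then obtain n where n: "x \<in> A" "fst x < t - 1 / real (Suc n)" by auto
        have "0 < 1 / real (Suc n)" by simp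
        then have "fst x < t" using n(2) by linarith
        then show "x \<in> A \<inter> {..<t} \<times> UNIV" using n(1) by (cases x) auto
      qed
      finally show "emeasure (Q \<omega>) (A \<inter> {..<t} \<times> UNIV) \<le> (SUP n. emeasure (Q \<omega>) (A \<inter> {..<t - 1 / real (Suc n)} \<times> UNIV))"
        by simp
    qed
    ultimately show "(\<lambda>z. emeasure (?K z) A) \<in> borel_measurable ?P" by (subst measurable_cong)
  qed (rule quadrant_squares)+
  moreover have "(\<integral>\<^sup>+x. f (z, x) * indicator {..<fst z} (fst x) \<partial>Q (snd z)) = (\<integral>\<^sup>+x. f (z, x) \<partial>?K z)" if "z \<in> space ?P" for z
  proof -
    note \<omega> = sp[OF that]
    have m: "(\<lambda>x. indicator {..<fst z} (fst x) :: ennreal) \<in> borel_measurable (Q (snd z))"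
      by (intro measurable_Q \<omega>) measurable
    have "(\<lambda>x. f (z, x)) \<in> borel_measurable borel" using measurable_Pair2[OF f that] .
    from nn_integral_density[OF m measurable_Q[OF \<omega> this]] show ?thesis by (simp add: mult.commute)
  qed
  ultimately show ?thesis by (subst measurable_cong)
qed

lemmas sets_N0 = counting_measuresD(1)[OF N0_counting]
lemmas space_N0 = counting_measuresD(2)[OF N0_counting]

lemma nn_integral_N0_measurable:
  fixes f :: "'z \<times> real \<Rightarrow> ennreal"
  assumes W: "\<And>z. z \<in> space P \<Longrightarrow> W z \<in> space M"
    and meas: "\<And>A. A \<in> sets borel \<Longrightarrow> (\<lambda>z. emeasure (N0 (W z)) (A \<inter> {..0})) \<in> borel_measurable P"
    and f: "f \<in> borel_measurable (P \<Otimes>\<^sub>M borel)"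
  shows "(\<lambda>z. \<integral>\<^sup>+s. f (z, s) \<partial>N0 (W z)) \<in> borel_measurable P"
proof -
  let ?N = "restrict_space borel {..0::real}"
  have "(\<lambda>z. \<integral>\<^sup>+s. (\<lambda>z s. f (z, s)) z s \<partial>N0 (W z)) \<in> borel_measurable P"
  proof (rule borel_measurable_kernel_nn_integral[where N="?N" and E="\<lambda>n. {- real n..0}"])
    have "(\<lambda>x. x) \<in> measurable ?N borel" by (rule measurable_restrict_space1) simp
    then have "(\<lambda>x. snd x) \<in> measurable (P \<Otimes>\<^sub>M ?N) borel"
      by (rule measurable_compose[OF measurable_snd])
    from measurable_compose[OF measurable_Pair[OF measurable_fst this] f]
    show "(\<lambda>(z, s). f (z, s)) \<in> borel_measurable (P \<Otimes>\<^sub>M ?N)" by simp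
    show E: "{- real n..0} \<in> sets ?N" for n by (auto simp: sets_restrict_borel)
    show "incseq (\<lambda>n. {- real n..0})" by (auto simp: incseq_def)
    have "\<exists>n. - real n \<le> x" for x using real_arch_simple[of "-x"] by (metis minus_le_iff)
    then show "(\<Union>n. {- real n..0}) = space ?N" by (auto simp: space_restrict_space)
    fix z assume "z \<in> space P"
    note \<omega> = W[OF this]
    show "sets (N0 (W z)) = sets ?N" by (rule sets_N0[OF \<omega>])
    fix n
    show "emeasure (N0 (W z)) {- real n..0} < \<infinity>"
      by (rule counting_measuresD(4)[OF N0_counting[OF \<omega>]]) (use E[of n] sets_N0[OF \<omega>] in auto)
  next
    fix A assume "A \<in> sets ?N"
    then have "A \<in> sets borel" "A \<inter> {..0} = A" by (auto simp: sets_restrict_borel)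
    then show "(\<lambda>z. emeasure (N0 (W z)) A) \<in> borel_measurable P" using meas[of A] by simp
  qed
  then show ?thesis .
qed

lemma nn_integral_N0_predictable:
  fixes f :: "(real \<times> 'w) \<times> real \<Rightarrow> ennreal"
  assumes f: "f \<in> borel_measurable (predictable M D \<Otimes>\<^sub>M borel)"
  shows "(\<lambda>z. \<integral>\<^sup>+s. f (z, s) \<partial>N0 (snd z)) \<in> borel_measurable (predictable M D)"
proof (rule nn_integral_N0_measurable[OF _ _ f])
  show "z \<in> space (predictable M D) \<Longrightarrow> snd z \<in> space M" for z by (auto simp: data.space_predictable)
  fix A :: "real set" assume A: "A \<in> sets borel"
  have "(\<lambda>z. emeasure (N0 (snd z)) (A \<inter> {..0}) * indicator {0<..} (fst z)) \<in> borel_measurable (predictable M D)"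
    by (rule data.predictable_step[OF order.refl N0_emeasure_measurable_data[OF A]])
  moreover have "emeasure (N0 (snd z)) (A \<inter> {..0}) = emeasure (N0 (snd z)) (A \<inter> {..0}) * indicator {0<..} (fst z)"
    if "z \<in> space (predictable M D)" for z using that by (auto simp: data.space_predictable)
  ultimately show "(\<lambda>z. emeasure (N0 (snd z)) (A \<inter> {..0})) \<in> borel_measurable (predictable M D)"
    by (subst measurable_cong)
qed

text \<open>The iterated integral against a random measure \<open>K\<close> and \<open>M\<close> is an integral for one measure on the
predictable \<open>\<sigma>\<close>-field with marks. This turns the compensation formula into the equality of two
measures, which can be checked on generators.\<close>

lemma marked_measure_exists:
  fixes K :: "'w \<Rightarrow> (real \<times> real) measure"
  assumes sets: "\<And>\<omega>. \<omega> \<in> space M \<Longrightarrow> sets (K \<omega>) = sets quadrant_space"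
    and meas: "\<And>g :: 'w \<times> (real \<times> real) \<Rightarrow> ennreal. g \<in> borel_measurable (M \<Otimes>\<^sub>M borel) \<Longrightarrow>
      (\<lambda>\<omega>. \<integral>\<^sup>+x. g (\<omega>, x) * indicator {0<..} (fst x) \<partial>K \<omega>) \<in> borel_measurable M"
  shows "\<exists>\<mu>. sets \<mu> = sets (predictable M F \<Otimes>\<^sub>M (borel :: real measure)) \<and>
    (\<forall>f\<in>borel_measurable (predictable M F \<Otimes>\<^sub>M borel).
      (\<integral>\<^sup>+z. f z \<partial>\<mu>) = (\<integral>\<^sup>+\<omega>. \<integral>\<^sup>+x. f ((fst x, \<omega>), snd x) \<partial>K \<omega> \<partial>M))"
proof -
  let ?R = "predictable M F \<Otimes>\<^sub>M (borel :: real measure)"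
  have space_K: "space (K \<omega>) = quadrant" if "\<omega> \<in> space M" for \<omega>
    using sets_eq_imp_space_eq[OF sets[OF that]] by (simp add: space_restrict_space)
  have lift: "(\<lambda>(\<omega>, x). f ((fst x, \<omega>), snd x) * indicator {0<..} (fst x)) \<in> borel_measurable (M \<Otimes>\<^sub>M borel)"
    if "f \<in> borel_measurable ?R" for f :: "_ \<Rightarrow> ennreal"
    using that sets_F_M by (intro past.predictable_marked_adapted) auto
  have drop: "(\<integral>\<^sup>+x. f ((fst x, \<omega>), snd x) \<partial>K \<omega>) = (\<integral>\<^sup>+x. (f ((fst x, \<omega>), snd x) * indicator {0<..} (fst x)) * indicator {0<..} (fst x) \<partial>K \<omega>)"
    if "\<omega> \<in> space M" for f :: "_ \<Rightarrow> ennreal" and \<omega>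
    by (rule nn_integral_cong) (auto simp: space_K[OF that])
  have outer: "(\<lambda>\<omega>. \<integral>\<^sup>+x. f ((fst x, \<omega>), snd x) \<partial>K \<omega>) \<in> borel_measurable M" if f: "f \<in> borel_measurable ?R" for f :: "_ \<Rightarrow> ennreal"
    using meas[OF lift[OF f]] by (subst measurable_cong[OF drop]) simp_all
  have inner: "(\<lambda>x. f ((fst x, \<omega>), snd x)) \<in> borel_measurable (K \<omega>)" if f: "f \<in> borel_measurable ?R" and \<omega>: "\<omega> \<in> space M" for f :: "_ \<Rightarrow> ennreal" and \<omega>
  proof -
    have "(\<lambda>x. f ((fst x, \<omega>), snd x) * indicator {0<..} (fst x)) \<in> borel_measurable borel"
      using measurable_Pair2[OF lift[OF f] \<omega>] by simp
    then have "(\<lambda>x. f ((fst x, \<omega>), snd x) * indicator {0<..} (fst x)) \<in> borel_measurable (K \<omega>)"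
      unfolding measurable_cong_sets[OF sets[OF \<omega>] refl] by (rule measurable_restrict_space1)
    moreover have "f ((fst x, \<omega>), snd x) = f ((fst x, \<omega>), snd x) * indicator {0<..} (fst x)" if "x \<in> space (K \<omega>)" for x
      using that by (auto simp: space_K[OF \<omega>])
    ultimately show ?thesis by (subst measurable_cong)
  qed
  let ?J = "\<lambda>f. \<integral>\<^sup>+\<omega>. \<integral>\<^sup>+x. f ((fst x, \<omega>), snd x) \<partial>K \<omega> \<partial>M"
  have cmult: "?J (\<lambda>z. c * f z) = c * ?J f" if f: "f \<in> borel_measurable ?R" for f :: "_ \<Rightarrow> ennreal" and c
    using nn_integral_cmult[OF outer[OF f]] nn_integral_cmult[OF inner[OF f]] by (simp cong: nn_integral_cong_simp)
  have plus: "?J (\<lambda>z. f z + g z) = ?J f + ?J g" if f: "f \<in> borel_measurable ?R" and g: "g \<in> borel_measurable ?R" for f g :: "_ \<Rightarrow> ennreal"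
    using nn_integral_add[OF outer[OF f] outer[OF g]] nn_integral_add[OF inner[OF f] inner[OF g]] by (simp cong: nn_integral_cong_simp)
  have suminf: "?J (\<lambda>z. \<Sum>i. f i z) = (\<Sum>i. ?J (f i))" if f: "\<And>i. f i \<in> borel_measurable ?R" for f :: "nat \<Rightarrow> _ \<Rightarrow> ennreal"
    using nn_integral_suminf[OF outer[OF f]] nn_integral_suminf[OF inner[OF f]] by (simp cong: nn_integral_cong_simp)
  have SUP: "?J (\<lambda>z. SUP i. U i z) = (SUP i. ?J (U i))" if U: "\<And>i. U i \<in> borel_measurable ?R" and inc: "incseq U" for U :: "nat \<Rightarrow> _ \<Rightarrow> ennreal"
  proof -
    have i1: "incseq (\<lambda>i x. U i ((fst x, \<omega>), snd x))" for \<omega> using inc by (auto simp: incseq_def le_fun_def)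
    have i2: "incseq (\<lambda>i \<omega>. \<integral>\<^sup>+x. U i ((fst x, \<omega>), snd x) \<partial>K \<omega>)"
      using inc by (auto simp: incseq_def le_fun_def intro!: nn_integral_mono)
    show ?thesis
      using nn_integral_monotone_convergence_SUP[OF i2 outer[OF U]] nn_integral_monotone_convergence_SUP[OF i1 inner[OF U]]
      by (simp cong: nn_integral_cong_simp)
  qed
  define \<mu> where "\<mu> = measure_of (space ?R) (sets ?R) (\<lambda>A. ?J (indicator A))"
  have s: "sets \<mu> = sets ?R" by (simp add: \<mu>_def)
  have em: "emeasure \<mu> A = ?J (indicator A)" if A: "A \<in> sets ?R" for A
  proof (rule emeasure_measure_of[OF \<mu>_def])
    show "countably_additive (sets \<mu>) (\<lambda>A. ?J (indicator A))"
    proof (rule countably_additiveI)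
      fix A :: "nat \<Rightarrow> _" assume A: "range A \<subseteq> sets \<mu>" "disjoint_family A"
      have "(\<Sum>i. ?J (indicator (A i))) = ?J (\<lambda>z. \<Sum>i. indicator (A i) z)"
        using A(1) s by (intro suminf[symmetric]) auto
      then show "(\<Sum>i. ?J (indicator (A i))) = ?J (indicator (\<Union>i. A i))" by (simp only: suminf_indicator[OF A(2)])
    qed
  qed (use A s sets.space_closed in \<open>auto simp: positive_def\<close>)
  have "(\<integral>\<^sup>+z. f z \<partial>\<mu>) = ?J f" if "f \<in> borel_measurable ?R" for f
    using that
  proof (induct rule: borel_measurable_induct)
    case (cong f g)
    have "?J f = ?J g"
      using cong(3) by (intro nn_integral_cong) (auto simp: space_K space_pair_measure past.space_predictable)
    moreover have "(\<integral>\<^sup>+z. f z \<partial>\<mu>) = (\<integral>\<^sup>+z. g z \<partial>\<mu>)"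
      using cong(3) by (intro nn_integral_cong) (simp add: \<mu>_def)
    ultimately show ?case using cong(4) by simp
  next
    case (set A) then show ?case using em s by simp
  next
    case (mult f c) then show ?case using cmult[of f c] by (simp add: nn_integral_cmult measurable_cong_sets[OF s refl])
  next
    case (add f g) then show ?case using plus[of g f]
      by (simp add: nn_integral_add measurable_cong_sets[OF s refl])
  next
    case (seq U)
    have "(\<integral>\<^sup>+z. (SUP i. U i z) \<partial>\<mu>) = (SUP i. \<integral>\<^sup>+z. U i z \<partial>\<mu>)"
      using seq(1,4) by (intro nn_integral_monotone_convergence_SUP) (simp_all add: measurable_cong_sets[OF s refl])
    then show ?case using SUP[OF seq(1,4)] seq(3) by (simp add: image_comp)
  qed
  with s show ?thesis by blast
qed

lemma nn_integral_const_kernel_measurable: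
  assumes g: "g \<in> borel_measurable (M \<Otimes>\<^sub>M borel)"
  shows "(\<lambda>\<omega>. \<integral>\<^sup>+x. g (\<omega>, x) * indicator {0<..} (fst x) \<partial>restrict_space lborel quadrant :: ennreal) \<in> borel_measurable M"
proof -
  have [measurable]: "g \<in> borel_measurable (M \<Otimes>\<^sub>M (lborel :: (real \<times> real) measure))"
    using g by (simp cong: measurable_cong_sets)
  have "(\<lambda>\<omega>. \<integral>\<^sup>+x. g (\<omega>, x) * indicator {0<..} (fst x) * indicator quadrant x \<partial>lborel) \<in> borel_measurable M"
    using quadrant_borel by measurable
  then show ?thesis using quadrant_borel by (simp add: nn_integral_restrict_space)
qed

text \<open>Products of a predictable rectangle with a half-line of marks are stable under intersection and
generate. On \<open>((s, t] \<times> X) \<times> (-\<infinity>, b]\<close> both sides equal \<open>(t - s) * max b 0 * P(X)\<close>: on the left by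
\<open>Q_rectangle_mean\<close>, on the right by the area of a rectangle.\<close>

lemma compensation_formula:
  fixes f :: "(real \<times> 'w) \<times> real \<Rightarrow> ennreal"
  assumes f: "f \<in> borel_measurable (predictable M F \<Otimes>\<^sub>M borel)"
  shows "(\<integral>\<^sup>+\<omega>. \<integral>\<^sup>+x. f ((fst x, \<omega>), snd x) \<partial>Q \<omega> \<partial>M) =
    (\<integral>\<^sup>+\<omega>. \<integral>\<^sup>+x. f ((fst x, \<omega>), snd x) \<partial>restrict_space lborel quadrant \<partial>M)"
proof -
  let ?rect = "past.predictable_rectangles" and ?half = "range (\<lambda>b::real. {..b})"
  let ?R = "predictable M F \<Otimes>\<^sub>M (borel :: real measure)"
  let ?G = "{a \<times> b | a b. a \<in> ?rect \<and> b \<in> ?half}"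
  let ?E = "\<lambda>n. ({0<..real n} \<times> space M) \<times> {..real n}"
  let ?Ca = "range (\<lambda>n. {0<..real n} \<times> space M)" and ?Cb = "range (\<lambda>n. {..real n})"
  have M0: "space M \<in> sets (F 0)" using sets.top[of "F 0"] space_F[of 0] by simp
  have Ca: "?Ca \<subseteq> ?rect"
  proof (rule image_subsetI)
    show "{0<..real n} \<times> space M \<in> ?rect" for n
      using M0 by (intro CollectI exI[of _ "0::real"] exI[of _ "real n"] exI[of _ "space M"]) simp
  qed
  have UCa: "\<Union>?Ca = space (predictable M F)"
  proof -
    have "\<exists>n. t \<le> real n" for t :: real using real_arch_simple by blast
    then show ?thesis by (auto simp: past.space_predictable)
  qed
  have UCb: "\<Union>?Cb = (UNIV :: real set)" using real_arch_simple by auto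
  have sR: "sets ?R = sets (sigma (space (predictable M F) \<times> space (borel :: real measure)) ?G)"
  proof (rule sets_pair_eq[where Ca="?Ca" and Cb="?Cb"])
    show "?rect \<subseteq> Pow (space (predictable M F))" using past.predictable_rectangles_subset by (simp add: past.space_predictable)
    show "sets (predictable M F) = sigma_sets (space (predictable M F)) ?rect" by (simp only: past.sets_predictable past.space_predictable)
    show "sets (borel :: real measure) = sigma_sets (space borel) ?half" by (subst borel_eq_atMost) simp
  qed (use Ca UCa UCb in auto)
  have Gsub: "?G \<subseteq> Pow (({0<..} \<times> space M) \<times> UNIV)" using past.predictable_rectangles_subset by blast
  have sR': "sets ?R = sigma_sets (({0<..} \<times> space M) \<times> UNIV) ?G"
    unfolding sR using Gsub by (simp add: past.space_predictable)
  have Int: "Int_stable ?G"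
  proof (rule Int_stableI)
    fix A B assume "A \<in> ?G" "B \<in> ?G"
    then obtain s t X b s' t' X' b' where *: "A = ({s<..t} \<times> X) \<times> {..b}" "0 \<le> s" "s \<le> t" "X \<in> sets (F s)"
      "B = ({s'<..t'} \<times> X') \<times> {..b'}" "0 \<le> s'" "s' \<le> t'" "X' \<in> sets (F s')" by blast
    have X: "X \<inter> X' \<in> sets (F (max s s'))"
      using * F_mono[of s "max s s'"] F_mono[of s' "max s s'"] by (intro sets.Int) auto
    have "A \<inter> B = ({max s s'<..max (max s s') (min t t')} \<times> (X \<inter> X')) \<times> {..min b b'}"
      using * by auto
    moreover have "{max s s'<..max (max s s') (min t t')} \<times> (X \<inter> X') \<in> ?rect"
      using * X by (intro CollectI exI[of _ "max s s'"] exI[of _ "max (max s s') (min t t')"] exI[of _ "X \<inter> X'"]) simp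
    ultimately show "A \<inter> B \<in> ?G" by blast
  qed
  obtain \<mu> where \<mu>: "sets \<mu> = sets ?R"
    "\<And>f. f \<in> borel_measurable ?R \<Longrightarrow> (\<integral>\<^sup>+z. f z \<partial>\<mu>) = (\<integral>\<^sup>+\<omega>. \<integral>\<^sup>+x. f ((fst x, \<omega>), snd x) \<partial>Q \<omega> \<partial>M)"
  proof -
    have "\<exists>\<mu>. sets \<mu> = sets ?R \<and> (\<forall>f\<in>borel_measurable ?R. (\<integral>\<^sup>+z. f z \<partial>\<mu>) = (\<integral>\<^sup>+\<omega>. \<integral>\<^sup>+x. f ((fst x, \<omega>), snd x) \<partial>Q \<omega> \<partial>M))"
      by (rule marked_measure_exists[OF sets_Q nn_integral_Q_adapted]) (auto intro: Q_measurable_M)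
    then show ?thesis using that by blast
  qed
  obtain \<nu> where \<nu>: "sets \<nu> = sets ?R"
    "\<And>f. f \<in> borel_measurable ?R \<Longrightarrow> (\<integral>\<^sup>+z. f z \<partial>\<nu>) = (\<integral>\<^sup>+\<omega>. \<integral>\<^sup>+x. f ((fst x, \<omega>), snd x) \<partial>restrict_space lborel quadrant \<partial>M)"
  proof -
    have "sets (restrict_space lborel quadrant) = sets quadrant_space" by (intro sets_restrict_space_cong) simp
    from marked_measure_exists[OF this nn_integral_const_kernel_measurable] show ?thesis using that by blast
  qed
  have rectval: "(\<integral>\<^sup>+\<omega>. \<integral>\<^sup>+x. indicator (({s<..t} \<times> X) \<times> {..b}) ((fst x, \<omega>), snd x) \<partial>K \<omega> \<partial>M) =
      (\<integral>\<^sup>+\<omega>. emeasure (K \<omega>) ({s<..t} \<times> {0<..b}) * indicator X \<omega> \<partial>M)"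
    if K: "\<And>\<omega>. \<omega> \<in> space M \<Longrightarrow> sets (K \<omega>) = sets quadrant_space" and s: "0 \<le> s" for K :: "'w \<Rightarrow> (real \<times> real) measure" and s t X b
  proof (rule nn_integral_cong)
    fix \<omega> assume \<omega>: "\<omega> \<in> space M"
    have "{s<..t} \<times> {0<..b} \<in> sets (borel :: (real \<times> real) measure)" by (intro borel_Times) auto
    then have [measurable]: "{s<..t} \<times> {0<..b} \<in> sets (K \<omega>)"
      using s by (auto simp: K[OF \<omega>] sets_restrict_borel[OF quadrant_borel])
    have sp: "space (K \<omega>) = quadrant" using sets_eq_imp_space_eq[OF K[OF \<omega>]] by (simp add: space_restrict_space)
    have "(\<integral>\<^sup>+x. indicator (({s<..t} \<times> X) \<times> {..b}) ((fst x, \<omega>), snd x) \<partial>K \<omega>) =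
      (\<integral>\<^sup>+x. indicator ({s<..t} \<times> {0<..b}) x * indicator X \<omega> \<partial>K \<omega>)"
      by (rule nn_integral_cong) (auto simp: sp indicator_def)
    also have "\<dots> = emeasure (K \<omega>) ({s<..t} \<times> {0<..b}) * indicator X \<omega>"
      by (subst nn_integral_multc) auto
    finally show "(\<integral>\<^sup>+x. indicator (({s<..t} \<times> X) \<times> {..b}) ((fst x, \<omega>), snd x) \<partial>K \<omega>) = emeasure (K \<omega>) ({s<..t} \<times> {0<..b}) * indicator X \<omega>" .
  qed
  have rectQ: "(\<integral>\<^sup>+\<omega>. \<integral>\<^sup>+x. indicator (({s<..t} \<times> X) \<times> {..b}) ((fst x, \<omega>), snd x) \<partial>Q \<omega> \<partial>M) = ennreal ((t - s) * max b 0) * emeasure M X"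
    if "0 \<le> s" "s \<le> t" "X \<in> sets (F s)" for s t X b
    using rectval[OF sets_Q that(1)] Q_rectangle_mean[OF that] by simp
  have rectL: "(\<integral>\<^sup>+\<omega>. \<integral>\<^sup>+x. indicator (({s<..t} \<times> X) \<times> {..b}) ((fst x, \<omega>), snd x) \<partial>restrict_space lborel quadrant \<partial>M) = ennreal ((t - s) * max b 0) * emeasure M X"
    if "0 \<le> s" "s \<le> t" "X \<in> sets (F s)" for s t X b
  proof -
    have X: "X \<in> sets M" using that sets_F_M by blast
    have "emeasure (restrict_space lborel quadrant) ({s<..t} \<times> {0<..b}) = emeasure lborel ({s<..t} \<times> {0<..b})"
      using quadrant_borel that(1) by (intro emeasure_restrict_space) auto
    also have "\<dots> = emeasure lborel {s<..t} * emeasure lborel {0<..b}"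
      unfolding lborel_prod[symmetric] by (rule lborel.emeasure_pair_measure_Times) auto
    also have "\<dots> = ennreal (t - s) * ennreal (max b 0)" using that by (cases "0 \<le> b") (auto simp: max_def)
    also have "\<dots> = ennreal ((t - s) * max b 0)" using that by (simp add: ennreal_mult)
    finally have e: "emeasure (restrict_space lborel quadrant) ({s<..t} \<times> {0<..b}) = ennreal ((t - s) * max b 0)" .
    have "sets (restrict_space lborel quadrant) = sets quadrant_space" by (intro sets_restrict_space_cong) simp
    from rectval[OF this that(1)] show ?thesis using X by (simp add: e nn_integral_cmult)
  qed
  have in_R: "A \<in> sets ?R" if "A \<in> ?G" for A using that by (auto simp: sR' intro!: sigma_sets.Basic)
  have em: "emeasure \<mu> A = ennreal ((t - s) * max b 0) * emeasure M X" "emeasure \<nu> A = ennreal ((t - s) * max b 0) * emeasure M X"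
    if A: "A = ({s<..t} \<times> X) \<times> {..b}" "0 \<le> s" "s \<le> t" "X \<in> sets (F s)" for A s t X b
  proof -
    have "A \<in> sets ?R" using A by (intro in_R) blast
    then show "emeasure \<mu> A = ennreal ((t - s) * max b 0) * emeasure M X" "emeasure \<nu> A = ennreal ((t - s) * max b 0) * emeasure M X"
      using \<mu>(2)[of "indicator A"] \<nu>(2)[of "indicator A"] \<mu>(1) \<nu>(1) rectQ[OF A(2-4), of b] rectL[OF A(2-4), of b]
      by (simp_all add: A(1))
  qed
  have "\<mu> = \<nu>"
  proof (rule measure_eqI_generator_eq[OF Int Gsub _ \<mu>(1)[unfolded sR'] \<nu>(1)[unfolded sR'], where A="?E"])
    show "range ?E \<subseteq> ?G"
    proof (rule image_subsetI)
      fix n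
      have "{0<..real n} \<times> space M \<in> ?rect"
        using M0 by (intro CollectI exI[of _ "0::real"] exI[of _ "real n"] exI[of _ "space M"]) simp
      then show "?E n \<in> ?G" by blast
    qed
    have "z \<in> (\<Union>n. ?E n)" if "z \<in> ({0<..} \<times> space M) \<times> UNIV" for z
    proof -
      obtain n :: nat where "max (fst (fst z)) (snd z) \<le> real n" using real_arch_simple by blast
      with that show ?thesis by (intro UN_I[of n]) auto
    qed
    then show "(\<Union>n. ?E n) = ({0<..} \<times> space M) \<times> UNIV" by auto
    show "emeasure \<mu> (?E n) \<noteq> \<infinity>" for n
      using em(1)[OF refl order.refl of_nat_0_le_iff M0] by (simp add: ennreal_mult_eq_top_iff emeasure_eq_measure)
    fix A assume "A \<in> ?G"
    then obtain s t X b where *: "A = ({s<..t} \<times> X) \<times> {..b}" "0 \<le> s" "s \<le> t" "X \<in> sets (F s)" by blast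
    show "emeasure \<mu> A = emeasure \<nu> A" unfolding em[OF *] ..
  qed
  then show ?thesis using \<mu>(2)[OF f] \<nu>(2)[OF f] by simp
qed

text \<open>Integrating the marks out of \<open>compensation_formula\<close>: the marks \<open>\<theta> \<le> l\<close> have total length \<open>l\<close>.\<close>

lemma thinning_compensator:
  fixes C l :: "real \<times> 'w \<Rightarrow> ennreal"
  assumes C: "C \<in> borel_measurable (predictable M F)" and l: "l \<in> borel_measurable (predictable M F)"
  shows "(\<integral>\<^sup>+\<omega>. \<integral>\<^sup>+x. C (fst x, \<omega>) * of_bool (ennreal (snd x) \<le> l (fst x, \<omega>)) \<partial>Q \<omega> \<partial>M) =
    (\<integral>\<^sup>+\<omega>. (\<integral>\<^sup>+u\<in>{0<..}. C (u, \<omega>) * l (u, \<omega>) \<partial>lborel) \<partial>M)"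
proof -
  note [measurable] = C l
  have "(\<lambda>x. C (fst x) * of_bool (ennreal (snd x) \<le> l (fst x))) \<in> borel_measurable (predictable M F \<Otimes>\<^sub>M borel)"
    by measurable
  from compensation_formula[OF this]
  have "(\<integral>\<^sup>+\<omega>. \<integral>\<^sup>+x. C (fst x, \<omega>) * of_bool (ennreal (snd x) \<le> l (fst x, \<omega>)) \<partial>Q \<omega> \<partial>M) =
    (\<integral>\<^sup>+\<omega>. \<integral>\<^sup>+x. C (fst x, \<omega>) * of_bool (ennreal (snd x) \<le> l (fst x, \<omega>)) \<partial>restrict_space lborel quadrant \<partial>M)"
    by simp
  also have "\<dots> = (\<integral>\<^sup>+\<omega>. (\<integral>\<^sup>+u\<in>{0<..}. C (u, \<omega>) * l (u, \<omega>) \<partial>lborel) \<partial>M)"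
  proof (rule nn_integral_cong)
    fix \<omega> assume \<omega>: "\<omega> \<in> space M"
    define c where "c = (\<lambda>u. C (u, \<omega>) * indicator {0<..} u)"
    define k where "k = (\<lambda>u. l (u, \<omega>) * indicator {0<..} u)"
    have [measurable]: "c \<in> borel_measurable borel" "k \<in> borel_measurable borel"
      unfolding c_def k_def by (rule past.predictable_section[OF C \<omega>], rule past.predictable_section[OF l \<omega>])
    have "(\<integral>\<^sup>+x. C (fst x, \<omega>) * of_bool (ennreal (snd x) \<le> l (fst x, \<omega>)) \<partial>restrict_space lborel quadrant) =
      (\<integral>\<^sup>+x. c (fst x) * (of_bool (ennreal (snd x) \<le> k (fst x)) * indicator {0<..} (snd x)) \<partial>(lborel \<Otimes>\<^sub>M lborel))"
      using quadrant_borel unfolding lborel_prod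
      by (subst nn_integral_restrict_space) (auto intro!: nn_integral_cong simp: c_def k_def indicator_def)
    also have "\<dots> = (\<integral>\<^sup>+u. \<integral>\<^sup>+\<theta>. c u * (of_bool (ennreal \<theta> \<le> k u) * indicator {0<..} \<theta>) \<partial>lborel \<partial>lborel)"
      by (subst lborel.nn_integral_fst[symmetric]) auto
    also have "\<dots> = (\<integral>\<^sup>+u. c u * k u \<partial>lborel)"
      by (intro nn_integral_cong) (subst nn_integral_cmult, auto simp: emeasure_lborel_below)
    also have "\<dots> = (\<integral>\<^sup>+u\<in>{0<..}. C (u, \<omega>) * l (u, \<omega>) \<partial>lborel)"
      by (intro nn_integral_cong) (auto simp: c_def k_def indicator_def)
    finally show "(\<integral>\<^sup>+x. C (fst x, \<omega>) * of_bool (ennreal (snd x) \<le> l (fst x, \<omega>)) \<partial>restrict_space lborel quadrant) =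
      (\<integral>\<^sup>+u\<in>{0<..}. C (u, \<omega>) * l (u, \<omega>) \<partial>lborel)" .
  qed
  finally show ?thesis .
qed

end

section \<open>The equation along a path\<close>

text \<open>The properties of \<open>D a b\<close>, the number of points in \<open>(a, b]\<close>, that the induction along the points uses:
additivity, no values strictly between \<open>0\<close> and \<open>1\<close>, and continuity at the left endpoint. In this form
they are also inherited by the sum of two counts.\<close>

definition counting_increments :: "(real \<Rightarrow> real \<Rightarrow> ennreal) \<Rightarrow> bool" where
  "counting_increments D \<longleftrightarrow>
    (\<forall>a b c. a \<le> b \<longrightarrow> b \<le> c \<longrightarrow> D a c = D a b + D b c) \<and>
    (\<forall>a b. D a b < 1 \<longrightarrow> D a b = 0) \<and>
    (\<forall>a b. (\<forall>s. a < s \<longrightarrow> s \<le> b \<longrightarrow> D s b = 0) \<longrightarrow> D a b = 0)"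

lemma counting_incrementsD:
  assumes "counting_increments D"
  shows "a \<le> b \<Longrightarrow> b \<le> c \<Longrightarrow> D a c = D a b + D b c" "D a b < 1 \<Longrightarrow> D a b = 0"
    "(\<And>s. a < s \<Longrightarrow> s \<le> b \<Longrightarrow> D s b = 0) \<Longrightarrow> D a b = 0"
  using assms unfolding counting_increments_def by blast+

lemma counting_increments_add:
  assumes "counting_increments D" "counting_increments D'"
  shows "counting_increments (\<lambda>a b. D a b + D' a b)"
  unfolding counting_increments_def
proof (intro conjI allI impI)
  fix a b c :: real assume "a \<le> b" "b \<le> c"
  then show "D a c + D' a c = D a b + D' a b + (D b c + D' b c)"
    using counting_incrementsD(1)[OF assms(1), of a b c] counting_incrementsD(1)[OF assms(2), of a b c]
    by (simp only: add_ac)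
next
  fix a b assume l: "D a b + D' a b < 1"
  have "D a b \<le> D a b + D' a b" "D' a b \<le> D a b + D' a b" by simp_all
  with l have "D a b < 1" "D' a b < 1" by (meson le_less_trans)+
  then show "D a b + D' a b = 0"
    using counting_incrementsD(2)[OF assms(1)] counting_incrementsD(2)[OF assms(2)] by simp
next
  fix a b assume "\<forall>s>a. s \<le> b \<longrightarrow> D s b + D' s b = 0"
  then show "D a b + D' a b = 0"
    using counting_incrementsD(3)[OF assms(1), of a b] counting_incrementsD(3)[OF assms(2), of a b] by simp
qed

lemma counting_increments_measure:
  assumes N: "sets N = sets borel" and nat: "\<And>A. A \<in> sets borel \<Longrightarrow> emeasure N A \<in> insert \<infinity> (range of_nat)"
  shows "counting_increments (\<lambda>a b. emeasure N {a<..b})"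
  unfolding counting_increments_def
proof (intro conjI allI impI)
  fix a b c :: real assume "a \<le> b" "b \<le> c"
  then have "{a<..c} = {a<..b} \<union> {b<..c}" "{a<..b} \<inter> {b<..c} = {}" by auto
  then show "emeasure N {a<..c} = emeasure N {a<..b} + emeasure N {b<..c}"
    using plus_emeasure[of "{a<..b}" N "{b<..c}"] by (simp add: N)
next
  fix a b assume "emeasure N {a<..b} < 1"
 moreover have "emeasure N {a<..b} = \<infinity> \<or> (\<exists>n. emeasure N {a<..b} = of_nat n)" using nat[of "{a<..b}"] by auto
  moreover have "n = 0" if "of_nat n < (1 :: ennreal)" for n :: nat
    using that by (simp add: ennreal_of_nat_eq_real_of_nat ennreal_less_iff flip: ennreal_1)
  ultimately show "emeasure N {a<..b} = 0" by auto
next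
  fix a b :: real assume z: "\<forall>s. a < s \<longrightarrow> s \<le> b \<longrightarrow> emeasure N {s<..b} = 0"
  have "{a<..b} = (\<Union>n. {a + (b - a) / real (n + 2)<..b})" if "a < b"
  proof (intro equalityI subsetI)
    fix x assume x: "x \<in> {a<..b}"
    then have "\<exists>n. b - a < real n * (x - a)" using reals_Archimedean3[of "x - a"] by auto
    then obtain n where "b - a < real n * (x - a)" by blast
    also have "\<dots> \<le> real (n + 2) * (x - a)" using x by (intro mult_right_mono) auto
    finally have "(b - a) / real (n + 2) < x - a" by (simp add: field_simps)
    then show "x \<in> (\<Union>n. {a + (b - a) / real (n + 2)<..b})" using x by (intro UN_I[of n]) auto
  next
    fix x assume "x \<in> (\<Union>n. {a + (b - a) / real (n + 2)<..b})"
    then obtain n where n: "a + (b - a) / real (n + 2) < x" "x \<le> b" by auto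
    have "0 < (b - a) / real (n + 2)" using that by simp
    then show "x \<in> {a<..b}" using n by auto
  qed
  moreover have "emeasure N (\<Union>n. {a + (b - a) / real (n + 2)<..b}) = 0" if "a < b"
  proof (rule emeasure_UN_eq_0)
    fix n :: nat
    have p: "0 < (b - a) / real (n + 2)" using that by simp
    have "(b - a) / real (n + 2) \<le> (b - a) / 1" using that by (intro divide_left_mono) auto
    then show "emeasure N {a + (b - a) / real (n + 2)<..b} = 0" using z p by simp
  qed (auto simp: N)
  ultimately show "emeasure N {a<..b} = 0" by (cases "a < b") auto
qed

text \<open>Induction on the number of points in \<open>(0, t]\<close>. Here \<open>\<tau>\<close> is the infimum of the times after which no point
occurs up to \<open>t\<close>. By continuity \<open>(\<tau>, t]\<close> contains no point, while for \<open>s < \<tau>\<close> the interval \<open>(s, t]\<close>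
contains one, so \<open>(0, s]\<close> has one point less than \<open>(0, t]\<close> and the induction hypothesis applies to
every \<open>s < \<tau>\<close>. The case \<open>\<tau> = 0\<close>, with no earlier time, is the start of the induction.\<close>

lemma counting_increments_induct:
  assumes D: "counting_increments D"
    and step: "\<And>n t \<tau>. 0 \<le> \<tau> \<Longrightarrow> \<tau> \<le> t \<Longrightarrow> D \<tau> t = 0 \<Longrightarrow> (\<And>s. 0 \<le> s \<Longrightarrow> s < \<tau> \<Longrightarrow> P n s) \<Longrightarrow> P (Suc n) t"
    and t: "0 \<le> t" "D 0 t \<le> of_nat n"
  shows "P (Suc n) t"
proof -
  note add = counting_incrementsD(1)[OF D] and int = counting_incrementsD(2)[OF D] and right = counting_incrementsD(3)[OF D]
  show ?thesis using t
  proof (induct n arbitrary: t)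
    case 0
    then show ?case by (intro step[of 0 t]) auto
  next
    case (Suc n)
    define S where "S = {s. 0 \<le> s \<and> s \<le> t \<and> D s t = 0}"
    have "D t t = 0" by (rule right) auto
    then have tS: "t \<in> S" using Suc(2) by (auto simp: S_def)
    have bdd: "bdd_below S" by (rule bdd_belowI[of _ 0]) (auto simp: S_def)
    define \<tau> where "\<tau> = Inf S"
    have \<tau>: "0 \<le> \<tau>" "\<tau> \<le> t" unfolding \<tau>_def
      using tS bdd by (auto intro!: cInf_greatest cInf_lower simp: S_def)
    have "D \<tau> t = 0"
    proof (rule right)
      fix s assume s: "\<tau> < s" "s \<le> t"
      then obtain s' where s': "s' \<in> S" "s' < s" using cInf_lessD[of S s] tS unfolding \<tau>_def by auto
      then have "D s' t = D s' s + D s t" using s by (intro add) auto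
      then show "D s t = 0" using s' by (simp add: S_def)
    qed
    then show ?case
    proof (rule step[OF \<tau>])
      fix s assume s: "0 \<le> s" "s < \<tau>"
      have "s \<notin> S" using cInf_lower[OF _ bdd, of s] s unfolding \<tau>_def by auto
      then have "D s t \<noteq> 0" using s \<tau> by (auto simp: S_def)
      then have "1 \<le> D s t" using int[of s t] by (meson not_le)
      then have "D 0 s + 1 \<le> of_nat (Suc n)"
        using add[of 0 s t] s \<tau> Suc(3) by (metis add_left_mono less_imp_le order_trans)
      then have "D 0 s + 1 \<le> of_nat n + 1" by (simp add: add.commute)
      then have "D 0 s \<le> of_nat n" by simp
      then show "P (Suc n) s" using Suc(1) s by simp
    qed
  qed
qed

text \<open>\<open>l\<close> is a candidate intensity: the points of \<open>q\<close> below its graph are accepted. The quantity below is the integral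
of \<open>g (u - s)\<close> over the past of \<open>u\<close> for the point process formed by \<open>n0\<close> and the accepted points.
Working with \<open>l\<close> and \<open>q\<close> instead of this point process keeps the kernel \<open>q\<close> locally finite even when
infinitely many points are accepted.\<close>

definition past_mass :: "real measure \<Rightarrow> (real \<times> real) measure \<Rightarrow> (real \<Rightarrow> ennreal) \<Rightarrow> (real \<Rightarrow> ennreal) \<Rightarrow> real \<Rightarrow> ennreal" where
  "past_mass n0 q g l u = (\<integral>\<^sup>+s. g (u - s) \<partial>n0) +
    (\<integral>\<^sup>+x. g (u - fst x) * of_bool (ennreal (snd x) \<le> l (fst x)) * indicator {..<u} (fst x) \<partial>q)"

definition next_intensity :: "real measure \<Rightarrow> (real \<times> real) measure \<Rightarrow> real \<Rightarrow> (real \<Rightarrow> real) \<Rightarrow> (real \<Rightarrow> ennreal) \<Rightarrow> real \<Rightarrow> ennreal" where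
  "next_intensity n0 q lam h l u = e2ennreal (max (ereal lam +
    (enn2ereal (past_mass n0 q (\<lambda>t. ennreal (h t)) l u) - enn2ereal (past_mass n0 q (\<lambda>t. ennreal (- h t)) l u))) 0)"

abbreviation accepted :: "(real \<times> real) measure \<Rightarrow> (real \<Rightarrow> ennreal) \<Rightarrow> real set \<Rightarrow> ennreal" where
  "accepted q l A \<equiv> \<integral>\<^sup>+x. indicator A (fst x) * of_bool (ennreal (snd x) \<le> l (fst x)) \<partial>q"

text \<open>The right-hand side of the equation, as a set function.\<close>

definition thinned :: "real measure \<Rightarrow> (real \<times> real) measure \<Rightarrow> (real \<Rightarrow> ennreal) \<Rightarrow> real set \<Rightarrow> ennreal" where
  "thinned n0 q l A = emeasure n0 (A \<inter> {..0}) + (\<integral>\<^sup>+(u, \<theta>). indicator A u * of_bool (ennreal \<theta> \<le> l u) \<partial>q)"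

locale hawkes_path =
  fixes n0 :: "real measure" and q :: "(real \<times> real) measure"
  assumes n0: "n0 \<in> counting_measures {..0}" and q: "q \<in> counting_measures quadrant"
begin

lemmas sets_n0 = counting_measuresD(1)[OF n0]
lemmas space_n0 = counting_measuresD(2)[OF n0]
lemmas sets_q = counting_measuresD(1)[OF q]
lemmas space_q = counting_measuresD(2)[OF q]

lemma measurable_q: "f \<in> measurable borel R \<Longrightarrow> f \<in> measurable q R"
  unfolding measurable_cong_sets[OF sets_q refl] by (rule measurable_restrict_space1)

lemma measurable_n0: "f \<in> measurable borel R \<Longrightarrow> f \<in> measurable n0 R"
  unfolding measurable_cong_sets[OF sets_n0 refl] by (rule measurable_restrict_space1)

lemma [measurable]: "fst \<in> borel_measurable (borel :: (real \<times> real) measure)"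
  "snd \<in> borel_measurable (borel :: (real \<times> real) measure)"
  by (simp_all add: borel_prod[symmetric])

lemma accept_measurable:
  assumes [measurable]: "l \<in> borel_measurable borel" "f \<in> borel_measurable borel"
  shows "(\<lambda>x. f (fst x) * of_bool (ennreal (snd x) \<le> l (fst x)) :: ennreal) \<in> borel_measurable q"
  by (rule measurable_q) measurable

lemma thinned_eq: "thinned n0 q l A = emeasure n0 (A \<inter> {..0}) + (accepted q l A)"
  by (simp add: thinned_def split_beta')

lemma thinned_accept:
  assumes l: "l \<in> borel_measurable borel" and A: "A \<in> sets borel"
  shows "(accepted q l A) =
    emeasure q ({x. fst x \<in> A \<and> ennreal (snd x) \<le> l (fst x)} \<inter> quadrant)"
    "{x. fst x \<in> A \<and> ennreal (snd x) \<le> l (fst x)} \<inter> quadrant \<in> sets q"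
proof -
  note [measurable] = l A
  have "{x. fst x \<in> A \<and> ennreal (snd x) \<le> l (fst x)} \<in> sets (borel :: (real \<times> real) measure)"
    by measurable
  then show s: "{x. fst x \<in> A \<and> ennreal (snd x) \<le> l (fst x)} \<inter> quadrant \<in> sets q"
    using quadrant_borel unfolding sets_q sets_restrict_borel[OF quadrant_borel] by auto
  have "(accepted q l A) =
    (\<integral>\<^sup>+x. indicator ({x. fst x \<in> A \<and> ennreal (snd x) \<le> l (fst x)} \<inter> quadrant) x \<partial>q)"
    by (rule nn_integral_cong) (auto simp: space_q indicator_def)
  then show "(accepted q l A) =
    emeasure q ({x. fst x \<in> A \<and> ennreal (snd x) \<le> l (fst x)} \<inter> quadrant)" using s by simp
qed

lemma thinned_measure:
  assumes l: "l \<in> borel_measurable borel"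
  defines "N \<equiv> measure_of UNIV (sets borel) (thinned n0 q l)"
  shows "sets N = sets borel" "A \<in> sets borel \<Longrightarrow> emeasure N A = thinned n0 q l A"
proof -
  show s: "sets N = sets borel" unfolding N_def
    using sets.sigma_sets_eq[of "borel :: real measure"] by simp
  assume A: "A \<in> sets borel"
  have n0s: "B \<inter> {..0} \<in> sets n0" if "B \<in> sets borel" for B
    using that unfolding sets_n0 by (subst sets_restrict_borel) auto
  show "emeasure N A = thinned n0 q l A"
  proof (rule emeasure_measure_of[OF N_def[THEN meta_eq_to_obj_eq]])
    show "positive (sets N) (thinned n0 q l)" by (simp add: positive_def thinned_eq)
    show "countably_additive (sets N) (thinned n0 q l)" unfolding s
    proof (rule countably_additiveI)
      fix B :: "nat \<Rightarrow> real set" assume B: "range B \<subseteq> sets borel" "disjoint_family B"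
      have m: "(\<lambda>x. indicator (B i) (fst x) * of_bool (ennreal (snd x) \<le> l (fst x)) :: ennreal) \<in> borel_measurable q" for i
        by (rule accept_measurable[OF l]) (use B in auto)
      have "(\<Sum>i. emeasure n0 (B i \<inter> {..0})) = emeasure n0 (\<Union>i. B i \<inter> {..0})"
        using B by (intro suminf_emeasure) (auto simp: disjoint_family_on_def intro!: n0s)
      moreover have "(\<Sum>i. accepted q l (B i)) =
        (accepted q l (\<Union>i. B i))"
        using m by (subst nn_integral_suminf[symmetric]) (simp_all add: suminf_indicator[OF B(2)])
      ultimately show "(\<Sum>i. thinned n0 q l (B i)) = thinned n0 q l (\<Union>i. B i)"
        unfolding thinned_eq by (subst suminf_add[symmetric]) (auto simp: Int_UN_distrib2)
    qed
    show "sets borel \<subseteq> Pow (UNIV :: real set)" by simp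
    show "A \<in> sets N" using A s by simp
  qed
qed

lemma nn_integral_thinned:
  assumes l: "l \<in> borel_measurable borel" and N: "sets N = sets borel" "\<forall>A\<in>sets borel. emeasure N A = thinned n0 q l A"
    and f: "f \<in> borel_measurable borel"
  shows "(\<integral>\<^sup>+x. f x \<partial>N) = (\<integral>\<^sup>+x. f x \<partial>n0) + (\<integral>\<^sup>+x. f (fst x) * of_bool (ennreal (snd x) \<le> l (fst x)) \<partial>q)"
  using f
proof (induct rule: borel_measurable_induct)
  case (cong f g) then show ?case by (simp cong: nn_integral_cong)
next
  case (set A)
  have "(\<integral>\<^sup>+x. indicator A x \<partial>n0) = (\<integral>\<^sup>+x. indicator (A \<inter> {..0}) x \<partial>n0)"
    by (rule nn_integral_cong) (simp add: space_n0 indicator_def)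
  also have "\<dots> = emeasure n0 (A \<inter> {..0})"
    using set unfolding sets_n0 by (intro nn_integral_indicator) (auto simp: sets_n0 sets_restrict_borel)
  finally show ?case using set N by (simp add: thinned_eq)
next
  case (mult f c)
  have [measurable]: "f \<in> borel_measurable N" "f \<in> borel_measurable n0" 
    using mult(2) N(1) measurable_n0 by (auto simp: measurable_cong_sets[OF N(1) refl])
  show ?case using mult(4) accept_measurable[OF l mult(2)]
    by (simp add: nn_integral_cmult distrib_left mult.assoc)
next
  case (add f g)
  have [measurable]: "f \<in> borel_measurable N" "f \<in> borel_measurable n0" "g \<in> borel_measurable N" "g \<in> borel_measurable n0"
    using add(1,4) N(1) measurable_n0 by (auto simp: measurable_cong_sets[OF N(1) refl])
  show ?case using add(3,7) accept_measurable[OF l add(1)] accept_measurable[OF l add(4)]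
    by (simp add: nn_integral_add distrib_right add_ac)
next
  case (seq U)
  have m: "U i \<in> borel_measurable N" "U i \<in> borel_measurable n0" for i
    using seq(1)[of i] N(1) measurable_n0 by (auto simp: measurable_cong_sets[OF N(1) refl])
  have i1: "incseq (\<lambda>i x. U i (fst x) * of_bool (ennreal (snd x) \<le> l (fst x)))"
    using seq(4) by (auto simp: incseq_def le_fun_def)
  have i2: "incseq (\<lambda>i. \<integral>\<^sup>+x. U i x \<partial>n0)" "incseq (\<lambda>i. \<integral>\<^sup>+x. U i (fst x) * of_bool (ennreal (snd x) \<le> l (fst x)) \<partial>q)"
    using seq(4) by (auto simp: incseq_def le_fun_def intro!: nn_integral_mono)
  have "(\<integral>\<^sup>+x. (SUP i. U i x) \<partial>N) = (SUP i. \<integral>\<^sup>+x. U i x \<partial>N)"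
    "(\<integral>\<^sup>+x. (SUP i. U i x) \<partial>n0) = (SUP i. \<integral>\<^sup>+x. U i x \<partial>n0)"
    using seq(4) m by (auto intro!: nn_integral_monotone_convergence_SUP)
  moreover have "(\<integral>\<^sup>+x. (SUP i. U i (fst x)) * of_bool (ennreal (snd x) \<le> l (fst x)) \<partial>q) =
    (SUP i. \<integral>\<^sup>+x. U i (fst x) * of_bool (ennreal (snd x) \<le> l (fst x)) \<partial>q)"
    using nn_integral_monotone_convergence_SUP[OF i1 accept_measurable[OF l seq(1)]] by (simp add: SUP_mult_right_ennreal)
  ultimately show ?case using seq(3) ennreal_SUP_add[OF i2] by (simp add: image_comp)
qed

lemma past_mass_eq:
  assumes l: "l \<in> borel_measurable borel" and N: "sets N = sets borel" "\<forall>A\<in>sets borel. emeasure N A = thinned n0 q l A"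
    and g[measurable]: "g \<in> borel_measurable borel" and u: "u > 0"
  shows "(\<integral>\<^sup>+s\<in>{..<u}. g (u - s) \<partial>N) = past_mass n0 q g l u"
proof -
  have m: "(\<lambda>s. g (u - s) * indicator {..<u} s) \<in> borel_measurable borel" by measurable
  have "(\<integral>\<^sup>+s\<in>{..<u}. g (u - s) \<partial>N) = (\<integral>\<^sup>+s. g (u - s) * indicator {..<u} s \<partial>n0) +
    (\<integral>\<^sup>+x. g (u - fst x) * indicator {..<u} (fst x) * of_bool (ennreal (snd x) \<le> l (fst x)) \<partial>q)"
    by (rule nn_integral_thinned[OF l N m])
  moreover have "(\<integral>\<^sup>+s. g (u - s) * indicator {..<u} s \<partial>n0) = (\<integral>\<^sup>+s. g (u - s) \<partial>n0)"
    using u by (intro nn_integral_cong) (auto simp: space_n0)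
  ultimately show ?thesis by (simp add: past_mass_def mult_ac)
qed

text \<open>This translates the equation for \<open>N\<close> into a fixed point equation for its intensity.\<close>

lemma hawkes_intensity_eq:
  assumes l: "l \<in> borel_measurable borel" and N: "sets N = sets borel" "\<forall>A\<in>sets borel. emeasure N A = thinned n0 q l A"
    and h: "h \<in> borel_measurable borel" and u: "u > 0"
  shows "hawkes_intensity lam h N u = next_intensity n0 q lam h l u"
  unfolding hawkes_intensity_def signed_integral_def next_intensity_def
  using past_mass_eq[OF l N _ u, of "\<lambda>t. ennreal (h t)"] past_mass_eq[OF l N _ u, of "\<lambda>t. ennreal (- h t)"] h
  by simp

lemma past_mass_cong:
  assumes "AE x in q. fst x < u \<longrightarrow> (ennreal (snd x) \<le> l (fst x) \<longleftrightarrow> ennreal (snd x) \<le> l' (fst x))"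
  shows "past_mass n0 q g l u = past_mass n0 q g l' u"
  unfolding past_mass_def
proof (intro arg_cong2[where f="(+)"] refl nn_integral_cong_AE)
  show "AE x in q. g (u - fst x) * of_bool (ennreal (snd x) \<le> l (fst x)) * indicator {..<u} (fst x) =
    g (u - fst x) * of_bool (ennreal (snd x) \<le> l' (fst x)) * indicator {..<u} (fst x)"
    using assms by eventually_elim (auto simp: indicator_def)
qed

lemma next_intensity_cong:
  assumes "AE x in q. fst x < u \<longrightarrow> (ennreal (snd x) \<le> l (fst x) \<longleftrightarrow> ennreal (snd x) \<le> l' (fst x))"
  shows "next_intensity n0 q lam h l u = next_intensity n0 q lam h l' u"
  unfolding next_intensity_def past_mass_cong[OF assms] ..

lemma past_mass_mono:
  assumes "\<And>t. t > 0 \<Longrightarrow> g t \<le> g' t" "\<And>s. s > 0 \<Longrightarrow> l s \<le> l' s" "u > 0"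
  shows "past_mass n0 q g l u \<le> past_mass n0 q g' l' u"
  unfolding past_mass_def
proof (intro add_mono nn_integral_mono)
  fix s assume "s \<in> space n0" then show "g (u - s) \<le> g' (u - s)" using assms by (auto simp: space_n0)
next
  fix x assume x: "x \<in> space q"
  show "g (u - fst x) * of_bool (ennreal (snd x) \<le> l (fst x)) * indicator {..<u} (fst x)
    \<le> g' (u - fst x) * of_bool (ennreal (snd x) \<le> l' (fst x)) * indicator {..<u} (fst x)"
    using assms(1)[of "u - fst x"] assms(2)[of "fst x"] x by (auto simp: space_q indicator_def intro: order_trans)
qed

end

lemma e2ennreal_max_le:
  assumes "P \<le> P'" "lam \<ge> 0"
  shows "e2ennreal (max (ereal lam + (enn2ereal P - enn2ereal R)) 0) \<le> ennreal lam + P'"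
proof -
  have "enn2ereal P - enn2ereal R \<le> enn2ereal P'"
    using assms by (metis enn2ereal_nonneg ereal_diff_le_self less_eq_ennreal.rep_eq order_trans)
  then have "max (ereal lam + (enn2ereal P - enn2ereal R)) 0 \<le> enn2ereal (ennreal lam + P')"
    using assms by (auto simp: plus_ennreal.rep_eq enn2ereal_ennreal intro!: add_mono)
  then have "e2ennreal (max (ereal lam + (enn2ereal P - enn2ereal R)) 0) \<le> e2ennreal (enn2ereal (ennreal lam + P'))"
    by (rule e2ennreal_mono)
  then show ?thesis by simp
qed

lemma e2ennreal_max_nonneg:
  assumes "lam \<ge> 0"
  shows "e2ennreal (max (ereal lam + (enn2ereal P - enn2ereal 0)) 0) = ennreal lam + P"
proof -
  have "ereal lam + (enn2ereal P - enn2ereal 0) = enn2ereal (ennreal lam + P)"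
    using assms by (simp add: plus_ennreal.rep_eq enn2ereal_ennreal zero_ennreal.rep_eq)
  then show ?thesis by (simp add: max_absorb1)
qed

lemma sigma_finite_counting:
  assumes N: "N \<in> counting_measures (UNIV :: real set)"
  shows "sigma_finite_measure N"
proof
  note D = counting_measuresD[OF N]
  have "x \<in> (\<Union>n. {- real n..real n})" for x :: real
  proof -
    obtain n :: nat where "\<bar>x\<bar> \<le> real n" using real_arch_simple by blast
    then show ?thesis by (intro UN_I[of n]) auto
  qed
  then show "\<exists>A. countable A \<and> A \<subseteq> sets N \<and> \<Union> A = space N \<and> (\<forall>a\<in>A. emeasure N a \<noteq> \<infinity>)"
    using D(1,2) D(4)[of "{- real n..real n}" for n]
    by (intro exI[of _ "range (\<lambda>n. {- real n..real n})"]) (auto simp: less_top[symmetric])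
qed

lemma hawkes_intensity_measurable:
  assumes N: "N \<in> counting_measures (UNIV :: real set)" and h[measurable]: "h \<in> borel_measurable borel"
  shows "hawkes_intensity lam h N \<in> borel_measurable borel"
proof -
  interpret sigma_finite_measure N by (rule sigma_finite_counting[OF N])
  have sN[measurable_cong]: "sets N = sets borel" using counting_measuresD(1)[OF N] by simp
  have [measurable]: "(\<lambda>u. \<integral>\<^sup>+s. g (u - s) * indicator {..<u} s \<partial>N) \<in> borel_measurable borel"
    if [measurable]: "g \<in> borel_measurable borel" for g :: "real \<Rightarrow> ennreal"
  proof -
    have "(\<lambda>(u, s). g (u - s) * of_bool (s < u)) \<in> borel_measurable (borel \<Otimes>\<^sub>M borel)" by measurable
    moreover have "(\<lambda>(u, s). g (u - s) * of_bool (s < u)) = (\<lambda>(u, s). g (u - s) * indicator {..<u} s)"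
      by (auto simp: indicator_def fun_eq_iff)
    ultimately have "(\<lambda>(u, s). g (u - s) * indicator {..<u} s) \<in> borel_measurable (borel \<Otimes>\<^sub>M borel)" by simp
    then have "(\<lambda>(u, s). g (u - s) * indicator {..<u} s) \<in> borel_measurable (borel \<Otimes>\<^sub>M N)"
      by (subst measurable_cong_sets[OF sets_pair_measure_cong[OF refl sN] refl])
    then show ?thesis by (rule borel_measurable_nn_integral)
  qed
  have [measurable]: "(\<lambda>t. ennreal (h t)) \<in> borel_measurable borel" "(\<lambda>t. ennreal (- h t)) \<in> borel_measurable borel"
    by measurable
  show ?thesis unfolding hawkes_intensity_def[abs_def] signed_integral_def by measurable
qed

lemma sets_restrict_halfline:
  "sets N = sets (borel :: real measure) \<Longrightarrow> A \<in> sets (restrict_space N {..<u}) \<longleftrightarrow> A \<in> sets borel \<and> A \<subseteq> {..<u}"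
  using sets_restrict_space_cong[of N borel "{..<u}"] by (simp add: sets_restrict_borel)

lemma restrict_mass_eq:
  assumes N: "sets N = sets (borel :: real measure)" "sets N' = sets (borel :: real measure)"
    and eq: "\<forall>A\<in>sets borel. A \<subseteq> {..<u} \<longrightarrow> emeasure N A = emeasure N' A"
  shows "(\<integral>\<^sup>+s\<in>{..<u}. g s \<partial>N) = (\<integral>\<^sup>+s\<in>{..<u}. g s \<partial>N')"
proof -
  have sp: "space N = UNIV" "space N' = UNIV" using N[THEN sets_eq_imp_space_eq] by simp_all
  have "restrict_space N {..<u} = restrict_space N' {..<u}"
  proof (rule measure_eqI)
    show "sets (restrict_space N {..<u}) = sets (restrict_space N' {..<u})"
      using N by (intro sets_restrict_space_cong) simp
    fix A assume "A \<in> sets (restrict_space N {..<u})"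
    then have "A \<in> sets borel" "A \<subseteq> {..<u}" by (simp_all add: sets_restrict_halfline[OF N(1)])
    then show "emeasure (restrict_space N {..<u}) A = emeasure (restrict_space N' {..<u}) A"
      using eq N by (simp add: emeasure_restrict_space sp)
  qed
  then have "(\<integral>\<^sup>+s. g s \<partial>restrict_space N {..<u}) = (\<integral>\<^sup>+s. g s \<partial>restrict_space N' {..<u})" by simp
  then show ?thesis using N by (simp add: nn_integral_restrict_space sp)
qed

lemma restrict_mass_mono:
  assumes N: "sets N = sets (borel :: real measure)" "sets N' = sets (borel :: real measure)"
    and le: "\<forall>A\<in>sets borel. A \<subseteq> {..<u} \<longrightarrow> emeasure N A \<le> emeasure N' A"
  shows "(\<integral>\<^sup>+s\<in>{..<u}. g s \<partial>N) \<le> (\<integral>\<^sup>+s\<in>{..<u}. g s \<partial>N')"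
proof -
  have sp: "space N = UNIV" "space N' = UNIV" using N[THEN sets_eq_imp_space_eq] by simp_all
  have "(\<integral>\<^sup>+s. g s \<partial>restrict_space N {..<u}) \<le> (\<integral>\<^sup>+s. g s \<partial>restrict_space N' {..<u})"
  proof (rule nn_integral_mono_measure)
    show s: "sets (restrict_space N {..<u}) = sets (restrict_space N' {..<u})"
      using N by (intro sets_restrict_space_cong) simp
    show "restrict_space N {..<u} \<le> restrict_space N' {..<u}"
      unfolding le_measure[OF s]
    proof
      fix A assume "A \<in> sets (restrict_space N {..<u})"
      then have "A \<in> sets borel" "A \<subseteq> {..<u}" by (simp_all add: sets_restrict_halfline[OF N(1)])
      then show "emeasure (restrict_space N {..<u}) A \<le> emeasure (restrict_space N' {..<u}) A"
        using le N by (simp add: emeasure_restrict_space sp)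
    qed
  qed
  then show ?thesis using N by (simp add: nn_integral_restrict_space sp)
qed

context hawkes_path begin

lemma thinned_cong: "(\<And>u. u > 0 \<Longrightarrow> l u = l' u) \<Longrightarrow> thinned n0 q l A = thinned n0 q l' A"
  unfolding thinned_eq by (intro arg_cong2[where f="(+)"] refl nn_integral_cong) (auto simp: space_q)

text \<open>One induction serves for equality and for domination, hence the relation \<open>R\<close>. Assume that the measures are
related on the past of \<open>\<tau>\<close>. Then by causality so are the intensities at \<open>\<tau>\<close>, hence the masses at \<open>\<tau>\<close>,
and nothing has to be compared on \<open>(\<tau>, t]\<close>, where \<open>D\<close> counts no point.\<close>

lemma thinned_compare:
  assumes l: "l \<in> borel_measurable borel" and N: "sets N = sets borel" "\<forall>A\<in>sets borel. emeasure N A = thinned n0 q l A"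
    and l': "l' \<in> borel_measurable borel" and N': "sets N' = sets borel" "\<forall>A\<in>sets borel. emeasure N' A = thinned n0 q l' A"
    and R: "R = (=) \<or> R = (\<le>)"
    and D: "counting_increments D" "\<And>t. D 0 t < \<infinity>"
    and null: "\<And>a b A. D a b = 0 \<Longrightarrow> A \<in> sets borel \<Longrightarrow> A \<subseteq> {a<..b} \<Longrightarrow> R (emeasure N A) (emeasure N' A)"
    and causal: "\<And>\<tau>. \<tau> > 0 \<Longrightarrow> (\<forall>A\<in>sets borel. A \<subseteq> {..<\<tau>} \<longrightarrow> R (emeasure N A) (emeasure N' A)) \<Longrightarrow> R (l \<tau>) (l' \<tau>)"
    and A: "A \<in> sets borel"
  shows "R (emeasure N A) (emeasure N' A)"
proof -
  have Rrefl: "R x x" for x using R by auto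
  have Radd: "R a b \<Longrightarrow> R c d \<Longrightarrow> R (a + c) (b + d)" for a b c d using R by (auto intro: add_mono)
  have RSUP: "R (SUP i. a i) (SUP i. b i)" if "\<And>i::nat. R (a i) (b i)" for a b
    using that R by (auto intro: SUP_mono)
  define P where "P = (\<lambda>t. \<forall>A\<in>sets borel. A \<subseteq> {..t} \<longrightarrow> R (emeasure N A) (emeasure N' A))"
  have past: "R (emeasure N A) (emeasure N' A)" if "A \<in> sets borel" "A \<subseteq> {..0}" for A
  proof -
    have "thinned n0 q k A = emeasure n0 A" for k
    proof -
      have "(accepted q k A) = (\<integral>\<^sup>+x. 0 \<partial>q)"
        using that(2) by (intro nn_integral_cong) (auto simp: space_q indicator_def)
      then show ?thesis using that(2) by (simp add: thinned_eq Int_absorb2)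
    qed
    then show ?thesis using N N' that(1) Rrefl by simp
  qed
  have limit: "\<forall>A\<in>sets borel. A \<subseteq> {..<\<tau>} \<longrightarrow> R (emeasure N A) (emeasure N' A)" if "\<tau> > 0" "\<And>s. 0 \<le> s \<Longrightarrow> s < \<tau> \<Longrightarrow> P s" for \<tau>
  proof (intro ballI impI)
    fix A :: "real set" assume A: "A \<in> sets borel" "A \<subseteq> {..<\<tau>}"
    define B where "B = (\<lambda>n::nat. A \<inter> {..\<tau> - \<tau> / real (n + 1)})"
    have s: "0 \<le> \<tau> - \<tau> / real (n + 1)" "\<tau> - \<tau> / real (n + 1) < \<tau>" for n
      using that(1) by (auto simp: field_simps)
    have B: "B n \<in> sets borel" "B n \<subseteq> {..\<tau> - \<tau> / real (n + 1)}" for n using A by (auto simp: B_def)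
    have "\<tau> - \<tau> / real (m + 1) \<le> \<tau> - \<tau> / real (n + 1)" if "m \<le> n" for m n
      using \<open>\<tau> > 0\<close> that by (intro diff_left_mono divide_left_mono) auto
    then have inc: "incseq B" by (auto simp: incseq_def B_def intro: order_trans)
    have UB: "(\<Union>n. B n) = A"
    proof (intro equalityI subsetI)
      fix x assume x: "x \<in> A"
      then have "\<tau> - x > 0" using A by auto
      then have "\<exists>n. \<tau> < real n * (\<tau> - x)" using reals_Archimedean3[of "\<tau> - x"] by auto
      then obtain n where "\<tau> < real n * (\<tau> - x)" by blast
      also have "\<dots> \<le> real (n + 1) * (\<tau> - x)" using \<open>\<tau> - x > 0\<close> by (intro mult_right_mono) auto
      finally have "\<tau> / real (n + 1) < \<tau> - x" by (simp add: field_simps)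
      then show "x \<in> (\<Union>n. B n)" using x by (intro UN_I[of n]) (auto simp: B_def)
    qed (auto simp: B_def)
    have "R (SUP n. emeasure N (B n)) (SUP n. emeasure N' (B n))"
      using that(2)[OF s, unfolded P_def] B by (intro RSUP) blast
    moreover have "(SUP n. emeasure N (B n)) = emeasure N A" "(SUP n. emeasure N' (B n)) = emeasure N' A"
      using SUP_emeasure_incseq[of B N] SUP_emeasure_incseq[of B N'] B inc N(1) N'(1) UB by auto
    ultimately show "R (emeasure N A) (emeasure N' A)" by simp
  qed
  have P: "P t" if "0 \<le> t" for t
  proof -
    obtain n where "D 0 t < of_nat n" using D(2)[of t] ennreal_Ex_less_of_nat by auto
    then have "D 0 t \<le> of_nat n" by simp
    show "P t"
    proof (rule counting_increments_induct[OF D(1), where P="\<lambda>_. P", OF _ \<open>0 \<le> t\<close> \<open>D 0 t \<le> of_nat n\<close>])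
      fix t \<tau> assume \<tau>: "0 \<le> \<tau>" "\<tau> \<le> t" and D0: "D \<tau> t = 0" and IH: "\<And>s. 0 \<le> s \<Longrightarrow> s < \<tau> \<Longrightarrow> P s"
      have "P \<tau>"
      proof (cases "\<tau> = 0")
        case True then show ?thesis using past by (simp add: P_def)
      next
        case False
        then have pos: "\<tau> > 0" using \<tau> by simp
        note lim = limit[OF pos IH]
        have at: "R (emeasure N (A \<inter> {\<tau>})) (emeasure N' (A \<inter> {\<tau>}))" if "A \<in> sets borel" for A
        proof -
          have e: "A \<inter> {\<tau>} \<inter> {..0} = {}" using pos by auto
          have "(accepted q k (A \<inter> {\<tau>})) =
            (\<integral>\<^sup>+x. indicator (A \<inter> {\<tau>}) (fst x) * of_bool (ennreal (snd x) \<le> k \<tau>) \<partial>q)" for k :: "real \<Rightarrow> ennreal"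
            by (rule nn_integral_cong) (auto simp: indicator_def)
          then have "thinned n0 q k (A \<inter> {\<tau>}) = (\<integral>\<^sup>+x. indicator (A \<inter> {\<tau>}) (fst x) * of_bool (ennreal (snd x) \<le> k \<tau>) \<partial>q)" for k
            by (simp add: thinned_eq e)
          moreover have "R (\<integral>\<^sup>+x. indicator (A \<inter> {\<tau>}) (fst x) * of_bool (ennreal (snd x) \<le> l \<tau>) \<partial>q)
            (\<integral>\<^sup>+x. indicator (A \<inter> {\<tau>}) (fst x) * of_bool (ennreal (snd x) \<le> l' \<tau>) \<partial>q)"
            using R
          proof
            assume "R = (=)" then show ?thesis using causal[OF pos lim] by simp
          next
            assume "R = (\<le>)" then show ?thesis using causal[OF pos lim]
              by (auto intro!: nn_integral_mono mult_left_mono intro: order_trans)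
          qed
          ultimately show ?thesis using N N' that by simp
        qed
        show ?thesis unfolding P_def
        proof (intro ballI impI)
          fix A :: "real set" assume A: "A \<in> sets borel" "A \<subseteq> {..\<tau>}"
          have "A = (A \<inter> {..<\<tau>}) \<union> (A \<inter> {\<tau>})" "(A \<inter> {..<\<tau>}) \<inter> (A \<inter> {\<tau>}) = {}" using A by auto
          then have "emeasure K A = emeasure K (A \<inter> {..<\<tau>}) + emeasure K (A \<inter> {\<tau>})" if "sets K = sets borel" for K
            using plus_emeasure[of "A \<inter> {..<\<tau>}" K "A \<inter> {\<tau>}"] A that by auto
          then show "R (emeasure N A) (emeasure N' A)"
            using Radd[OF lim[rule_format, of "A \<inter> {..<\<tau>}"] at[OF A(1)]] A N(1) N'(1) by auto
        qed
      qed
      then show "P t" unfolding P_def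
      proof (intro ballI impI)
        assume P\<tau>: "\<forall>A\<in>sets borel. A \<subseteq> {..\<tau>} \<longrightarrow> R (emeasure N A) (emeasure N' A)"
        fix A :: "real set" assume A: "A \<in> sets borel" "A \<subseteq> {..t}"
        have "A = (A \<inter> {..\<tau>}) \<union> (A \<inter> {\<tau><..t})" "(A \<inter> {..\<tau>}) \<inter> (A \<inter> {\<tau><..t}) = {}" using A by auto
        then have "emeasure K A = emeasure K (A \<inter> {..\<tau>}) + emeasure K (A \<inter> {\<tau><..t})" if "sets K = sets borel" for K
          using plus_emeasure[of "A \<inter> {..\<tau>}" K "A \<inter> {\<tau><..t}"] A that by auto
        then show "R (emeasure N A) (emeasure N' A)"
          using Radd[OF P\<tau>[rule_format, of "A \<inter> {..\<tau>}"] null[OF D0, of "A \<inter> {\<tau><..t}"]] A N(1) N'(1) by auto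
      qed
    qed
  qed
  have "R (SUP n. emeasure N (A \<inter> {..real n})) (SUP n. emeasure N' (A \<inter> {..real n}))"
  proof (rule RSUP)
    show "R (emeasure N (A \<inter> {..real n})) (emeasure N' (A \<inter> {..real n}))" for n
    proof -
      have "A \<inter> {..real n} \<in> sets borel" "A \<inter> {..real n} \<subseteq> {..real n}" using A by auto
      then show ?thesis using P[of "real n"] unfolding P_def by simp
    qed
  qed
  moreover have "(SUP n. emeasure K (A \<inter> {..real n})) = emeasure K A" if "sets K = sets borel" for K
  proof -
    have "(SUP n. emeasure K (A \<inter> {..real n})) = emeasure K (\<Union>n. A \<inter> {..real n})"
    proof (rule SUP_emeasure_incseq)
      show "range (\<lambda>n. A \<inter> {..real n}) \<subseteq> sets K"
        unfolding that using A by (intro image_subsetI sets.Int) simp_all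
      show "incseq (\<lambda>n. A \<inter> {..real n})"
        by (intro monoI Int_mono order.refl) simp
    qed
    also have "(\<Union>n. A \<inter> {..real n}) = A"
    proof -
      have "\<exists>n. x \<le> real n" for x :: real by (rule real_arch_simple)
      then show ?thesis by auto
    qed
    finally show ?thesis .
  qed
  ultimately show ?thesis using N(1) N'(1) by simp
qed

definition path_solution :: "real \<Rightarrow> (real \<Rightarrow> real) \<Rightarrow> real measure \<Rightarrow> bool" where
  "path_solution lam h N \<longleftrightarrow> N \<in> counting_measures UNIV \<and>
    (\<forall>A\<in>sets borel. emeasure N A = thinned n0 q (hawkes_intensity lam h N) A)"

lemma counting_measure_increments:
  assumes N: "N \<in> counting_measures (UNIV :: real set)"
  shows "counting_increments (\<lambda>a b. emeasure N {a<..b})" "emeasure N {a<..b} < \<infinity>"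
proof -
  note D = counting_measuresD[OF N]
  have s: "sets N = sets borel" using D(1) by simp
  show "counting_increments (\<lambda>a b. emeasure N {a<..b})"
    using D(3) s by (intro counting_increments_measure) auto
  have "bounded {a<..b}" by (rule bounded_subset[OF bounded_closed_interval[of a b]]) auto
  then show "emeasure N {a<..b} < \<infinity>" using D(4)[of "{a<..b}"] s by auto
qed

text \<open>The induction runs along the points of both solutions together.\<close>

lemma path_unique:
  assumes N: "path_solution lam h N" and N': "path_solution lam h N'" and h: "h \<in> borel_measurable borel"
  shows "N = N'"
proof -
  have c: "N \<in> counting_measures UNIV" "N' \<in> counting_measures UNIV" using N N' by (auto simp: path_solution_def)
  have s: "sets N = sets borel" "sets N' = sets borel" using c[THEN counting_measuresD(1)] by simp_all
  have e: "\<forall>A\<in>sets borel. emeasure N A = thinned n0 q (hawkes_intensity lam h N) A"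
    "\<forall>A\<in>sets borel. emeasure N' A = thinned n0 q (hawkes_intensity lam h N') A" using N N' by (auto simp: path_solution_def)
  note I = counting_measure_increments[OF c(1)] counting_measure_increments[OF c(2)]
  show ?thesis
  proof (rule measure_eqI)
    show "sets N = sets N'" using s by simp
    fix A assume "A \<in> sets N"
    then have A: "A \<in> sets borel" using s by simp
    show "emeasure N A = emeasure N' A"
    proof (rule thinned_compare[OF hawkes_intensity_measurable[OF c(1) h] s(1) e(1) hawkes_intensity_measurable[OF c(2) h] s(2) e(2) _
          counting_increments_add[OF I(1,3)] _ _ _ A])
      show "emeasure N {0<..t} + emeasure N' {0<..t} < \<infinity>" for t using I(2,4) by simp
      show "emeasure N A = emeasure N' A" if "emeasure N {a<..b} + emeasure N' {a<..b} = 0" "A \<subseteq> {a<..b}" for a b A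
      proof -
        have "emeasure N A \<le> emeasure N {a<..b}" "emeasure N' A \<le> emeasure N' {a<..b}"
          using that(2) s by (auto intro!: emeasure_mono)
        then show ?thesis using that(1) by simp
      qed
      show "hawkes_intensity lam h N \<tau> = hawkes_intensity lam h N' \<tau>"
        if "\<forall>A\<in>sets borel. A \<subseteq> {..<\<tau>} \<longrightarrow> emeasure N A = emeasure N' A" for \<tau>
        unfolding hawkes_intensity_def signed_integral_def restrict_mass_eq[OF s that] ..
    qed simp
  qed
qed

text \<open>The induction runs along the points of the smaller process. The intensity for \<open>h\<close> is at most \<open>lam\<close> plus the integral of
the positive part of \<open>h\<close>, and that integral increases with the measure.\<close>

lemma path_domination:
  assumes N: "path_solution lam h N" and N': "path_solution lam (\<lambda>t. max (h t) 0) N'"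
    and h: "h \<in> borel_measurable borel" and lam: "lam \<ge> 0" and A: "A \<in> sets borel"
  shows "emeasure N A \<le> emeasure N' A"
proof -
  let ?hp = "\<lambda>t. max (h t) 0"
  have hp: "?hp \<in> borel_measurable borel" using h by measurable
  have c: "N \<in> counting_measures UNIV" "N' \<in> counting_measures UNIV" using N N' by (auto simp: path_solution_def)
  have s: "sets N = sets borel" "sets N' = sets borel" using c[THEN counting_measuresD(1)] by simp_all
  have e: "\<forall>A\<in>sets borel. emeasure N A = thinned n0 q (hawkes_intensity lam h N) A"
    "\<forall>A\<in>sets borel. emeasure N' A = thinned n0 q (hawkes_intensity lam ?hp N') A" using N N' by (auto simp: path_solution_def)
  note I = counting_measure_increments[OF c(1)]
  show ?thesis
  proof (rule thinned_compare[OF hawkes_intensity_measurable[OF c(1) h] s(1) e(1) hawkes_intensity_measurable[OF c(2) hp] s(2) e(2) _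
        I(1) I(2) _ _ A])
    show "emeasure N A \<le> emeasure N' A" if "emeasure N {a<..b} = 0" "A \<subseteq> {a<..b}" for a b A
    proof -
      have "emeasure N A \<le> emeasure N {a<..b}" using that(2) s by (auto intro!: emeasure_mono)
      then show ?thesis using that(1) by simp
    qed
    show "hawkes_intensity lam h N \<tau> \<le> hawkes_intensity lam ?hp N' \<tau>"
      if "\<forall>A\<in>sets borel. A \<subseteq> {..<\<tau>} \<longrightarrow> emeasure N A \<le> emeasure N' A" for \<tau>
    proof -
      have p: "ennreal (max x 0) = ennreal x" "ennreal (- max x 0) = 0" for x
        by (auto simp: max_def ennreal_neg)
      have "hawkes_intensity lam h N \<tau> \<le> ennreal lam + (\<integral>\<^sup>+s\<in>{..<\<tau>}. ennreal (h (\<tau> - s)) \<partial>N')"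
        unfolding hawkes_intensity_def signed_integral_def
        by (rule e2ennreal_max_le[OF restrict_mass_mono[OF s that] lam])
      also have "\<dots> = hawkes_intensity lam ?hp N' \<tau>"
        unfolding hawkes_intensity_def signed_integral_def p
        using e2ennreal_max_nonneg[OF lam] by simp
      finally show ?thesis .
    qed
  qed simp
qed

lemma thinned_counting:
  assumes l: "l \<in> borel_measurable borel"
    and fin: "\<And>t. (accepted q l {0<..t}) < \<infinity>"
  shows "measure_of UNIV (sets borel) (thinned n0 q l) \<in> counting_measures UNIV" (is "?N \<in> _")
  unfolding counting_measures_def
proof (intro CollectI conjI ballI impI)
  note T = thinned_measure[OF l]
  show "sets ?N = sets (restrict_space borel UNIV)" using T(1) by simp
  have n0s: "B \<inter> {..0} \<in> sets n0" if "B \<in> sets borel" for B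
    using that unfolding sets_n0 by (subst sets_restrict_borel) auto
  fix A assume "A \<in> sets ?N"
  then have A: "A \<in> sets borel" using T(1) by simp
  have "emeasure n0 (A \<inter> {..0}) \<in> insert \<infinity> (range of_nat)"
    by (rule counting_measuresD(3)[OF n0 n0s[OF A]])
  moreover have "(accepted q l A) \<in> insert \<infinity> (range of_nat)"
    unfolding thinned_accept(1)[OF l A] by (rule counting_measuresD(3)[OF q thinned_accept(2)[OF l A]])
  moreover have "a + b \<in> insert \<infinity> (range of_nat)" if "a \<in> insert \<infinity> (range of_nat)" "b \<in> insert \<infinity> (range of_nat)" for a b :: ennreal
    using that by (auto simp flip: of_nat_add)
  ultimately show "emeasure ?N A \<in> insert \<infinity> (range of_nat)" unfolding T(2)[OF A] thinned_eq by blast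
  assume bA: "bounded A"
  then obtain B where B: "\<And>x. x \<in> A \<Longrightarrow> \<bar>x\<bar> \<le> B" unfolding bounded_iff by auto
  have "emeasure n0 (A \<inter> {..0}) < \<infinity>"
    using bA by (intro counting_measuresD(4)[OF n0 n0s[OF A]]) (auto intro: bounded_subset)
  moreover have "(accepted q l A) \<le>
    (accepted q l {0<..B})"
    using B by (intro nn_integral_mono) (fastforce simp: space_q indicator_def)
  then have "(accepted q l A) < \<infinity>"
    using fin[of B] by (rule le_less_trans)
  ultimately show "emeasure ?N A < \<infinity>" unfolding T(2)[OF A] thinned_eq by simp
qed

lemma path_solution_of_fixpoint:
  assumes l: "l \<in> borel_measurable borel" and h: "h \<in> borel_measurable borel"
    and fp: "\<And>u. u > 0 \<Longrightarrow> next_intensity n0 q lam h l u = l u"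
    and fin: "\<And>t. (accepted q l {0<..t}) < \<infinity>"
  defines "N \<equiv> measure_of UNIV (sets borel) (thinned n0 q l)"
  shows "path_solution lam h N" "\<And>u. u > 0 \<Longrightarrow> hawkes_intensity lam h N u = l u"
proof -
  note T = thinned_measure[OF l, folded N_def]
  show hl: "hawkes_intensity lam h N u = l u" if "u > 0" for u
    using hawkes_intensity_eq[OF l T(1) _ h that] T(2) fp[OF that] by auto
  have "emeasure N A = thinned n0 q (hawkes_intensity lam h N) A" if "A \<in> sets borel" for A
    using T(2)[OF that] thinned_cong[of "hawkes_intensity lam h N" l A] hl by simp
  moreover have "N \<in> counting_measures UNIV" unfolding N_def by (rule thinned_counting[OF l fin])
  ultimately show "path_solution lam h N" by (simp add: path_solution_def)
qed

text \<open>If two consecutive iterates accept the same points before \<open>\<tau>\<close>, the next two iterates coincide as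
functions up to and including time \<open>\<tau>\<close>. On \<open>(\<tau>, t]\<close> there is no point of \<open>S\<close>, so there no iterate
accepts anything. So each point of \<open>S\<close> costs one iteration.\<close>

lemma picard_stabilises:
  fixes L :: "nat \<Rightarrow> real \<Rightarrow> ennreal"
  assumes rec: "\<And>n u. u > 0 \<Longrightarrow> L (Suc n) u = next_intensity n0 q lam h (L n) u"
    and S: "S \<in> sets q" "\<And>n x. x \<in> quadrant \<Longrightarrow> ennreal (snd x) \<le> L n (fst x) \<Longrightarrow> x \<in> S"
    and fin: "\<And>t. emeasure q (S \<inter> {0<..t} \<times> UNIV) < \<infinity>"
  shows "\<exists>n. \<forall>m\<ge>n. \<forall>u. 0 < u \<longrightarrow> u \<le> t \<longrightarrow> L m u = L n u"
proof (cases "t > 0")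
  case True
  have fstq: "fst \<in> borel_measurable q" by (rule measurable_q) measurable
  have pre: "S \<inter> fst -` A \<inter> space q \<in> sets q" if "A \<in> sets borel" for A
    using measurable_sets[OF fstq that] S(1) by (metis Int_assoc sets.Int)
  \<comment> \<open>The times of the points of \<open>S\<close>, counted with multiplicity.\<close>
  define \<nu> where "\<nu> = distr (density q (indicator S)) borel fst"
  have em: "emeasure \<nu> A = emeasure q (S \<inter> A \<times> UNIV)" if "A \<in> sets borel" for A
  proof -
    have a: "fst -` A \<inter> space q \<in> sets q" by (rule measurable_sets[OF fstq that])
    have eq: "S \<inter> (fst -` A \<inter> space q) = S \<inter> A \<times> UNIV"
      using sets.sets_into_space[OF S(1)] by auto
    have "emeasure \<nu> A = emeasure (density q (indicator S)) (fst -` A \<inter> space q)"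
      unfolding \<nu>_def using fstq that by (subst emeasure_distr) auto
    also have "\<dots> = (\<integral>\<^sup>+x. indicator S x * indicator (fst -` A \<inter> space q) x \<partial>q)"
      using S(1) a by (subst emeasure_density) auto
    also have "\<dots> = (\<integral>\<^sup>+x. indicator (S \<inter> (fst -` A \<inter> space q)) x \<partial>q)"
      by (intro nn_integral_cong) (auto simp: indicator_def)
    also have "\<dots> = emeasure q (S \<inter> (fst -` A \<inter> space q))" using S(1) a by simp
    finally show ?thesis unfolding eq .
  qed
  have inS: "S \<inter> A \<times> UNIV \<in> sets q" if "A \<in> sets borel" for A
  proof -
    have "S \<inter> fst -` A \<inter> space q = S \<inter> A \<times> UNIV" using sets.sets_into_space[OF S(1)] by auto
    then show ?thesis using pre[OF that] by simp
  qed
  have ci: "counting_increments (\<lambda>a b. emeasure \<nu> {a<..b})"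
  proof (rule counting_increments_measure)
    show "emeasure \<nu> A \<in> insert \<infinity> (range of_nat)" if "A \<in> sets borel" for A
      unfolding em[OF that] by (rule counting_measuresD(3)[OF q inS[OF that]])
  qed (simp add: \<nu>_def)
  define P where "P = (\<lambda>n t. \<forall>m\<ge>n. AE x in q. fst x \<le> t \<longrightarrow> (ennreal (snd x) \<le> L m (fst x) \<longleftrightarrow> ennreal (snd x) \<le> L (Suc m) (fst x)))"
  have next_eq: "L (Suc m) u = L (Suc (Suc m)) u" if "u > 0" "AE x in q. fst x < u \<longrightarrow> (ennreal (snd x) \<le> L m (fst x) \<longleftrightarrow> ennreal (snd x) \<le> L (Suc m) (fst x))" for m u
    unfolding rec[OF that(1)] by (rule next_intensity_cong[OF that(2)])
  have P: "\<exists>n. P n t" if "0 \<le> t" for t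
  proof -
    have "emeasure \<nu> {0<..t} < \<infinity>" using fin[of t] by (simp add: em)
    then obtain n where "emeasure \<nu> {0<..t} < of_nat n" using ennreal_Ex_less_of_nat by auto
    then have n: "emeasure \<nu> {0<..t} \<le> of_nat n" by simp
    have "P (Suc n) t"
    proof (rule counting_increments_induct[OF ci, where P=P, OF _ that n])
      fix n t \<tau> assume \<tau>: "0 \<le> \<tau>" "\<tau> \<le> t" and D0: "emeasure \<nu> {\<tau><..t} = 0" and IH: "\<And>s. 0 \<le> s \<Longrightarrow> s < \<tau> \<Longrightarrow> P n s"
      have "S \<inter> {\<tau><..t} \<times> UNIV \<in> null_sets q" using D0 em[of "{\<tau><..t}"] inS[of "{\<tau><..t}"] by auto
      then have nS: "AE x in q. x \<notin> S \<inter> {\<tau><..t} \<times> UNIV" by (rule AE_not_in)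
      have before: "AE x in q. fst x < u \<longrightarrow> (ennreal (snd x) \<le> L m (fst x) \<longleftrightarrow> ennreal (snd x) \<le> L (Suc m) (fst x))"
        if "m \<ge> n" "0 < u" "u \<le> \<tau>" for m u
      proof -
        have s: "0 \<le> u - u / real (k + 1)" "u - u / real (k + 1) < \<tau>" for k
        proof -
          have "u / real (k + 1) \<le> u / 1" using that(2) by (intro divide_left_mono) auto
          then show "0 \<le> u - u / real (k + 1)" by simp
          have "0 < u / real (k + 1)" using that(2) by simp
          then show "u - u / real (k + 1) < \<tau>" using that(3) by linarith
        qed
        have "AE x in q. \<forall>k. fst x \<le> u - u / real (k + 1) \<longrightarrow> (ennreal (snd x) \<le> L m (fst x) \<longleftrightarrow> ennreal (snd x) \<le> L (Suc m) (fst x))"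
          unfolding AE_all_countable using IH[OF s] that(1) by (simp add: P_def)
        then show ?thesis
        proof eventually_elim
          case (elim x)
          show ?case
          proof
            assume "fst x < u"
            then have "\<exists>k. u < real k * (u - fst x)" using reals_Archimedean3[of "u - fst x"] by auto
            then obtain k where "u < real k * (u - fst x)" by blast
            also have "\<dots> \<le> real (k + 1) * (u - fst x)" using \<open>fst x < u\<close> by (intro mult_right_mono) auto
            finally have "u / real (k + 1) < u - fst x" by (simp add: field_simps)
            then have "fst x \<le> u - u / real (k + 1)" by linarith
            then show "ennreal (snd x) \<le> L m (fst x) \<longleftrightarrow> ennreal (snd x) \<le> L (Suc m) (fst x)" using elim by blast
          qed
        qed
      qed
      show "P (Suc n) t" unfolding P_def
      proof (intro allI impI)
        fix m assume "Suc n \<le> m"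
        then obtain m' where m': "m = Suc m'" "n \<le> m'" by (cases m) auto
        have eq: "L m u = L (Suc m) u" if "0 < u" "u \<le> \<tau>" for u
          unfolding m'(1) by (rule next_eq[OF that(1) before[OF m'(2) that]])
        show "AE x in q. fst x \<le> t \<longrightarrow> (ennreal (snd x) \<le> L m (fst x) \<longleftrightarrow> ennreal (snd x) \<le> L (Suc m) (fst x))"
          using nS AE_space
        proof eventually_elim
          case (elim x)
          then have xq: "x \<in> quadrant" by (simp add: space_q)
          show ?case
          proof (intro impI)
            assume xt: "fst x \<le> t"
            show "ennreal (snd x) \<le> L m (fst x) \<longleftrightarrow> ennreal (snd x) \<le> L (Suc m) (fst x)"
            proof (cases "fst x \<le> \<tau>")
              case True then show ?thesis using eq[of "fst x"] xq by auto
            next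
              case False
              then have "x \<notin> S" using elim xt by (cases x) auto
              then show ?thesis using S(2)[OF xq] by blast
            qed
          qed
        qed
      qed
    qed
    then show ?thesis by blast
  qed
  obtain n where n: "P n t" using P True by force
  have stab: "L (Suc (Suc m)) u = L (Suc m) u" if "m \<ge> n" "0 < u" "u \<le> t" for m u
  proof -
    have "AE x in q. fst x \<le> t \<longrightarrow> (ennreal (snd x) \<le> L m (fst x) \<longleftrightarrow> ennreal (snd x) \<le> L (Suc m) (fst x))"
      using n that(1) by (simp add: P_def)
    then have "AE x in q. fst x < u \<longrightarrow> (ennreal (snd x) \<le> L m (fst x) \<longleftrightarrow> ennreal (snd x) \<le> L (Suc m) (fst x))"
      by eventually_elim (use that in auto)
    from next_eq[OF that(2) this] show ?thesis by simp
  qed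
  have "L m u = L (Suc n) u" if "m \<ge> Suc n" "0 < u" "u \<le> t" for m u
    using that(1)
  proof (induct m rule: dec_induct)
    case (step m)
    then obtain m' where "m = Suc m'" "n \<le> m'" by (cases m) auto
    then show ?case using step(3) stab[of m' u] that by simp
  qed simp
  then show ?thesis by blast
qed auto

text \<open>The limit is written as a limit inferior, which is measurable in all parameters whether or not the
sequence converges.\<close>

lemma picard_limit:
  fixes L :: "nat \<Rightarrow> real \<Rightarrow> ennreal"
  assumes rec: "\<And>n u. u > 0 \<Longrightarrow> L (Suc n) u = next_intensity n0 q lam h (L n) u"
    and S: "S \<in> sets q" "\<And>n x. x \<in> quadrant \<Longrightarrow> ennreal (snd x) \<le> L n (fst x) \<Longrightarrow> x \<in> S"
    and fin: "\<And>t. emeasure q (S \<inter> {0<..t} \<times> UNIV) < \<infinity>"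
    and u: "u > 0"
  shows "next_intensity n0 q lam h (\<lambda>u. liminf (\<lambda>n. L n u)) u = liminf (\<lambda>n. L n u)"
    "\<exists>m. liminf (\<lambda>n. L n u) = L m u"
proof -
  have "\<exists>n. \<forall>m\<ge>n. \<forall>v. 0 < v \<longrightarrow> v \<le> u \<longrightarrow> L m v = L n v"
  proof (rule picard_stabilises[where lam=lam and h=h and S=S])
    show "L (Suc n) v = next_intensity n0 q lam h (L n) v" if "v > 0" for n v using that by (rule rec)
    show "x \<in> S" if "x \<in> quadrant" "ennreal (snd x) \<le> L n (fst x)" for n x using that by (rule S(2))
  qed (rule S(1), rule fin)
  then obtain n where "\<forall>m\<ge>n. \<forall>v. 0 < v \<longrightarrow> v \<le> u \<longrightarrow> L m v = L n v" by blast
  then have n: "\<And>m v. m \<ge> n \<Longrightarrow> 0 < v \<Longrightarrow> v \<le> u \<Longrightarrow> L m v = L n v" by blast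
  have lim: "liminf (\<lambda>n. L n v) = L n v" if "0 < v" "v \<le> u" for v
  proof (rule lim_imp_Liminf[OF sequentially_bot tendsto_eventually])
    show "\<forall>\<^sub>F m in sequentially. L m v = L n v"
      unfolding eventually_sequentially using n[OF _ that] by blast
  qed
  have "next_intensity n0 q lam h (\<lambda>u. liminf (\<lambda>n. L n u)) u = next_intensity n0 q lam h (L n) u"
  proof (rule next_intensity_cong)
    show "AE x in q. fst x < u \<longrightarrow> (ennreal (snd x) \<le> liminf (\<lambda>n. L n (fst x)) \<longleftrightarrow> ennreal (snd x) \<le> L n (fst x))"
      using AE_space by eventually_elim (auto simp: space_q lim)
  qed
  also have "\<dots> = L (Suc n) u" using rec[OF u] by simp
  also have "\<dots> = liminf (\<lambda>n. L n u)" using n[of "Suc n" u] lim[of u] u by simp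
  finally show "next_intensity n0 q lam h (\<lambda>u. liminf (\<lambda>n. L n u)) u = liminf (\<lambda>n. L n u)" .
  show "\<exists>m. liminf (\<lambda>n. L n u) = L m u" using lim[of u] u by blast
qed

end

section \<open>Picard iteration\<close>

abbreviation path_of :: "(real \<times> 'w \<Rightarrow> ennreal) \<Rightarrow> 'w \<Rightarrow> real \<Rightarrow> ennreal" where
  "path_of f \<omega> u \<equiv> f (u, \<omega>) * indicator {0<..} u"

context driven_space begin

lemma path: "\<omega> \<in> space M \<Longrightarrow> hawkes_path (N0 \<omega>) (Q \<omega>)"
  by unfold_locales (auto intro: N0_counting Q_counting)

text \<open>Both parts of the integral only use what happened strictly before the current time.\<close>

lemma past_mass_predictable:
  fixes g :: "real \<Rightarrow> ennreal"
  assumes g[measurable]: "g \<in> borel_measurable borel" and l: "l \<in> borel_measurable (predictable M D)"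
  shows "(\<lambda>z. past_mass (N0 (snd z)) (Q (snd z)) g (path_of l (snd z)) (fst z)) \<in> borel_measurable (predictable M D)"
proof -
  let ?P = "predictable M D"
  note [measurable] = data.measurable_fst_predictable
  have 1: "(\<lambda>z. \<integral>\<^sup>+s. (\<lambda>(z, s). g (fst z - s)) (z, s) \<partial>N0 (snd z)) \<in> borel_measurable ?P"
    by (rule nn_integral_N0_predictable) measurable
  have m: "(\<lambda>x. (fst x, fst (snd x))) \<in> measurable (?P \<Otimes>\<^sub>M (borel :: (real \<times> real) measure)) (?P \<Otimes>\<^sub>M borel)"
    by measurable
  have [measurable]: "(\<lambda>x. l (fst (snd x), snd (fst x)) * indicator {0<..<fst (fst x)} (fst (snd x))) \<in> borel_measurable (?P \<Otimes>\<^sub>M (borel :: (real \<times> real) measure))"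
    using measurable_compose[OF m data.predictable_past[OF l]] by (simp add: split_beta')
  let ?f = "\<lambda>x. g (fst (fst x) - fst (snd x)) * of_bool (ennreal (snd (snd x)) \<le> l (fst (snd x), snd (fst x)) * indicator {0<..<fst (fst x)} (fst (snd x)))"
  have "?f \<in> borel_measurable (?P \<Otimes>\<^sub>M (borel :: (real \<times> real) measure))" by measurable
  note 2 = nn_integral_Q_predictable[OF this]
  have e: "past_mass (N0 (snd z)) (Q (snd z)) g (path_of l (snd z)) (fst z) =
    (\<integral>\<^sup>+s. (\<lambda>(z, s). g (fst z - s)) (z, s) \<partial>N0 (snd z)) + (\<integral>\<^sup>+x. ?f (z, x) * indicator {..<fst z} (fst x) \<partial>Q (snd z))"
    if "z \<in> space ?P" for z
    unfolding past_mass_def by (intro arg_cong2[where f="(+)"] nn_integral_cong) (auto simp: indicator_def)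
  show ?thesis using 1 2 by (subst measurable_cong[OF e]) auto
qed

lemma next_intensity_predictable:
  assumes k[measurable]: "k \<in> borel_measurable borel" and l: "l \<in> borel_measurable (predictable M D)"
  shows "(\<lambda>z. next_intensity (N0 (snd z)) (Q (snd z)) lam k (path_of l (snd z)) (fst z)) \<in> borel_measurable (predictable M D)"
proof -
  have [measurable]: "(\<lambda>z. past_mass (N0 (snd z)) (Q (snd z)) (\<lambda>t. ennreal (k t)) (path_of l (snd z)) (fst z)) \<in> borel_measurable (predictable M D)"
    "(\<lambda>z. past_mass (N0 (snd z)) (Q (snd z)) (\<lambda>t. ennreal (- k t)) (path_of l (snd z)) (fst z)) \<in> borel_measurable (predictable M D)"
    by (intro past_mass_predictable l; measurable)+
  show ?thesis unfolding next_intensity_def by measurable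
qed

lemma predictable_D_F: "l \<in> borel_measurable (predictable M D) \<Longrightarrow> (l :: _ \<Rightarrow> ennreal) \<in> borel_measurable (predictable M F)"
proof (erule measurable_from_subalg[rotated])
  show "subalgebra (predictable M F) (predictable M D)"
    unfolding subalgebra_def using predictable_D_sub_F by (simp add: data.space_predictable past.space_predictable)
qed

lemma section_D: "l \<in> borel_measurable (predictable M D) \<Longrightarrow> \<omega> \<in> space M \<Longrightarrow>
  path_of l \<omega> \<in> borel_measurable borel"
  by (rule data.predictable_section)

lemma accept_adapted:
  assumes l: "l \<in> borel_measurable (predictable M D)" and A: "A \<in> sets borel" "A \<subseteq> {0<..t}" and t: "0 \<le> t"
  shows "(\<lambda>\<omega>. accepted (Q \<omega>) (path_of l \<omega>) A) \<in> borel_measurable (D t)"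
proof -
  note [measurable] = l A(1) data.measurable_fst_predictable
  have "(\<lambda>x. indicator A (fst (fst x)) * of_bool (ennreal (snd x) \<le> l (fst x)) :: ennreal) \<in> borel_measurable (predictable M D \<Otimes>\<^sub>M borel)"
    by measurable
  then have "(\<lambda>(\<omega>, x). (\<lambda>x. indicator A (fst (fst x)) * of_bool (ennreal (snd x) \<le> l (fst x))) ((fst x, \<omega>), snd x) * indicator {0<..t} (fst x) :: ennreal) \<in> borel_measurable (D t \<Otimes>\<^sub>M borel)"
  proof (rule data.predictable_marked_adapted)
    fix a X assume "0 \<le> a" "X \<in> sets (D a)" "{0<..t} \<inter> {a<..} \<noteq> {}"
    then show "X \<in> sets (D t)" using D_mono[of a t] by auto
  qed (auto simp: space_D)
  then have "(\<lambda>(\<omega>, x). (indicator A (fst x) * of_bool (ennreal (snd x) \<le> l (fst x, \<omega>))) * indicator {0<..t} (fst x) :: ennreal) \<in> borel_measurable (D t \<Otimes>\<^sub>M borel)"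
    by simp
  then have "(\<lambda>\<omega>. \<integral>\<^sup>+x. (\<lambda>(\<omega>, x). (indicator A (fst x) * of_bool (ennreal (snd x) \<le> l (fst x, \<omega>))) * indicator {0<..t} (fst x)) (\<omega>, x) * indicator {0<..t} (fst x) \<partial>Q \<omega> :: ennreal) \<in> borel_measurable (D t)"
    by (intro nn_integral_Q_adapted Q_measurable_data) (auto simp: space_D)
  moreover have "(accepted (Q \<omega>) (path_of l \<omega>) A) =
    (\<integral>\<^sup>+x. (\<lambda>(\<omega>, x). (indicator A (fst x) * of_bool (ennreal (snd x) \<le> l (fst x, \<omega>))) * indicator {0<..t} (fst x)) (\<omega>, x) * indicator {0<..t} (fst x) \<partial>Q \<omega> :: ennreal)" for \<omega>
    using A(2) by (intro nn_integral_cong) (auto simp: indicator_def)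
  ultimately show ?thesis by simp
qed

lemma accept_measurable_M:
  assumes l: "l \<in> borel_measurable (predictable M D)" and A: "A \<in> sets borel"
  shows "(\<lambda>\<omega>. accepted (Q \<omega>) (path_of l \<omega>) A) \<in> borel_measurable M"
proof -
  let ?I = "\<lambda>B \<omega>. accepted (Q \<omega>) (path_of l \<omega>) B"
  have m: "?I (A \<inter> {0<..real n}) \<in> borel_measurable M" for n
    by (rule measurable_from_subalg[OF _ accept_adapted[OF l, of _ "real n"]]) (use A D_sub_M space_D in \<open>auto simp: subalgebra_def\<close>)
  have "?I A \<omega> = (SUP n. ?I (A \<inter> {0<..real n}) \<omega>)" if \<omega>: "\<omega> \<in> space M" for \<omega>
  proof -
    interpret hawkes_path "N0 \<omega>" "Q \<omega>" by (rule path[OF \<omega>])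
    have "?I A \<omega> = (\<integral>\<^sup>+x. (SUP n. indicator (A \<inter> {0<..real n}) (fst x) * of_bool (ennreal (snd x) \<le> l (fst x, \<omega>) * indicator {0<..} (fst x))) \<partial>Q \<omega>)"
    proof (rule nn_integral_cong)
      fix x assume "x \<in> space (Q \<omega>)"
      then have x: "x \<in> quadrant" by (simp add: space_q)
      obtain n :: nat where n: "fst x \<le> real n" using real_arch_simple by blast
      let ?b = "of_bool (ennreal (snd x) \<le> l (fst x, \<omega>) * indicator {0<..} (fst x)) :: ennreal"
      have "indicator A (fst x) * ?b = indicator (A \<inter> {0<..real n}) (fst x) * ?b" using n x by (auto simp: indicator_def)
      also have "\<dots> \<le> (SUP n. indicator (A \<inter> {0<..real n}) (fst x) * ?b)" by (rule SUP_upper) simp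
      finally have "indicator A (fst x) * ?b \<le> (SUP n. indicator (A \<inter> {0<..real n}) (fst x) * ?b)" .
      moreover have "(SUP n. indicator (A \<inter> {0<..real n}) (fst x) * ?b) \<le> indicator A (fst x) * ?b"
        by (rule SUP_least) (auto simp: indicator_def)
      ultimately show "indicator A (fst x) * ?b = (SUP n. indicator (A \<inter> {0<..real n}) (fst x) * ?b)" by (rule antisym)
    qed
    also have "\<dots> = (SUP n. ?I (A \<inter> {0<..real n}) \<omega>)"
    proof (rule nn_integral_monotone_convergence_SUP)
      show "incseq (\<lambda>n x. indicator (A \<inter> {0<..real n}) (fst x) * of_bool (ennreal (snd x) \<le> l (fst x, \<omega>) * indicator {0<..} (fst x)) :: ennreal)"
        by (intro monoI le_funI mult_right_mono) (auto simp: indicator_def)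
      show "(\<lambda>x. indicator (A \<inter> {0<..real n}) (fst x) * of_bool (ennreal (snd x) \<le> l (fst x, \<omega>) * indicator {0<..} (fst x)) :: ennreal) \<in> borel_measurable (Q \<omega>)" for n
        using A by (intro accept_measurable section_D l \<omega>) simp
    qed
    finally show ?thesis .
  qed
  then show ?thesis using m by (subst measurable_cong) auto
qed

lemma accept_mean:
  assumes l: "l \<in> borel_measurable (predictable M D)" and A: "A \<in> sets borel"
  shows "(\<integral>\<^sup>+\<omega>. (accepted (Q \<omega>) (path_of l \<omega>) A) \<partial>M) =
    (\<integral>\<^sup>+\<omega>. (\<integral>\<^sup>+u\<in>{0<..}. indicator A u * l (u, \<omega>) \<partial>lborel) \<partial>M)"
proof -
  have C: "(\<lambda>z. indicator A (fst z) :: ennreal) \<in> borel_measurable (predictable M F)"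
    by (rule measurable_compose[OF past.measurable_fst_predictable]) (use A in simp)
  have "(\<integral>\<^sup>+\<omega>. (accepted (Q \<omega>) (path_of l \<omega>) A) \<partial>M) =
    (\<integral>\<^sup>+\<omega>. \<integral>\<^sup>+x. (\<lambda>z. indicator A (fst z)) (fst x, \<omega>) * of_bool (ennreal (snd x) \<le> l (fst x, \<omega>)) \<partial>Q \<omega> \<partial>M)"
    by (intro nn_integral_cong) (auto simp: space_Q)
  also have "\<dots> = (\<integral>\<^sup>+\<omega>. (\<integral>\<^sup>+u\<in>{0<..}. (\<lambda>z. indicator A (fst z)) (u, \<omega>) * l (u, \<omega>) \<partial>lborel) \<partial>M)"
    by (rule thinning_compensator[OF C predictable_D_F[OF l]])
  finally show ?thesis by simp
qed

text \<open>The filtration contains all null sets of the complete space.\<close>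

lemma modification_measurable:
  fixes f g :: "'w \<Rightarrow> ennreal"
  assumes g: "g \<in> borel_measurable (F t)" and t: "0 \<le> t" and eq: "AE \<omega> in M. f \<omega> = g \<omega>"
  shows "f \<in> borel_measurable (F t)"
proof (rule measurableI)
  obtain Z where Z: "{\<omega> \<in> space M. f \<omega> \<noteq> g \<omega>} \<subseteq> Z" "Z \<in> null_sets M"
    using AE_E[OF eq] by (metis null_setsI)
  have null: "X \<in> sets (F t)" if "X \<subseteq> Z" for X
    using complete2[OF that Z(2)] null_sets_F F_mono[of 0 t] t by auto
  fix B :: "ennreal set" assume B: "B \<in> sets borel"
  have "f -` B \<inter> space (F t) = (g -` B \<inter> space (F t) - Z) \<union> (f -` B \<inter> space M \<inter> Z)"
    using Z(1) space_F[OF t] by auto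
  moreover have "g -` B \<inter> space (F t) - Z \<in> sets (F t)"
    using measurable_sets[OF g B] null[of Z] by auto
  ultimately show "f -` B \<inter> space (F t) \<in> sets (F t)" using null[of "f -` B \<inter> space M \<inter> Z"] by auto
qed simp

end

text \<open>The two integrability assumptions are stated with \<open>ennreal (h t)\<close>, which is the positive part of
\<open>h t\<close>. They are therefore the same for \<open>h\<close> and for \<open>hp\<close>, and the theory below applies to both.\<close>

locale hawkes_driven = driven_space M F Q N0 for M :: "'w measure" and F Q N0 +
  fixes lam :: real and h :: "real \<Rightarrow> real"
  assumes h: "h \<in> borel_measurable borel" and lam: "lam > 0"
    and subcritical: "(\<integral>\<^sup>+t\<in>{0<..}. ennreal (h t) \<partial>lborel) < 1"
    and initial: "\<forall>t>0. (\<integral>\<^sup>+u\<in>{0<..t}. (\<integral>\<^sup>+\<omega>. (\<integral>\<^sup>+s. ennreal (h (u - s)) \<partial>N0 \<omega>) \<partial>M) \<partial>lborel) < \<infinity>"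
begin

abbreviation "hp \<equiv> \<lambda>t. max (h t) 0"

lemma hp: "hp \<in> borel_measurable borel" using h by measurable

primrec picard :: "(real \<Rightarrow> real) \<Rightarrow> nat \<Rightarrow> real \<times> 'w \<Rightarrow> ennreal" where
  "picard k 0 = (\<lambda>_. 0)"
| "picard k (Suc n) = (\<lambda>z. next_intensity (N0 (snd z)) (Q (snd z)) lam k (path_of (picard k n) (snd z)) (fst z))"

lemma picard_predictable: "k \<in> borel_measurable borel \<Longrightarrow> picard k n \<in> borel_measurable (predictable M D)"
  by (induct n) (simp_all add: next_intensity_predictable)

lemma next_intensity_hp:
  "next_intensity n0 q lam hp l u = ennreal lam + past_mass n0 q (\<lambda>t. ennreal (h t)) l u"
proof -
  have p: "ennreal (max x 0) = ennreal x" "ennreal (- max x 0) = 0" for x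
    by (auto simp: max_def ennreal_neg)
  have "past_mass n0 q (\<lambda>t. 0) l u = 0" by (simp add: past_mass_def)
  then show ?thesis unfolding next_intensity_def p using e2ennreal_max_nonneg[of lam] lam by simp
qed

lemma next_intensity_le_hp:
  assumes "hawkes_path n0 q" "\<And>s. s > 0 \<Longrightarrow> l s \<le> l' s" "u > 0"
  shows "next_intensity n0 q lam h l u \<le> next_intensity n0 q lam hp l' u"
    "next_intensity n0 q lam hp l u \<le> next_intensity n0 q lam hp l' u"
proof -
  interpret hawkes_path n0 q by (rule assms)
  have m: "past_mass n0 q (\<lambda>t. ennreal (h t)) l u \<le> past_mass n0 q (\<lambda>t. ennreal (h t)) l' u"
    by (rule past_mass_mono) (use assms in auto)
  show "next_intensity n0 q lam hp l u \<le> next_intensity n0 q lam hp l' u"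
    unfolding next_intensity_hp using m by (intro add_left_mono)
  show "next_intensity n0 q lam h l u \<le> next_intensity n0 q lam hp l' u"
    unfolding next_intensity_hp unfolding next_intensity_def using m lam by (intro e2ennreal_max_le) auto
qed

text \<open>The map \<open>next_intensity\<close> is monotone for \<open>hp\<close> and, for equal arguments, larger for \<open>hp\<close> than for \<open>h\<close>.
For \<open>h\<close> itself it is not monotone, which is why the iterates for \<open>h\<close> are controlled through those for \<open>hp\<close>.\<close>

lemma picard_mono:
  assumes \<omega>: "\<omega> \<in> space M"
  shows "u > 0 \<Longrightarrow> picard h n (u, \<omega>) \<le> picard hp n (u, \<omega>)" "u > 0 \<Longrightarrow> picard hp n (u, \<omega>) \<le> picard hp (Suc n) (u, \<omega>)"
proof -
  note le = next_intensity_le_hp[OF path[OF \<omega>]]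
  show "u > 0 \<Longrightarrow> picard h n (u, \<omega>) \<le> picard hp n (u, \<omega>)"
  proof (induct n arbitrary: u)
    case (Suc n) then show ?case by (auto intro!: le(1) mult_right_mono)
  qed simp
  show "u > 0 \<Longrightarrow> picard hp n (u, \<omega>) \<le> picard hp (Suc n) (u, \<omega>)"
  proof (induct n arbitrary: u)
    case (Suc n)
    have "next_intensity (N0 \<omega>) (Q \<omega>) lam hp (path_of (picard hp n) \<omega>) u \<le>
      next_intensity (N0 \<omega>) (Q \<omega>) lam hp (path_of (picard hp (Suc n)) \<omega>) u"
      using Suc by (intro le(2) mult_right_mono) auto
    then show ?case by simp
  qed simp
qed

lemma sigma_finite_Q: "\<omega> \<in> space M \<Longrightarrow> sigma_finite_measure (Q \<omega>)"
proof
  assume \<omega>: "\<omega> \<in> space M"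
  let ?A = "range (\<lambda>n. {0<..real n} \<times> {0<..real n})"
  have "emeasure (Q \<omega>) ({0<..real n} \<times> {0<..real n}) < \<infinity>" for n
    by (rule Q_finite[OF \<omega> _ order.refl]) (auto intro!: borel_Times)
  then have "\<forall>a\<in>?A. emeasure (Q \<omega>) a \<noteq> \<infinity>" by (auto simp: less_top[symmetric])
  moreover have "?A \<subseteq> sets (Q \<omega>)" using quadrant_squares(1) sets_Q[OF \<omega>] by auto
  moreover have "\<Union> ?A = space (Q \<omega>)" using quadrant_squares(3) space_Q[OF \<omega>] by (simp add: space_restrict_space)
  ultimately show "\<exists>A. countable A \<and> A \<subseteq> sets (Q \<omega>) \<and> \<Union> A = space (Q \<omega>) \<and> (\<forall>a\<in>A. emeasure (Q \<omega>) a \<noteq> \<infinity>)"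
    by (intro exI[of _ ?A]) simp
qed

lemma nn_integral_shift:
  "(\<integral>\<^sup>+u\<in>{0<..}. ennreal (h (u - s)) * indicator {s<..} u \<partial>lborel) \<le> (\<integral>\<^sup>+t\<in>{0<..}. ennreal (h t) \<partial>lborel)" for s
proof -
  have [measurable]: "h \<in> borel_measurable borel" by (rule h)
  have "(\<integral>\<^sup>+u\<in>{0<..}. ennreal (h (u - s)) * indicator {s<..} u \<partial>lborel) \<le> (\<integral>\<^sup>+u. ennreal (h (u - s)) * indicator {0<..} (u - s) \<partial>lborel)"
    by (intro nn_integral_mono) (auto simp: indicator_def)
  also have "\<dots> = (\<integral>\<^sup>+t. ennreal (h t) * indicator {0<..} t \<partial>lborel)"
    using nn_integral_real_affine[of "\<lambda>u. ennreal (h (u - s)) * indicator {0<..} (u - s)" 1 s] by simp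
  finally show ?thesis .
qed

lemma offspring_joint:
  assumes l: "l \<in> borel_measurable borel" and \<omega>: "\<omega> \<in> space M"
  shows "(\<lambda>(u, x). ennreal (h (u - fst x)) * of_bool (ennreal (snd x) \<le> l (fst x)) * of_bool (fst x < u) * of_bool (0 < u \<and> u \<le> t))
    \<in> borel_measurable (lborel \<Otimes>\<^sub>M Q \<omega>)" (is "?f \<in> _")
proof -
  note [measurable] = h l
  have "?f \<in> borel_measurable (borel \<Otimes>\<^sub>M (borel :: (real \<times> real) measure))" by measurable
  from measurable_quadrant_marginals[OF this] show ?thesis
    by (subst measurable_cong_sets[OF sets_pair_measure_cong[OF sets_lborel sets_Q[OF \<omega>]] refl])
qed

lemma offspring_section:
  assumes l: "l \<in> borel_measurable borel" and \<omega>: "\<omega> \<in> space M"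
  shows "(\<lambda>u. (\<integral>\<^sup>+x. ennreal (h (u - fst x)) * of_bool (ennreal (snd x) \<le> l (fst x)) * indicator {..<u} (fst x) \<partial>Q \<omega>) * indicator {0<..t} u)
    \<in> borel_measurable lborel"
proof -
  interpret Q: sigma_finite_measure "Q \<omega>" by (rule sigma_finite_Q[OF \<omega>])
  have "(\<lambda>u. \<integral>\<^sup>+x. ennreal (h (u - fst x)) * of_bool (ennreal (snd x) \<le> l (fst x)) * of_bool (fst x < u) * of_bool (0 < u \<and> u \<le> t) \<partial>Q \<omega>) \<in> borel_measurable lborel"
    by (rule Q.borel_measurable_nn_integral[OF offspring_joint[OF l \<omega>]])
  moreover have "(\<integral>\<^sup>+x. ennreal (h (u - fst x)) * of_bool (ennreal (snd x) \<le> l (fst x)) * of_bool (fst x < u) * of_bool (0 < u \<and> u \<le> t) \<partial>Q \<omega>) =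
    (\<integral>\<^sup>+x. ennreal (h (u - fst x)) * of_bool (ennreal (snd x) \<le> l (fst x)) * indicator {..<u} (fst x) \<partial>Q \<omega>) * indicator {0<..t} u" for u
    by (auto simp: indicator_def intro!: nn_integral_cong)
  ultimately show ?thesis by simp
qed

text \<open>By Tonelli each accepted point \<open>s\<close> contributes the integral of the positive part of \<open>h\<close> over
\<open>(0, t - s]\<close>, which is at most its total mass.\<close>

lemma offspring_bound:
  assumes l: "l \<in> borel_measurable borel" and \<omega>: "\<omega> \<in> space M"
  shows "(\<integral>\<^sup>+u\<in>{0<..t}. (\<integral>\<^sup>+x. ennreal (h (u - fst x)) * of_bool (ennreal (snd x) \<le> l (fst x)) * indicator {..<u} (fst x) \<partial>Q \<omega>) \<partial>lborel)
    \<le> (\<integral>\<^sup>+t\<in>{0<..}. ennreal (h t) \<partial>lborel) * (accepted (Q \<omega>) l {0<..t})"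
proof -
  interpret hawkes_path "N0 \<omega>" "Q \<omega>" by (rule path[OF \<omega>])
  interpret Q: sigma_finite_measure "Q \<omega>" by (rule sigma_finite_Q[OF \<omega>])
  interpret P: pair_sigma_finite lborel "Q \<omega>" ..
  let ?r = "\<integral>\<^sup>+t\<in>{0<..}. ennreal (h t) \<partial>lborel"
  let ?b = "\<lambda>x. of_bool (ennreal (snd x) \<le> l (fst x)) :: ennreal"
  let ?f = "\<lambda>u x. ennreal (h (u - fst x)) * ?b x * of_bool (fst x < u) * of_bool (0 < u \<and> u \<le> t)"
  note [measurable] = h l
  have m: "(\<lambda>(u, x). ?f u x) \<in> borel_measurable (lborel \<Otimes>\<^sub>M Q \<omega>)" by (rule offspring_joint[OF l \<omega>])
  have "(\<integral>\<^sup>+u\<in>{0<..t}. (\<integral>\<^sup>+x. ennreal (h (u - fst x)) * ?b x * indicator {..<u} (fst x) \<partial>Q \<omega>) \<partial>lborel)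
    = (\<integral>\<^sup>+u. \<integral>\<^sup>+x. ?f u x \<partial>Q \<omega> \<partial>lborel)"
    by (intro nn_integral_cong) (auto simp: indicator_def intro!: nn_integral_cong)
  also have "\<dots> = (\<integral>\<^sup>+x. \<integral>\<^sup>+u. ?f u x \<partial>lborel \<partial>Q \<omega>)" by (rule P.Fubini'[OF m, symmetric])
  also have "\<dots> \<le> (\<integral>\<^sup>+x. ?r * (indicator {0<..t} (fst x) * ?b x) \<partial>Q \<omega>)"
  proof (rule nn_integral_mono)
    fix x assume "x \<in> space (Q \<omega>)"
    then have x: "0 < fst x" by (auto simp: space_q)
    have "(\<integral>\<^sup>+u. ?f u x \<partial>lborel) \<le> (\<integral>\<^sup>+u. (indicator {0<..t} (fst x) * ?b x) * (ennreal (h (u - fst x)) * indicator {fst x<..} u * indicator {0<..} u) \<partial>lborel)"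
      using x by (intro nn_integral_mono) (auto simp: indicator_def)
    also have "\<dots> = (indicator {0<..t} (fst x) * ?b x) * (\<integral>\<^sup>+u. ennreal (h (u - fst x)) * indicator {fst x<..} u * indicator {0<..} u \<partial>lborel)"
      by (rule nn_integral_cmult) measurable
    also have "\<dots> \<le> (indicator {0<..t} (fst x) * ?b x) * ?r"
      using nn_integral_shift[of "fst x"] by (intro mult_left_mono) auto
    finally show "(\<integral>\<^sup>+u. ?f u x \<partial>lborel) \<le> ?r * (indicator {0<..t} (fst x) * ?b x)" by (simp add: mult.commute)
  qed
  also have "\<dots> = ?r * (\<integral>\<^sup>+x. indicator {0<..t} (fst x) * ?b x \<partial>Q \<omega>)"
    by (rule nn_integral_cmult, rule accept_measurable[OF l]) simp
  finally show ?thesis .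
qed

lemma immigrant_joint:
  "(\<lambda>(\<omega>, u). \<integral>\<^sup>+s. ennreal (h (u - s)) \<partial>N0 \<omega>) \<in> borel_measurable (M \<Otimes>\<^sub>M lborel)"
proof -
  note [measurable] = h
  have meas0: "(\<lambda>\<omega>. emeasure (N0 \<omega>) (A \<inter> {..0})) \<in> borel_measurable M" if "A \<in> sets borel" for A
    by (rule measurable_from_subalg[OF _ N0_emeasure_measurable_data[OF that, of 0]]) (use D_sub_M[of 0] space_D in \<open>auto simp: subalgebra_def\<close>)
  have "(\<lambda>z. \<integral>\<^sup>+s. (\<lambda>(z, s). ennreal (h (snd z - s))) (z, s) \<partial>N0 (fst z)) \<in> borel_measurable (M \<Otimes>\<^sub>M borel)"
  proof (rule nn_integral_N0_measurable)
    show "(\<lambda>z. emeasure (N0 (fst z)) (A \<inter> {..0})) \<in> borel_measurable (M \<Otimes>\<^sub>M borel)" if "A \<in> sets borel" for A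
      by (rule measurable_compose[OF measurable_fst meas0[OF that]])
  qed (measurable, auto simp: space_pair_measure)
  then show ?thesis
    unfolding measurable_cong_sets[OF sets_pair_measure_cong[OF refl sets_lborel] refl] by (simp add: split_beta')
qed

lemma immigrant_section:
  assumes "\<omega> \<in> space M"
  shows "(\<lambda>u. (\<integral>\<^sup>+s. ennreal (h (u - s)) \<partial>N0 \<omega>) * indicator {0<..t} u) \<in> borel_measurable borel"
  using measurable_Pair2[OF immigrant_joint assms] by simp

lemma immigrant_measurable:
  "(\<lambda>\<omega>. \<integral>\<^sup>+u\<in>{0<..t}. (\<integral>\<^sup>+s. ennreal (h (u - s)) \<partial>N0 \<omega>) \<partial>lborel) \<in> borel_measurable M"
proof -
  note [measurable] = immigrant_joint
  show ?thesis by measurable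
qed

lemma immigrant_mass:
  "(\<integral>\<^sup>+\<omega>. (\<integral>\<^sup>+u\<in>{0<..t}. (\<integral>\<^sup>+s. ennreal (h (u - s)) \<partial>N0 \<omega>) \<partial>lborel) \<partial>M) =
   (\<integral>\<^sup>+u\<in>{0<..t}. (\<integral>\<^sup>+\<omega>. (\<integral>\<^sup>+s. ennreal (h (u - s)) \<partial>N0 \<omega>) \<partial>M) \<partial>lborel)"
proof -
  interpret P: pair_sigma_finite M lborel ..
  have s: "(\<lambda>\<omega>. \<integral>\<^sup>+s. ennreal (h (u - s)) \<partial>N0 \<omega>) \<in> borel_measurable M" for u
    using measurable_compose[OF measurable_Pair[OF measurable_ident_sets[OF refl] measurable_const[of u lborel M]] immigrant_joint] by simp
  note [measurable] = immigrant_joint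
  have m: "(\<lambda>(\<omega>, u). (\<integral>\<^sup>+s. ennreal (h (u - s)) \<partial>N0 \<omega>) * indicator {0<..t} u) \<in> borel_measurable (M \<Otimes>\<^sub>M lborel)"
    by measurable
  have "(\<integral>\<^sup>+\<omega>. (\<integral>\<^sup>+u\<in>{0<..t}. (\<integral>\<^sup>+s. ennreal (h (u - s)) \<partial>N0 \<omega>) \<partial>lborel) \<partial>M)
    = (\<integral>\<^sup>+u. (\<integral>\<^sup>+\<omega>. (\<integral>\<^sup>+s. ennreal (h (u - s)) \<partial>N0 \<omega>) * indicator {0<..t} u \<partial>M) \<partial>lborel)"
    using P.Fubini'[OF m] by simp
  also have "\<dots> = (\<integral>\<^sup>+u\<in>{0<..t}. (\<integral>\<^sup>+\<omega>. (\<integral>\<^sup>+s. ennreal (h (u - s)) \<partial>N0 \<omega>) \<partial>M) \<partial>lborel)"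
    by (intro nn_integral_cong nn_integral_multc s)
  finally show ?thesis .
qed

lemma ennreal_affine_fixpoint:
  fixes a r :: ennreal
  assumes "a < \<infinity>" "r < 1"
  shows "\<exists>K. K < \<infinity> \<and> a + r * K = K"
proof -
  obtain a' where a: "a = ennreal a'" "0 \<le> a'" using assms(1) by (cases a) auto
  obtain r' where r: "r = ennreal r'" "0 \<le> r'" using assms(2) by (cases r) auto
  have r1: "r' < 1" using assms(2) r by (simp add: ennreal_less_iff flip: ennreal_1)
  define k where "k = a' / (1 - r')"
  have k: "a' + r' * k = k" "0 \<le> k" using r1 a by (simp_all add: k_def field_simps)
  then have "a + r * ennreal k = ennreal k"
    using a r by (simp add: ennreal_mult[symmetric] ennreal_plus[symmetric] del: ennreal_plus)
  then show ?thesis by (intro exI[of _ "ennreal k"]) simp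
qed

text \<open>Immigration and \<open>N0\<close> contribute a finite amount \<open>a\<close> to the mean of the next iterate, and the accepted points
contribute at most \<open>r\<close> times the mean of the present one, by \<open>offspring_bound\<close> and \<open>accept_mean\<close>. As
\<open>r < 1\<close>, the bound \<open>K = a / (1 - r)\<close> is preserved, and it holds for the zero iterate.\<close>

lemma picard_mean_bound:
  assumes t: "t > 0"
  shows "\<exists>K<\<infinity>. \<forall>n. (\<integral>\<^sup>+\<omega>. (\<integral>\<^sup>+u\<in>{0<..}. indicator {0<..t} u * picard hp n (u, \<omega>) \<partial>lborel) \<partial>M) \<le> K"
proof -
  let ?r = "\<integral>\<^sup>+t\<in>{0<..}. ennreal (h t) \<partial>lborel"
  let ?imm = "\<integral>\<^sup>+\<omega>. (\<integral>\<^sup>+u\<in>{0<..t}. (\<integral>\<^sup>+s. ennreal (h (u - s)) \<partial>N0 \<omega>) \<partial>lborel) \<partial>M"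
  let ?a = "ennreal lam * ennreal t + ?imm"
  let ?x = "\<lambda>n. \<integral>\<^sup>+\<omega>. (\<integral>\<^sup>+u\<in>{0<..}. indicator {0<..t} u * picard hp n (u, \<omega>) \<partial>lborel) \<partial>M"
  have "?imm < \<infinity>" unfolding immigrant_mass using initial t by simp
  then have "?a < \<infinity>" by (simp add: ennreal_mult_less_top)
  then obtain K where K: "K < \<infinity>" "?a + ?r * K = K" using ennreal_affine_fixpoint[OF _ subcritical] by blast
  have pp: "picard hp n \<in> borel_measurable (predictable M D)" for n by (rule picard_predictable[OF hp])
  have step: "?x (Suc n) \<le> ?a + ?r * ?x n" for n
  proof -
    let ?l = "\<lambda>\<omega> s. picard hp n (s, \<omega>) * indicator {0<..} s"
    let ?c = "\<lambda>\<omega>. accepted (Q \<omega>) (?l \<omega>) {0<..t}"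
    have c: "?c \<in> borel_measurable M" by (rule accept_measurable_M[OF pp]) simp
    note [measurable] = h
    have immM: "(\<lambda>\<omega>. \<integral>\<^sup>+u\<in>{0<..t}. (\<integral>\<^sup>+s. ennreal (h (u - s)) \<partial>N0 \<omega>) \<partial>lborel) \<in> borel_measurable M"
      by (rule immigrant_measurable)
    have "?x (Suc n) \<le> (\<integral>\<^sup>+\<omega>. ennreal lam * ennreal t + (\<integral>\<^sup>+u\<in>{0<..t}. (\<integral>\<^sup>+s. ennreal (h (u - s)) \<partial>N0 \<omega>) \<partial>lborel) + ?r * ?c \<omega> \<partial>M)"
    proof (rule nn_integral_mono)
      fix \<omega> assume \<omega>: "\<omega> \<in> space M"
      interpret hawkes_path "N0 \<omega>" "Q \<omega>" by (rule path[OF \<omega>])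
      let ?I = "\<lambda>u. \<integral>\<^sup>+s. ennreal (h (u - s)) \<partial>N0 \<omega>"
      let ?J = "\<lambda>u. \<integral>\<^sup>+x. ennreal (h (u - fst x)) * of_bool (ennreal (snd x) \<le> ?l \<omega> (fst x)) * indicator {..<u} (fst x) \<partial>Q \<omega>"
      have Im: "(\<lambda>u. ?I u * indicator {0<..t} u) \<in> borel_measurable lborel" using immigrant_section[OF \<omega>] by simp
      have 1: "(\<integral>\<^sup>+u\<in>{0<..}. indicator {0<..t} u * picard hp (Suc n) (u, \<omega>) \<partial>lborel) = (\<integral>\<^sup>+u. (ennreal lam * indicator {0<..t} u + ?I u * indicator {0<..t} u) + ?J u * indicator {0<..t} u \<partial>lborel)"
        by (intro nn_integral_cong) (auto simp: indicator_def next_intensity_hp past_mass_def add_ac)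
      have 2: "\<dots> = (\<integral>\<^sup>+u. ennreal lam * indicator {0<..t} u + ?I u * indicator {0<..t} u \<partial>lborel) + (\<integral>\<^sup>+u. ?J u * indicator {0<..t} u \<partial>lborel)"
        using Im offspring_section[OF section_D[OF pp \<omega>] \<omega>] by (intro nn_integral_add) auto
      have 3: "(\<integral>\<^sup>+u. ennreal lam * indicator {0<..t} u + ?I u * indicator {0<..t} u \<partial>lborel) = ennreal lam * ennreal t + (\<integral>\<^sup>+u. ?I u * indicator {0<..t} u \<partial>lborel)"
        using Im t by (subst nn_integral_add) (auto simp: nn_integral_cmult)
      have 4: "(\<integral>\<^sup>+u. ?J u * indicator {0<..t} u \<partial>lborel) \<le> ?r * ?c \<omega>"
        by (rule offspring_bound[OF section_D[OF pp \<omega>] \<omega>])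
      show "(\<integral>\<^sup>+u\<in>{0<..}. indicator {0<..t} u * picard hp (Suc n) (u, \<omega>) \<partial>lborel) \<le>
        ennreal lam * ennreal t + (\<integral>\<^sup>+u\<in>{0<..t}. ?I u \<partial>lborel) + ?r * ?c \<omega>"
        unfolding 1 2 3 by (rule add_left_mono[OF 4])
    qed
    moreover have "\<dots> = (\<integral>\<^sup>+\<omega>. ennreal lam * ennreal t + (\<integral>\<^sup>+u\<in>{0<..t}. (\<integral>\<^sup>+s. ennreal (h (u - s)) \<partial>N0 \<omega>) \<partial>lborel) \<partial>M) + (\<integral>\<^sup>+\<omega>. ?r * ?c \<omega> \<partial>M)"
      using c immM by (intro nn_integral_add) auto
    moreover have "(\<integral>\<^sup>+\<omega>. ennreal lam * ennreal t + (\<integral>\<^sup>+u\<in>{0<..t}. (\<integral>\<^sup>+s. ennreal (h (u - s)) \<partial>N0 \<omega>) \<partial>lborel) \<partial>M) = ?a"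
      using immM by (subst nn_integral_add) (auto simp: emeasure_space_1)
    moreover have "(\<integral>\<^sup>+\<omega>. ?r * ?c \<omega> \<partial>M) = ?r * (\<integral>\<^sup>+\<omega>. ?c \<omega> \<partial>M)" by (rule nn_integral_cmult[OF c])
    moreover have "(\<integral>\<^sup>+\<omega>. ?c \<omega> \<partial>M) = ?x n" by (rule accept_mean[OF pp]) simp
    ultimately show ?thesis by (simp only:)
  qed
  have "?x n \<le> K" for n
  proof (induct n)
    case (Suc n)
    have "?x (Suc n) \<le> ?a + ?r * K" using step[of n] Suc by (meson add_left_mono mult_left_mono order_trans zero_le)
    then show ?case using K(2) by simp
  qed simp
  then show ?thesis using K(1) by blast
qed

text \<open>This set plays the role of \<open>S\<close> in \<open>picard_stabilises\<close>. It contains the points accepted by the iterates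
for \<open>h\<close> as well, by \<open>picard_mono\<close>.\<close>

definition dominating_points :: "'w \<Rightarrow> (real \<times> real) set" where
  "dominating_points \<omega> = {x \<in> quadrant. \<exists>n. ennreal (snd x) \<le> picard hp n (fst x, \<omega>)}"

lemma dominating_points_sets:
  assumes \<omega>: "\<omega> \<in> space M" shows "dominating_points \<omega> \<in> sets (Q \<omega>)"
proof -
  interpret hawkes_path "N0 \<omega>" "Q \<omega>" by (rule path[OF \<omega>])
  have "dominating_points \<omega> = (\<Union>n. {x. fst x \<in> UNIV \<and> ennreal (snd x) \<le> picard hp n (fst x, \<omega>) * indicator {0<..} (fst x)} \<inter> quadrant)"
    by (auto simp: dominating_points_def)
  also have "\<dots> \<in> sets (Q \<omega>)"
    using thinned_accept(2)[OF section_D[OF picard_predictable[OF hp] \<omega>], of UNIV] by (intro sets.countable_UN) auto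
  finally show ?thesis .
qed

lemma dominating_count:
  assumes \<omega>: "\<omega> \<in> space M"
  shows "emeasure (Q \<omega>) (dominating_points \<omega> \<inter> {0<..t} \<times> UNIV) =
    (SUP n. accepted (Q \<omega>) (path_of (picard hp n) \<omega>) {0<..t})"
proof -
  interpret hawkes_path "N0 \<omega>" "Q \<omega>" by (rule path[OF \<omega>])
  let ?B = "\<lambda>n. {x. fst x \<in> {0<..t} \<and> ennreal (snd x) \<le> picard hp n (fst x, \<omega>) * indicator {0<..} (fst x)} \<inter> quadrant"
  note acc = thinned_accept[OF section_D[OF picard_predictable[OF hp] \<omega>], of "{0<..t}"]
  have "(SUP n. emeasure (Q \<omega>) (?B n)) = emeasure (Q \<omega>) (\<Union>n. ?B n)"
  proof (rule SUP_emeasure_incseq)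
    show "range ?B \<subseteq> sets (Q \<omega>)" using acc(2) by auto
    show "incseq ?B"
      by (intro incseq_SucI) (auto intro: order_trans[OF _ picard_mono(2)[OF \<omega>]] simp del: picard.simps)
  qed
  also have "(\<Union>n. ?B n) = dominating_points \<omega> \<inter> {0<..t} \<times> UNIV" by (auto simp: dominating_points_def)
  finally show ?thesis using acc(1) by simp
qed

lemma dominating_mean_finite:
  assumes t: "t > 0"
  shows "(\<integral>\<^sup>+\<omega>. (SUP n. accepted (Q \<omega>) (path_of (picard hp n) \<omega>) {0<..t}) \<partial>M) < \<infinity>"
    and "(\<lambda>\<omega>. accepted (Q \<omega>) (path_of (picard hp n) \<omega>) {0<..t}) \<in> borel_measurable M"
proof -
  let ?c = "\<lambda>n \<omega>. accepted (Q \<omega>) (path_of (picard hp n) \<omega>) {0<..t}"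
  have pp: "picard hp n \<in> borel_measurable (predictable M D)" for n by (rule picard_predictable[OF hp])
  show m: "?c n \<in> borel_measurable M" for n by (rule accept_measurable_M[OF pp]) simp
  obtain K where K: "K < \<infinity>" "\<And>n. (\<integral>\<^sup>+\<omega>. (\<integral>\<^sup>+u\<in>{0<..}. indicator {0<..t} u * picard hp n (u, \<omega>) \<partial>lborel) \<partial>M) \<le> K"
    using picard_mean_bound[OF t] by auto
  have "(\<integral>\<^sup>+\<omega>. (SUP n. ?c n \<omega>) \<partial>M) = (SUP n. \<integral>\<^sup>+\<omega>. ?c n \<omega> \<partial>M)"
  proof (rule nn_integral_monotone_convergence_SUP_AE)
    show "AE \<omega> in M. ?c n \<omega> \<le> ?c (Suc n) \<omega>" for n
    proof (intro AE_I2 nn_integral_mono mult_left_mono)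
      fix \<omega> x assume "\<omega> \<in> space M" "x \<in> space (Q \<omega>)"
      then show "(of_bool (ennreal (snd x) \<le> picard hp n (fst x, \<omega>) * indicator {0<..} (fst x)) :: ennreal) \<le> of_bool (ennreal (snd x) \<le> picard hp (Suc n) (fst x, \<omega>) * indicator {0<..} (fst x))"
        using picard_mono(2)[of \<omega> "fst x" n] by (auto simp: space_Q simp del: picard.simps intro: order_trans)
    qed simp
  qed (rule m)
  also have "\<dots> \<le> K"
    unfolding accept_mean[OF pp greaterThanAtMost_borel] using K(2) by (intro SUP_least)
  finally show "(\<integral>\<^sup>+\<omega>. (SUP n. ?c n \<omega>) \<partial>M) < \<infinity>" using K(1) by (rule le_less_trans)
qed

text \<open>Since the means are bounded and the counts increase with \<open>n\<close>, the limiting count has finite mean on each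
\<open>(0, k]\<close>.\<close>

lemma AE_dominating_finite: "AE \<omega> in M. \<forall>t. emeasure (Q \<omega>) (dominating_points \<omega> \<inter> {0<..t} \<times> UNIV) < \<infinity>"
proof -
  let ?C = "\<lambda>t \<omega>. SUP n. accepted (Q \<omega>) (path_of (picard hp n) \<omega>) {0<..t}"
  have "AE \<omega> in M. ?C (real (Suc k)) \<omega> \<noteq> \<infinity>" for k
  proof (rule nn_integral_PInf_AE)
    show "?C (real (Suc k)) \<in> borel_measurable M"
      by (rule borel_measurable_SUP, simp, rule dominating_mean_finite(2), simp)
    show "(\<integral>\<^sup>+\<omega>. ?C (real (Suc k)) \<omega> \<partial>M) \<noteq> \<infinity>"
      using dominating_mean_finite(1)[of "real (Suc k)"] by (simp del: of_nat_Suc)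
  qed
  then have "AE \<omega> in M. \<forall>k. ?C (real (Suc k)) \<omega> \<noteq> \<infinity>" by (simp add: AE_all_countable)
  then show ?thesis using AE_space
  proof eventually_elim
    case (elim \<omega>)
    show ?case
    proof
      fix t
      obtain k :: nat where k: "t \<le> real k" using real_arch_simple by blast
      note S = dominating_points_sets[OF elim(2)]
      interpret hawkes_path "N0 \<omega>" "Q \<omega>" by (rule path[OF elim(2)])
      have T: "{0<..real (Suc k)} \<times> {0<..} \<in> sets (Q \<omega>)"
        by (intro sets_QI elim borel_Times) auto
      have e: "dominating_points \<omega> \<inter> {0<..real (Suc k)} \<times> UNIV = dominating_points \<omega> \<inter> {0<..real (Suc k)} \<times> {0<..}"
        by (auto simp: dominating_points_def)
      have "emeasure (Q \<omega>) (dominating_points \<omega> \<inter> {0<..t} \<times> UNIV) \<le> emeasure (Q \<omega>) (dominating_points \<omega> \<inter> {0<..real (Suc k)} \<times> UNIV)"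
        unfolding e using S T k by (intro emeasure_mono sets.Int) (auto simp: dominating_points_def)
      also have "\<dots> < \<infinity>" unfolding dominating_count[OF elim(2)] using elim(1) by (simp add: less_top[symmetric])
      finally show "emeasure (Q \<omega>) (dominating_points \<omega> \<inter> {0<..t} \<times> UNIV) < \<infinity>" .
    qed
  qed
qed

end

section \<open>The solution and its conditional intensity\<close>

lemma hawkes_intensity_positive_lags:
  assumes "\<And>t. t > 0 \<Longrightarrow> h t = h' t"
  shows "hawkes_intensity lam h = hawkes_intensity lam h'"
proof (intro ext)
  fix \<mu> u
  have "(\<integral>\<^sup>+s\<in>{..<u}. ennreal (f (h (u - s))) \<partial>\<mu>) = (\<integral>\<^sup>+s\<in>{..<u}. ennreal (f (h' (u - s))) \<partial>\<mu>)" for f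
    using assms by (intro nn_integral_cong) (auto simp: indicator_def)
  from this[of "\<lambda>x. x"] this[of uminus]
  show "hawkes_intensity lam h \<mu> u = hawkes_intensity lam h' \<mu> u"
    by (simp add: hawkes_intensity_def signed_integral_def)
qed

context driven_space begin

lemma solution_path:
  assumes "solution M F Q lam k N0 N"
  shows "AE \<omega> in M. hawkes_path.path_solution (N0 \<omega>) (Q \<omega>) lam k (N \<omega>)"
proof -
  have N: "N \<in> measurable M (counting_borel UNIV)" and "AE \<omega> in M. \<forall>A\<in>sets borel. emeasure (N \<omega>) A = thinned (N0 \<omega>) (Q \<omega>) (hawkes_intensity lam k (N \<omega>)) A"
    using assms unfolding solution_def thinned_def by auto
  from this(2) AE_space show ?thesis
  proof eventually_elim
    case (elim \<omega>)
    then show ?case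
      using measurable_space[OF N] by (simp add: hawkes_path.path_solution_def[OF path[OF elim(2)]] space_counting_borel)
  qed
qed

lemma solution_pathwise_unique:
  assumes k: "k \<in> borel_measurable borel"
  shows "pathwise_unique M F Q lam k N0"
  unfolding pathwise_unique_def
proof (intro allI impI)
  fix N N' assume "solution M F Q lam k N0 N" "solution M F Q lam k N0 N'"
  from solution_path[OF this(1)] solution_path[OF this(2)] AE_space show "AE \<omega> in M. N \<omega> = N' \<omega>"
  proof eventually_elim
    case (elim \<omega>)
    show ?case by (rule hawkes_path.path_unique[OF path[OF elim(3)] elim(1,2) k])
  qed
qed

lemma solution_domination:
  assumes k: "k \<in> borel_measurable borel" and "0 \<le> lam"
    and "solution M F Q lam k N0 N" "solution M F Q lam (\<lambda>t. max (k t) 0) N0 N'"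
  shows "AE \<omega> in M. \<forall>A\<in>sets borel. emeasure (N \<omega>) A \<le> emeasure (N' \<omega>) A"
  using solution_path[OF assms(3)] solution_path[OF assms(4)] AE_space
proof eventually_elim
  case (elim \<omega>)
  show ?case using hawkes_path.path_domination[OF path[OF elim(3)] elim(1,2) k assms(2)] by blast
qed

end

context hawkes_driven begin

definition good :: "'w set" where
  "good = {\<omega>\<in>space M. \<forall>t. emeasure (Q \<omega>) (dominating_points \<omega> \<inter> {0<..t} \<times> UNIV) < \<infinity>}"

lemma good_sets: "good \<in> sets (D t)"
proof -
  obtain Z where Z: "Z \<in> null_sets M" "{\<omega> \<in> space M. \<not> (\<forall>t. emeasure (Q \<omega>) (dominating_points \<omega> \<inter> {0<..t} \<times> UNIV) < \<infinity>)} \<subseteq> Z"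
    using AE_dominating_finite unfolding eventually_ae_filter by blast
  have "space M - good \<in> null_sets M"
    by (rule complete2[OF _ Z(1)]) (use Z(2) in \<open>auto simp: good_def\<close>)
  then have "space (D t) - (space M - good) \<in> sets (D t)" using null_sets_D by blast
  moreover have "space (D t) - (space M - good) = good" by (auto simp: space_D good_def)
  ultimately show ?thesis by simp
qed

lemma AE_good: "AE \<omega> in M. \<omega> \<in> good"
  using AE_dominating_finite AE_space by eventually_elim (simp add: good_def)

text \<open>Outside \<open>good\<close> the intensity is set to \<open>0\<close>, so that the process constructed from it is boundedly finite on
all paths. As the complement of \<open>good\<close> is a null set, this does not affect predictability.\<close>

definition intensity :: "real \<times> 'w \<Rightarrow> ennreal" where
  "intensity z = liminf (\<lambda>n. picard h n z) * indicator good (snd z)"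

lemma intensity_predictable: "intensity \<in> borel_measurable (predictable M D)"
proof -
  have p: "picard h n \<in> borel_measurable (predictable M D)" for n by (rule picard_predictable[OF h])
  have g: "(indicator good :: _ \<Rightarrow> ennreal) \<in> borel_measurable (D 0)" using good_sets by simp
  note [measurable] = p data.predictable_step[OF order.refl g]
  have "(\<lambda>z. liminf (\<lambda>n. picard h n z) * (indicator good (snd z) * indicator {0<..} (fst z))) \<in> borel_measurable (predictable M D)"
    by measurable
  moreover have "intensity z = liminf (\<lambda>n. picard h n z) * (indicator good (snd z) * indicator {0<..} (fst z))"
    if "z \<in> space (predictable M D)" for z using that by (auto simp: intensity_def data.space_predictable)
  ultimately show ?thesis by (subst measurable_cong)
qed

abbreviation path_intensity :: "'w \<Rightarrow> real \<Rightarrow> ennreal" where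
  "path_intensity \<equiv> path_of intensity"

lemma path_intensity_measurable: "\<omega> \<in> space M \<Longrightarrow> path_intensity \<omega> \<in> borel_measurable borel"
  by (rule section_D[OF intensity_predictable])

lemma path_intensity_good:
  assumes g: "\<omega> \<in> good" and u: "u > 0"
  shows "next_intensity (N0 \<omega>) (Q \<omega>) lam h (path_intensity \<omega>) u = path_intensity \<omega> u"
    "\<exists>m. path_intensity \<omega> u = picard h m (u, \<omega>)"
proof -
  have \<omega>: "\<omega> \<in> space M" using g by (simp add: good_def)
  interpret hawkes_path "N0 \<omega>" "Q \<omega>" by (rule path[OF \<omega>])
  let ?L = "\<lambda>n u. picard h n (u, \<omega>) * indicator {0<..} u"
  have e: "path_intensity \<omega> = (\<lambda>u. liminf (\<lambda>n. ?L n u))"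
    using g by (auto simp: intensity_def fun_eq_iff indicator_def Liminf_const)
  have rec: "\<And>n u. u > 0 \<Longrightarrow> ?L (Suc n) u = next_intensity (N0 \<omega>) (Q \<omega>) lam h (?L n) u" by simp
  have S: "x \<in> dominating_points \<omega>" if "x \<in> quadrant" "ennreal (snd x) \<le> ?L n (fst x)" for n x
  proof -
    have "ennreal (snd x) \<le> picard h n (fst x, \<omega>)" "fst x > 0" using that by auto
    then have "ennreal (snd x) \<le> picard hp n (fst x, \<omega>)" using picard_mono(1)[OF \<omega>, of "fst x" n] by (meson order_trans)
    then show ?thesis using that(1) unfolding dominating_points_def by blast
  qed
  have fin: "\<And>t. emeasure (Q \<omega>) (dominating_points \<omega> \<inter> {0<..t} \<times> UNIV) < \<infinity>" using g by (simp add: good_def)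
  have "next_intensity (N0 \<omega>) (Q \<omega>) lam h (\<lambda>u. liminf (\<lambda>n. ?L n u)) u = liminf (\<lambda>n. ?L n u)"
    by (rule picard_limit(1)[where S="dominating_points \<omega>" and L="?L"])
      (use rec in blast, rule dominating_points_sets[OF \<omega>], use S in blast, rule fin, rule u)
  then show "next_intensity (N0 \<omega>) (Q \<omega>) lam h (path_intensity \<omega>) u = path_intensity \<omega> u"
    unfolding e using fun_cong[OF e, of u] by simp
  have "\<exists>m. liminf (\<lambda>n. ?L n u) = ?L m u"
    by (rule picard_limit(2)[where S="dominating_points \<omega>" and L="?L" and lam=lam and h=h])
      (use rec in blast, rule dominating_points_sets[OF \<omega>], use S in blast, rule fin, rule u)
  then show "\<exists>m. path_intensity \<omega> u = picard h m (u, \<omega>)" using u fun_cong[OF e, of u] by simp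
qed

lemma accepted_subset_dominating:
  assumes \<omega>: "\<omega> \<in> space M"
  shows "(accepted (Q \<omega>) (path_intensity \<omega>) {0<..t}) \<le>
    emeasure (Q \<omega>) (dominating_points \<omega> \<inter> {0<..t} \<times> UNIV)"
proof -
  interpret hawkes_path "N0 \<omega>" "Q \<omega>" by (rule path[OF \<omega>])
  have T: "{0<..t} \<times> {0<..} \<in> sets (Q \<omega>)" by (intro sets_QI \<omega> borel_Times) auto
  have eT: "dominating_points \<omega> \<inter> {0<..t} \<times> UNIV = dominating_points \<omega> \<inter> {0<..t} \<times> {0<..}"
    by (auto simp: dominating_points_def)
  have s: "dominating_points \<omega> \<inter> {0<..t} \<times> UNIV \<in> sets (Q \<omega>)"
    unfolding eT using dominating_points_sets[OF \<omega>] T by (rule sets.Int)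
  have "(accepted (Q \<omega>) (path_intensity \<omega>) {0<..t}) \<le>
    (\<integral>\<^sup>+x. indicator (dominating_points \<omega> \<inter> {0<..t} \<times> UNIV) x \<partial>Q \<omega>)"
  proof (rule nn_integral_mono)
    fix x assume "x \<in> space (Q \<omega>)"
    then have x: "x \<in> quadrant" by (simp add: space_q)
    show "(indicator {0<..t} (fst x) * of_bool (ennreal (snd x) \<le> path_intensity \<omega> (fst x)) :: ennreal) \<le>
      indicator (dominating_points \<omega> \<inter> {0<..t} \<times> UNIV) x"
    proof (cases "fst x \<in> {0<..t} \<and> ennreal (snd x) \<le> path_intensity \<omega> (fst x)")
      case True
      have g: "\<omega> \<in> good"
      proof (rule ccontr)
        assume "\<omega> \<notin> good"
        then have "ennreal (snd x) \<le> 0" using True by (simp add: intensity_def)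
        then show False using x by (auto simp: ennreal_eq_0_iff)
      qed
      obtain m where "path_intensity \<omega> (fst x) = picard h m (fst x, \<omega>)" using path_intensity_good(2)[OF g, of "fst x"] x by auto
      also have "\<dots> \<le> picard hp m (fst x, \<omega>)" using picard_mono(1)[OF \<omega>] x by auto
      finally have "ennreal (snd x) \<le> picard hp m (fst x, \<omega>)" using True by (meson order_trans)
      then have "x \<in> dominating_points \<omega>" using x unfolding dominating_points_def by blast
      then show ?thesis using True by (cases x) (auto simp: indicator_def)
    qed (auto simp: indicator_def)
  qed
  then show ?thesis using s by simp
qed

lemma accepted_finite:
  assumes \<omega>: "\<omega> \<in> space M"
  shows "(accepted (Q \<omega>) (path_intensity \<omega>) {0<..t}) < \<infinity>"
proof (cases "\<omega> \<in> good")
  case True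
  then show ?thesis using accepted_subset_dominating[OF \<omega>, of t] by (auto simp: good_def intro: le_less_trans)
next
  case False
  have "(accepted (Q \<omega>) (path_intensity \<omega>) {0<..t}) = (\<integral>\<^sup>+x. 0 \<partial>Q \<omega>)"
    using False by (intro nn_integral_cong) (auto simp: intensity_def space_Q[OF \<omega>] ennreal_eq_0_iff)
  then show ?thesis by simp
qed

definition hawkes :: "'w \<Rightarrow> real measure" where
  "hawkes \<omega> = measure_of UNIV (sets borel) (thinned (N0 \<omega>) (Q \<omega>) (path_intensity \<omega>))"

lemma hawkes_emeasure:
  assumes "\<omega> \<in> space M" "A \<in> sets borel"
  shows "emeasure (hawkes \<omega>) A = emeasure (N0 \<omega>) (A \<inter> {..0}) +
    (accepted (Q \<omega>) (path_intensity \<omega>) A)"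
  unfolding hawkes_def hawkes_path.thinned_measure(2)[OF path[OF assms(1)] path_intensity_measurable[OF assms(1)] assms(2)]
  by (rule hawkes_path.thinned_eq[OF path[OF assms(1)]])

lemma hawkes_counting: "\<omega> \<in> space M \<Longrightarrow> hawkes \<omega> \<in> counting_measures UNIV"
  unfolding hawkes_def by (intro hawkes_path.thinned_counting path path_intensity_measurable accepted_finite)

lemma hawkes_good:
  assumes g: "\<omega> \<in> good"
  shows "hawkes_path.path_solution (N0 \<omega>) (Q \<omega>) lam h (hawkes \<omega>)"
    "u > 0 \<Longrightarrow> hawkes_intensity lam h (hawkes \<omega>) u = intensity (u, \<omega>)"
proof -
  have \<omega>: "\<omega> \<in> space M" using g by (simp add: good_def)
  note P = hawkes_path.path_solution_of_fixpoint[OF path[OF \<omega>] path_intensity_measurable[OF \<omega>] h path_intensity_good(1)[OF g] accepted_finite[OF \<omega>], folded hawkes_def]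
  show "hawkes_path.path_solution (N0 \<omega>) (Q \<omega>) lam h (hawkes \<omega>)" by (rule P(1))
  show "hawkes_intensity lam h (hawkes \<omega>) u = intensity (u, \<omega>)" if "u > 0" using P(2)[OF _ that] that by simp
qed

lemma hawkes_measurable: "hawkes \<in> measurable M (counting_borel UNIV)"
proof (rule measurable_counting_borelI[OF hawkes_counting])
  fix A :: "real set" assume A: "A \<in> sets borel"
  have "(\<lambda>\<omega>. emeasure (N0 \<omega>) (A \<inter> {..0})) \<in> borel_measurable M"
    by (rule measurable_from_subalg[OF _ N0_emeasure_measurable_data[OF A, of 0]]) (use D_sub_M[of 0] space_D in \<open>auto simp: subalgebra_def\<close>)
  moreover note accept_measurable_M[OF intensity_predictable A]
  ultimately show "(\<lambda>\<omega>. emeasure (hawkes \<omega>) A) \<in> borel_measurable M"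
    by (subst measurable_cong[OF hawkes_emeasure[OF _ A]]) simp_all
qed

lemma hawkes_adapted_data: "adapted_on_pos D hawkes"
  unfolding adapted_on_pos_def
proof (intro allI impI ballI)
  fix t :: real and A :: "real set" assume t: "t \<ge> 0" and A: "A \<in> sets borel" "A \<subseteq> {0<..t}"
  have "emeasure (hawkes \<omega>) A = (accepted (Q \<omega>) (path_intensity \<omega>) A)"
    if "\<omega> \<in> space (D t)" for \<omega>
  proof -
    have "A \<inter> {..0} = {}" using A(2) by auto
    then show ?thesis using hawkes_emeasure[OF _ A(1), of \<omega>] that by (simp add: space_D)
  qed
  with accept_adapted[OF intensity_predictable A t]
  show "(\<lambda>\<omega>. emeasure (hawkes \<omega>) A) \<in> borel_measurable (D t)" by (subst measurable_cong) simp_all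
qed

text \<open>The intensity is predictable for the data filtration, so the accepted points are adapted to it. On
\<open>good\<close> paths the intensity is a fixed point, which is the equation.\<close>

lemma hawkes_strong_solution: "strong_solution M F Q lam h N0 hawkes"
  unfolding strong_solution_def solution_def
proof (intro conjI hawkes_measurable hawkes_adapted_data)
  have "(f :: 'w \<Rightarrow> ennreal) \<in> borel_measurable (F t)" if "f \<in> borel_measurable (D t)" "t \<ge> 0" for f t
    by (rule measurable_from_subalg[OF _ that(1)]) (use D_sub_F[OF that(2)] space_F[OF that(2)] space_D in \<open>auto simp: subalgebra_def\<close>)
  then show "adapted_on_pos F hawkes" using hawkes_adapted_data unfolding adapted_on_pos_def by blast
  show "AE \<omega> in M. \<forall>A\<in>sets borel. emeasure (hawkes \<omega>) A = emeasure (N0 \<omega>) (A \<inter> {..0}) +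
       (\<integral>\<^sup>+(u, \<theta>). indicator A u * of_bool (ennreal \<theta> \<le> hawkes_intensity lam h (hawkes \<omega>) u) \<partial>Q \<omega>)"
    using AE_good AE_space
  proof eventually_elim
    case (elim \<omega>)
    show ?case using hawkes_good(1)[OF elim(1)]
      unfolding hawkes_path.path_solution_def[OF path[OF elim(2)]] thinned_def by blast
  qed
qed

lemma cumulative_mean_finite:
  assumes t: "t > 0"
  shows "(\<integral>\<^sup>+\<omega>. (\<integral>\<^sup>+u\<in>{0<..}. indicator {0<..t} u * intensity (u, \<omega>) \<partial>lborel) \<partial>M) < \<infinity>"
proof -
  have "(\<integral>\<^sup>+\<omega>. (\<integral>\<^sup>+u\<in>{0<..}. indicator {0<..t} u * intensity (u, \<omega>) \<partial>lborel) \<partial>M) =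
    (\<integral>\<^sup>+\<omega>. (accepted (Q \<omega>) (path_intensity \<omega>) {0<..t}) \<partial>M)"
    by (rule accept_mean[OF intensity_predictable, symmetric]) simp
  also have "\<dots> \<le> (\<integral>\<^sup>+\<omega>. emeasure (Q \<omega>) (dominating_points \<omega> \<inter> {0<..t} \<times> UNIV) \<partial>M)"
    by (rule nn_integral_mono[OF accepted_subset_dominating])
  also have "\<dots> = (\<integral>\<^sup>+\<omega>. (SUP n. accepted (Q \<omega>) (path_of (picard hp n) \<omega>) {0<..t}) \<partial>M)"
    by (rule nn_integral_cong[OF dominating_count])
  also have "\<dots> < \<infinity>" by (rule dominating_mean_finite(1)[OF t])
  finally show ?thesis .
qed

lemma cumulative_adapted:
  assumes t: "0 \<le> t"
  shows "(\<lambda>\<omega>. \<integral>\<^sup>+u. intensity (u, \<omega>) * indicator {0<..t} u \<partial>lborel) \<in> borel_measurable (F t)"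
proof -
  have "(\<lambda>(\<omega>, u). intensity (u, \<omega>) * indicator {0<..t} u) \<in> borel_measurable (F t \<Otimes>\<^sub>M borel)"
  proof (rule past.predictable_adapted[OF predictable_D_F[OF intensity_predictable] space_F[OF t]])
    fix a A assume "0 \<le> a" "A \<in> sets (F a)" "{0<..t} \<inter> {a<..} \<noteq> {}"
    then show "A \<in> sets (F t)" using F_mono[of a t] by auto
  qed auto
  then have "(\<lambda>(\<omega>, u). intensity (u, \<omega>) * indicator {0<..t} u) \<in> borel_measurable (F t \<Otimes>\<^sub>M lborel)"
    by (subst measurable_cong_sets[OF sets_pair_measure_cong[OF refl sets_lborel] refl])
  then show ?thesis by (rule lborel.borel_measurable_nn_integral)
qed

text \<open>Lebesgue measure does not charge the endpoint \<open>t\<close>.\<close>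

lemma cumulative_left_continuous:
  fixes k :: "real \<Rightarrow> ennreal"
  assumes k[measurable]: "k \<in> borel_measurable borel"
  shows "(\<integral>\<^sup>+u. k u * indicator {0<..t} u \<partial>lborel) \<le> (SUP n. \<integral>\<^sup>+u. k u * indicator {0<..t - 1 / real (Suc n)} u \<partial>lborel)"
proof -
  have "(\<integral>\<^sup>+u. k u * indicator {0<..t} u \<partial>lborel) = (\<integral>\<^sup>+u. k u * indicator {0<..<t} u \<partial>lborel)"
    by (rule nn_integral_cong_AE) (use AE_lborel_singleton[of t] in \<open>eventually_elim, auto simp: indicator_def\<close>)
  also have "\<dots> \<le> (\<integral>\<^sup>+u. (SUP n. k u * indicator {0<..t - 1 / real (Suc n)} u) \<partial>lborel)"
  proof (rule nn_integral_mono)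
    fix u
    show "k u * indicator {0<..<t} u \<le> (SUP n. k u * indicator {0<..t - 1 / real (Suc n)} u)"
    proof (cases "u \<in> {0<..<t}")
      case True
      then have "\<exists>n. 1 / real (Suc n) < t - u" using reals_Archimedean[of "t - u"] by (auto simp: inverse_eq_divide)
      then obtain n where "1 / real (Suc n) < t - u" by blast
      then have "u \<in> {0<..t - 1 / real (Suc n)}" using True by auto
      then show ?thesis using True by (intro SUP_upper2[of n]) auto
    qed simp
  qed
  also have "\<dots> = (SUP n. \<integral>\<^sup>+u. k u * indicator {0<..t - 1 / real (Suc n)} u \<partial>lborel)"
  proof (rule nn_integral_monotone_convergence_SUP)
    show "incseq (\<lambda>n u. k u * indicator {0<..t - 1 / real (Suc n)} u)"
    proof (intro monoI le_funI mult_left_mono)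
      fix m n :: nat and u assume "m \<le> n"
      then have "1 / real (Suc n) \<le> 1 / real (Suc m)" by (simp add: frac_le)
      then show "(indicator {0<..t - 1 / real (Suc m)} u :: ennreal) \<le> indicator {0<..t - 1 / real (Suc n)} u"
        by (auto simp: indicator_def simp del: of_nat_Suc)
    qed simp
  qed measurable
  finally show ?thesis .
qed

lemma solution_eq_hawkes:
  assumes "solution M F Q lam h N0 N"
  shows "AE \<omega> in M. \<omega> \<in> good \<and> N \<omega> = hawkes \<omega>"
proof -
  have "solution M F Q lam h N0 hawkes" using hawkes_strong_solution by (simp add: strong_solution_def)
  then have "AE \<omega> in M. N \<omega> = hawkes \<omega>"
    using solution_pathwise_unique[OF h] assms unfolding pathwise_unique_def by blast
  then show ?thesis using AE_good by eventually_elim simp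
qed

text \<open>By uniqueness \<open>N\<close> agrees almost surely with the process \<open>hawkes\<close>, so the integral identities can be
verified for the latter, where they are the compensation formula. Predictability of the cumulative
intensity must hold on every path, not only almost surely. It follows for \<open>N\<close> because at each fixed time
the cumulative intensity is adapted as a modification, and it is increasing and left-continuous on every path.\<close>

lemma solution_hawkes_process:
  assumes sol: "solution M F Q lam h N0 N"
  shows "hawkes_process M F lam h N0 N"
  unfolding hawkes_process_def conditional_intensity_measure_def
proof (intro conjI ballI allI impI)
  have N: "N \<in> measurable M (counting_borel UNIV)" using sol by (simp add: solution_def)
  then show "N \<in> measurable M (counting_borel UNIV)" .
  show "adapted_on_pos F N" using sol by (simp add: solution_def)
  have Nc: "N \<omega> \<in> counting_measures UNIV" if "\<omega> \<in> space M" for \<omega>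
    using measurable_space[OF N that] by (simp add: space_counting_borel)
  have Ns: "sets (N \<omega>) = sets borel" "space (N \<omega>) = UNIV" if "\<omega> \<in> space M" for \<omega>
    using counting_measuresD(1,2)[OF Nc[OF that]] by simp_all
  note Nint = hawkes_intensity_measurable[OF Nc h]
  note eq = solution_eq_hawkes[OF sol]
  let ?\<nu> = "\<lambda>\<omega>. density (restrict_space lborel {0<..}) (hawkes_intensity lam h (N \<omega>))"
  let ?X = "\<lambda>t \<omega>. \<integral>\<^sup>+u. hawkes_intensity lam h (N \<omega>) u * indicator {0<..t} u \<partial>lborel"
  let ?Y = "\<lambda>t \<omega>. \<integral>\<^sup>+u. intensity (u, \<omega>) * indicator {0<..t} u \<partial>lborel"
  have rm: "f \<in> borel_measurable (restrict_space lborel {0<..})" if "f \<in> borel_measurable borel" for f :: "real \<Rightarrow> ennreal"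
    using that by (intro measurable_restrict_space1) simp
  have \<nu>X: "emeasure (?\<nu> \<omega>) {0<..t} = ?X t \<omega>" if \<omega>: "\<omega> \<in> space M" for t \<omega>
  proof -
    have "{0<..t} \<in> sets (restrict_space lborel {0<..})" by (auto simp: sets_restrict_space_iff)
    then have "emeasure (?\<nu> \<omega>) {0<..t} = (\<integral>\<^sup>+u. hawkes_intensity lam h (N \<omega>) u * indicator {0<..t} u \<partial>restrict_space lborel {0<..})"
      by (rule emeasure_density[OF rm[OF Nint[OF \<omega>]]])
    also have "\<dots> = (\<integral>\<^sup>+u. hawkes_intensity lam h (N \<omega>) u * indicator {0<..t} u * indicator {0<..} u \<partial>lborel)"
      by (rule nn_integral_restrict_space) simp
    also have "\<dots> = ?X t \<omega>" by (intro nn_integral_cong) (auto simp: indicator_def)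
    finally show ?thesis .
  qed
  have XY: "AE \<omega> in M. \<forall>t. ?X t \<omega> = ?Y t \<omega>"
    using eq by eventually_elim (auto intro!: nn_integral_cong simp: indicator_def hawkes_good(2))
  show "AE \<omega> in M. restrict_space (N \<omega>) {..0} = N0 \<omega>"
    using eq AE_space
  proof eventually_elim
    case (elim \<omega>)
    note \<omega> = elim(2)
    show ?case
    proof (rule measure_eqI)
      show s: "sets (restrict_space (N \<omega>) {..0}) = sets (N0 \<omega>)"
        unfolding sets_N0[OF \<omega>] by (rule sets_restrict_space_cong[OF Ns(1)[OF \<omega>]])
      fix A assume "A \<in> sets (restrict_space (N \<omega>) {..0})"
      then have A: "A \<in> sets borel" "A \<subseteq> {..0}" unfolding s sets_N0[OF \<omega>] by (simp_all add: sets_restrict_borel)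
      have "emeasure (restrict_space (N \<omega>) {..0}) A = emeasure (hawkes \<omega>) A"
        using A elim Ns[OF \<omega>] by (subst emeasure_restrict_space) auto
      also have "\<dots> = emeasure (N0 \<omega>) A + (accepted (Q \<omega>) (path_intensity \<omega>) A)"
        using hawkes_emeasure[OF \<omega> A(1)] A(2) by (simp add: Int_absorb2)
      also have "(accepted (Q \<omega>) (path_intensity \<omega>) A) = (\<integral>\<^sup>+x. 0 \<partial>Q \<omega>)"
        using A(2) by (intro nn_integral_cong) (auto simp: space_Q[OF \<omega>] indicator_def)
      finally show "emeasure (restrict_space (N \<omega>) {..0}) A = emeasure (N0 \<omega>) A" by simp
    qed
  qed
  show "sets (?\<nu> \<omega>) = sets (restrict_space borel {0<..})" for \<omega>
    unfolding sets_density by (rule sets_restrict_space_cong) simp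
  show "AE \<omega> in M. \<forall>t>0. emeasure (?\<nu> \<omega>) {0<..t} < \<infinity>"
  proof -
    have YY: "(\<integral>\<^sup>+u\<in>{0<..}. indicator {0<..t} u * intensity (u, \<omega>) \<partial>lborel) = ?Y t \<omega>" for t \<omega>
      by (intro nn_integral_cong) (auto simp: indicator_def)
    have "AE \<omega> in M. ?Y (real (Suc n)) \<omega> \<noteq> \<infinity>" for n
    proof (rule nn_integral_PInf_AE)
      show "?Y (real (Suc n)) \<in> borel_measurable M"
        by (rule measurable_from_subalg[OF subalgebra_F cumulative_adapted]) simp_all
      show "(\<integral>\<^sup>+\<omega>. ?Y (real (Suc n)) \<omega> \<partial>M) \<noteq> \<infinity>"
        using cumulative_mean_finite[of "real (Suc n)"] unfolding YY by (simp del: of_nat_Suc)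
    qed
    then have "AE \<omega> in M. \<forall>n. ?Y (real (Suc n)) \<omega> \<noteq> \<infinity>" by (simp add: AE_all_countable)
    then show ?thesis using XY AE_space
    proof eventually_elim
      case (elim \<omega>)
      show ?case
      proof (intro allI impI)
        fix t :: real
        obtain n :: nat where n: "t \<le> real n" using real_arch_simple by blast
        have "?Y t \<omega> \<le> ?Y (real (Suc n)) \<omega>" using n by (intro nn_integral_mono mult_left_mono) (auto simp: indicator_def)
        also have "\<dots> < \<infinity>" using elim(1) by (simp add: less_top[symmetric] del: of_nat_Suc)
        finally show "emeasure (?\<nu> \<omega>) {0<..t} < \<infinity>" using elim by (simp add: \<nu>X)
      qed
    qed
  qed
  show "(\<lambda>(t, \<omega>). emeasure (?\<nu> \<omega>) {0<..t}) \<in> borel_measurable (predictable M F)"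
  proof -
    have "(\<lambda>z. ?X (fst z) (snd z)) \<in> borel_measurable (predictable M F)"
    proof (rule past.predictable_monotone_left_continuous)
      show "?X q \<in> borel_measurable (F q)" if "0 \<le> q" for q
        by (rule modification_measurable[OF cumulative_adapted[OF that] that]) (use XY in eventually_elim, blast)
      show "?X s \<omega> \<le> ?X t \<omega>" if "s \<le> t" for s t \<omega>
        using that by (intro nn_integral_mono mult_left_mono) (auto simp: indicator_def)
      show "?X t \<omega> \<le> (SUP n. ?X (t - 1 / real (Suc n)) \<omega>)" if "\<omega> \<in> space M" for t \<omega>
        by (rule cumulative_left_continuous[OF Nint[OF that]])
    qed
    then show ?thesis
      by (subst measurable_cong[where g="\<lambda>z. ?X (fst z) (snd z)"]) (auto simp: past.space_predictable \<nu>X)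
  qed
  fix C :: "real \<times> 'w \<Rightarrow> ennreal" assume C: "C \<in> borel_measurable (predictable M F)"
  have L: "AE \<omega> in M. (\<integral>\<^sup>+t. C (t, \<omega>) \<partial>restrict_space (N \<omega>) {0<..}) = (\<integral>\<^sup>+x. C (fst x, \<omega>) * of_bool (ennreal (snd x) \<le> intensity (fst x, \<omega>)) \<partial>Q \<omega>)"
    using eq AE_space
  proof eventually_elim
    case (elim \<omega>)
    note \<omega> = elim(2)
    interpret hawkes_path "N0 \<omega>" "Q \<omega>" by (rule path[OF \<omega>])
    note T = thinned_measure[OF path_intensity_measurable[OF \<omega>], folded hawkes_def]
    have "(\<integral>\<^sup>+t. C (t, \<omega>) \<partial>restrict_space (N \<omega>) {0<..}) = (\<integral>\<^sup>+t. C (t, \<omega>) * indicator {0<..} t \<partial>hawkes \<omega>)"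
      using elim Ns[OF \<omega>] by (subst nn_integral_restrict_space) auto
    also have "\<dots> = (\<integral>\<^sup>+t. C (t, \<omega>) * indicator {0<..} t \<partial>N0 \<omega>) +
        (\<integral>\<^sup>+x. C (fst x, \<omega>) * indicator {0<..} (fst x) * of_bool (ennreal (snd x) \<le> path_intensity \<omega> (fst x)) \<partial>Q \<omega>)"
      by (rule nn_integral_thinned[OF path_intensity_measurable[OF \<omega>] T(1) _ past.predictable_section[OF C \<omega>]]) (use T(2) in blast)
    also have "(\<integral>\<^sup>+t. C (t, \<omega>) * indicator {0<..} t \<partial>N0 \<omega>) = (\<integral>\<^sup>+t. 0 \<partial>N0 \<omega>)"
      by (rule nn_integral_cong) (auto simp: space_n0)
    also have "(\<integral>\<^sup>+x. C (fst x, \<omega>) * indicator {0<..} (fst x) * of_bool (ennreal (snd x) \<le> path_intensity \<omega> (fst x)) \<partial>Q \<omega>) =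
      (\<integral>\<^sup>+x. C (fst x, \<omega>) * of_bool (ennreal (snd x) \<le> intensity (fst x, \<omega>)) \<partial>Q \<omega>)"
      by (rule nn_integral_cong) (auto simp: space_q)
    finally show ?case by simp
  qed
  have R: "AE \<omega> in M. (\<integral>\<^sup>+t. C (t, \<omega>) \<partial>?\<nu> \<omega>) = (\<integral>\<^sup>+u\<in>{0<..}. C (u, \<omega>) * intensity (u, \<omega>) \<partial>lborel)"
    using eq AE_space
  proof eventually_elim
    case (elim \<omega>)
    note \<omega> = elim(2)
    have "(\<lambda>t. C (t, \<omega>)) \<in> borel_measurable (restrict_space lborel {0<..})"
      using past.predictable_section[OF C \<omega>] by (subst borel_measurable_restrict_space_iff_ennreal) auto
    then have "(\<integral>\<^sup>+t. C (t, \<omega>) \<partial>?\<nu> \<omega>) = (\<integral>\<^sup>+t. hawkes_intensity lam h (N \<omega>) t * C (t, \<omega>) \<partial>restrict_space lborel {0<..})"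
      by (rule nn_integral_density[OF rm[OF Nint[OF \<omega>]]])
    also have "\<dots> = (\<integral>\<^sup>+t. hawkes_intensity lam h (N \<omega>) t * C (t, \<omega>) * indicator {0<..} t \<partial>lborel)"
      by (rule nn_integral_restrict_space) simp
    also have "\<dots> = (\<integral>\<^sup>+u\<in>{0<..}. C (u, \<omega>) * intensity (u, \<omega>) \<partial>lborel)"
      using elim by (intro nn_integral_cong) (auto simp: hawkes_good(2) indicator_def mult.commute)
    finally show ?case .
  qed
  show "(\<integral>\<^sup>+\<omega>. (\<integral>\<^sup>+t. C (t, \<omega>) \<partial>restrict_space (N \<omega>) {0<..}) \<partial>M) = (\<integral>\<^sup>+\<omega>. (\<integral>\<^sup>+t. C (t, \<omega>) \<partial>?\<nu> \<omega>) \<partial>M)"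
    unfolding nn_integral_cong_AE[OF L] nn_integral_cong_AE[OF R]
    by (rule thinning_compensator[OF C predictable_D_F[OF intensity_predictable]])
qed

end

theorem proposition2p1:
  fixes M :: "'w measure" and F :: "real \<Rightarrow> 'w measure"
    and Q :: "'w \<Rightarrow> (real \<times> real) measure"
    and h :: "real \<Rightarrow> real" and lam :: real
    and N0 :: "'w \<Rightarrow> real measure" and \<mm> :: "real measure measure"
  defines "hp \<equiv> \<lambda>t. max (h t) 0"
  assumes "usual_filtered_prob_space M F"
    and "poisson_point_process M F Q"
    and "h \<in> borel_measurable (restrict_space borel {0<..})"
    and "lam > 0"
    and "N0 \<in> measurable (F 0) (counting_borel {..0})"
    and "distr M (counting_borel {..0}) N0 = \<mm>"
    and "(\<integral>\<^sup>+t\<in>{0<..}. ennreal (hp t) \<partial>lborel) < 1"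
    and "\<forall>t>0. (\<integral>\<^sup>+u\<in>{0<..t}. (\<integral>\<^sup>+\<omega>. (\<integral>\<^sup>+s. ennreal (hp (u - s)) \<partial>N0 \<omega>) \<partial>M) \<partial>lborel) < \<infinity>"
  shows "((\<exists>N. strong_solution M F Q lam h N0 N) \<and> pathwise_unique M F Q lam h N0 \<and>
          (\<forall>N. solution M F Q lam h N0 N \<longrightarrow> hawkes_process M F lam h N0 N)) \<and>
         ((\<exists>N. strong_solution M F Q lam hp N0 N) \<and> pathwise_unique M F Q lam hp N0 \<and>
          (\<forall>N. solution M F Q lam hp N0 N \<longrightarrow> hawkes_process M F lam hp N0 N)) \<and>
         (\<forall>N Np. solution M F Q lam h N0 N \<longrightarrow> solution M F Q lam hp N0 Np \<longrightarrow>
            (AE \<omega> in M. \<forall>A\<in>sets borel. emeasure (N \<omega>) A \<le> emeasure (Np \<omega>) A))"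
proof -
  \<comment> \<open>Extending \<open>h\<close> by zero makes it Borel measurable on the line and changes no intensity, as lags are positive.\<close>
  define k where "k = (\<lambda>t. h t * indicator {0<..} t)"
  have k: "k \<in> borel_measurable borel"
    unfolding k_def using assms(4) by (subst (asm) borel_measurable_restrict_space_iff) (simp_all add: mult.commute)
  let ?kp = "\<lambda>t. max (k t) 0"
  have ih: "hawkes_intensity lam h = hawkes_intensity lam k" and ihp: "hawkes_intensity lam hp = hawkes_intensity lam ?kp"
    by (rule hawkes_intensity_positive_lags, simp add: k_def hp_def)+
  interpret usual_filtered_prob_space M F by (rule assms(2))
  interpret driven_space M F Q N0
    by unfold_locales (use assms(3,6) in auto)
  have kp: "ennreal (max (k t) 0) = ennreal (k t)" for t by (simp add: max_def ennreal_neg)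
  have "(\<integral>\<^sup>+t\<in>{0<..}. ennreal (k t) \<partial>lborel) = (\<integral>\<^sup>+t\<in>{0<..}. ennreal (hp t) \<partial>lborel)"
    by (intro nn_integral_cong) (simp add: k_def hp_def indicator_def max_def ennreal_neg)
  then have sub: "(\<integral>\<^sup>+t\<in>{0<..}. ennreal (k t) \<partial>lborel) < 1" using assms(8) by simp
  have kN0: "(\<integral>\<^sup>+s. ennreal (k (u - s)) \<partial>N0 \<omega>) = (\<integral>\<^sup>+s. ennreal (hp (u - s)) \<partial>N0 \<omega>)" if "u > 0" "\<omega> \<in> space M" for u \<omega>
    using that by (intro nn_integral_cong) (auto simp: k_def hp_def indicator_def max_def ennreal_neg space_N0)
  have "(\<integral>\<^sup>+\<omega>. (\<integral>\<^sup>+s. ennreal (k (u - s)) \<partial>N0 \<omega>) \<partial>M) = (\<integral>\<^sup>+\<omega>. (\<integral>\<^sup>+s. ennreal (hp (u - s)) \<partial>N0 \<omega>) \<partial>M)"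
    if "u > 0" for u
    by (rule nn_integral_cong[OF kN0[OF that]])
  then have "(\<integral>\<^sup>+u\<in>{0<..t}. (\<integral>\<^sup>+\<omega>. (\<integral>\<^sup>+s. ennreal (k (u - s)) \<partial>N0 \<omega>) \<partial>M) \<partial>lborel) =
    (\<integral>\<^sup>+u\<in>{0<..t}. (\<integral>\<^sup>+\<omega>. (\<integral>\<^sup>+s. ennreal (hp (u - s)) \<partial>N0 \<omega>) \<partial>M) \<partial>lborel)" for t
    by (intro nn_integral_cong) (simp add: indicator_def)
  then have init: "\<forall>t>0. (\<integral>\<^sup>+u\<in>{0<..t}. (\<integral>\<^sup>+\<omega>. (\<integral>\<^sup>+s. ennreal (k (u - s)) \<partial>N0 \<omega>) \<partial>M) \<partial>lborel) < \<infinity>"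
    using assms(9) by simp
  interpret K: hawkes_driven M F Q N0 lam k
    by unfold_locales (use k assms(5) sub init in auto)
  interpret KP: hawkes_driven M F Q N0 lam ?kp
    by unfold_locales (use K.hp assms(5) sub init in \<open>auto simp: kp\<close>)
  have sol: "solution M F Q lam h N0 = solution M F Q lam k N0" "solution M F Q lam hp N0 = solution M F Q lam ?kp N0"
    by (intro ext, simp add: solution_def ih ihp)+
  have strong: "strong_solution M F Q lam h N0 = strong_solution M F Q lam k N0"
    "strong_solution M F Q lam hp N0 = strong_solution M F Q lam ?kp N0"
    by (intro ext, simp only: strong_solution_def sol)+
  have unique: "pathwise_unique M F Q lam h N0 = pathwise_unique M F Q lam k N0"
    "pathwise_unique M F Q lam hp N0 = pathwise_unique M F Q lam ?kp N0"
    by (simp_all only: pathwise_unique_def sol)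
  have hawkes: "hawkes_process M F lam h N0 = hawkes_process M F lam k N0"
    "hawkes_process M F lam hp N0 = hawkes_process M F lam ?kp N0"
    by (intro ext, simp only: hawkes_process_def ih ihp)+
  show ?thesis unfolding strong unique hawkes sol
  proof (intro conjI allI impI exI)
    show "strong_solution M F Q lam k N0 K.hawkes" by (rule K.hawkes_strong_solution)
    show "strong_solution M F Q lam ?kp N0 KP.hawkes" by (rule KP.hawkes_strong_solution)
    show "pathwise_unique M F Q lam k N0" "pathwise_unique M F Q lam ?kp N0"
      by (rule solution_pathwise_unique[OF k], rule solution_pathwise_unique[OF K.hp])
    show "hawkes_process M F lam k N0 N" if "solution M F Q lam k N0 N" for N
      using that by (rule K.solution_hawkes_process)
    show "hawkes_process M F lam ?kp N0 N" if "solution M F Q lam ?kp N0 N" for N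
      using that by (rule KP.solution_hawkes_process)
    show "AE \<omega> in M. \<forall>A\<in>sets borel. emeasure (N \<omega>) A \<le> emeasure (Np \<omega>) A"
      if "solution M F Q lam k N0 N" "solution M F Q lam ?kp N0 Np" for N Np
      using solution_domination[OF k _ that] assms(5) by simp
  qed
qed

end
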